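(* Let $F$ and $B$ be simplicial sets, $G$ a simplicial group acting simplicially on $F$, $\tau=(\tau_p:B_p\to G_{p-1})_{p>0}$ a twisting function, and $F\times_\tau B$ the corresponding twisted product. Then the Eilenberg-Zilber vector field $V_{F\times B}$ of the non-twisted product $F\times B$ can be used as well for the twisted product: the same set of pairs of simplices is a discrete vector field on $C_*(F\times_\tau B)$. It is admissible and therefore defines a homological reduction $$TEZ:\ C_*(F\times_\tau B)\ \Longrightarrow\ C_*(F)\otimes_t C_*(B),$$ where the small chain complex $C_*(F)\otimes_t C_*(B)$ has the same underlying graded module as $C_*(F)\otimes C_*(B)$, only the differential being modified.
   Context: $C_*$ denotes the normalized chain complex of a simplicial set over $\mathbb Z$, with distinguished basis the non-degenerate simplices. Twisted products. A twisting function is a collection of maps $\tau_p:B_p\to G_{p-1}$ ($p>0$) satisfying $\partial_0\tau(b)=\tau(\partial_0b)^{-1}\cdot\tau(\partial_1b)$; $\partial_i\tau(b)=\tau(\partial_{i+1}b)$ for $i>0$; $\eta_i\tau(b)=\tau(\eta_{i+1}b)$ for $i\ge0$; and $\tau(\eta_0b)=e_p$, the neutral element of $G_p$, for $b\in B_p$ ($\partial_i,\eta_i$ denote the face and degeneracy operators). The twisted product $F\times_\tau B$ has $(F\times_\tau B)_p=F_p\times B_p$, with $\partial_0(f,b)=(\tau(b)\cdot\partial_0f,\partial_0b)$, $\partial_i(f,b)=(\partial_if,\partial_ib)$ for $i>0$, and $\eta_i(f,b)=(\eta_if,\eta_ib)$ for all $i$. So $F\times_\tau B$ and $F\times B$ have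 the same simplices and the same non-degenerate simplices. Discrete vector fields. Let $C=(C_p,d_p,\beta_p)_p$ be a chain complex of free $\mathbb Z$-modules with distinguished (possibly infinite) bases $\beta_p$ of "cells". A $(p-1)$-cell $\sigma$ is a face (resp. regular face) of a $p$-cell $\sigma'$ if its coefficient in $d\sigma'$ is nonzero (resp. $\pm1$). A discrete vector field is a set $V$ of pairs $(\sigma,\sigma')$, with $\sigma$ (the source) a regular face of $\sigma'$ (the target), every cell appearing at most once in $V$; cells not appearing are critical. A $V$-path of length $m$ is a sequence $((\sigma_k,\sigma'_k))_{0\le k<m}$ in $V$ with all $\sigma'_k$ of the same degree and, for $0<k<m$, $\sigma_k$ a face of $\sigma'_{k-1}$ different from $\sigma_{k-1}$. $V$ is admissible if for every cell $\sigma$ the lengths of the $V$-paths starting from $\sigma$ are bounded by some integer $\lambda(\sigma)$. Reduction defined by $V$. A reduction $(f,g,h)$ from $\widehat C_*$ to $C_*$ consists of chain maps $f:\widehat C_*\to C_*$, $g:C_*\to\widehat C_*$ and a degree $+1$ map $h$ on $\widehat C_*$ with $fg=\mathrm{id}$, $gf+dh+hd=\mathrm{id}$, $fh=0$, $hg=0$, $hh=0$. If $V$ is admissible, write $C_p=C_p^t\oplus C_p^s\oplus C_p^c$ (spans of the target, source and critical cells), and let $d_{p,i,j}$ be the component of $d_p$ from the $j$-th to the $i$-th summand; then $d_{p,2,1}:C^t_p\to C^s_{p-1}$ is invertible and $V$ defines the reduction of $C$ to $(C^c_*,d')$ with $d'_p=d_{p,3,3}-d_{p,3,1}d_{p,2,1}^{-1}d_{p,2,3}$,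 $f_p=[\,0\ \ -d_{p,3,1}d_{p,2,1}^{-1}\ \ 1\,]$, $g_p={}^t[\,-d_{p,2,1}^{-1}d_{p,2,3}\ \ 0\ \ 1\,]$, and $h_{p-1}$ equal to $d_{p,2,1}^{-1}$ on $C^s_{p-1}$ and $0$ on $C^t_{p-1}\oplus C^c_{p-1}$. Eilenberg-Zilber vector field $V_{F\times B}$. Let $\underline p=\{0,\ldots,p\}$. Every simplex of a simplicial set is uniquely $\alpha^*\phi$ with $\phi$ non-degenerate and $\alpha$ an order-preserving surjection. Let $\rho=(\alpha^*\phi,\beta^*b)$ be a non-degenerate $n$-simplex of $F\times B$, with $\phi\in F_p$, $b\in B_q$ non-degenerate and $\alpha:\underline n\to\underline p$, $\beta:\underline n\to\underline q$ order-preserving surjections. Its path is $\pi(\rho)=((\alpha(i),\beta(i)))_{0\le i\le n}$ in $\underline p\times\underline q$ (first coordinate horizontal, second vertical); it goes from $(0,0)$ to $(p,q)$ with steps $(1,0)$ (horizontal), $(0,1)$ (vertical) or $(1,1)$ (diagonal). Run $\pi(\rho)$ backward from $(p,q)$ to $(0,0)$ and look for the first event, an event being either a diagonal step, or a bend at a point which (in the forward direction) is reached by a vertical step and left by a horizontal step. If the first event is a diagonal step, $\rho$ is a source simplex; if it is such a bend, $\rho$ is a target simplex; if there is no event, $\rho$ is critical, and then $\pi(\rho)=((0,0),\ldots,(p,0),(p,1),\ldots,(p,q))$. $V_{F\times B}$ is the set of pairs $(\rho_1,\rho_2)$, with $\rho_2$ a target simplex and $\rho_1$ the source simplex with the same $\phi,b$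 whose path is obtained from $\pi(\rho_2)$ by removing the bend point which is its first event. The critical simplex associated with non-degenerate $\phi\in F_p$ and $b\in B_q$ is identified with the generator $\phi\otimes b$ of $C_*(F)\otimes C_*(B)$. *)

theory Defs
  imports "HOL-Algebra.Group_Action" "HOL-Algebra.Free_Abelian_Groups"
begin

section \<open>Simplicial sets, simplicial groups and twisted products\<close>

text \<open>
  The operators carry the dimension of their argument: \<open>face X p i\<close> is the \<open>i\<close>-th face operator
  on the \<open>p\<close>-simplices (\<open>p > 0\<close>, \<open>i \<le> p\<close>) and \<open>degen X p i\<close> the \<open>i\<close>-th degeneracy operator on
  them (\<open>i \<le> p\<close>). The carriers of different dimensions are allowed to overlap.
\<close>

record 'a sset =
  simplices :: "nat \<Rightarrow> 'a set"
  face :: "nat \<Rightarrow> nat \<Rightarrow> 'a \<Rightarrow> 'a"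
  degen :: "nat \<Rightarrow> nat \<Rightarrow> 'a \<Rightarrow> 'a"

locale simplicial_set =
  fixes X :: "('a, 'm) sset_scheme"
  assumes face_closed:
      "\<lbrakk>x \<in> simplices X (Suc p); i \<le> Suc p\<rbrakk> \<Longrightarrow> face X (Suc p) i x \<in> simplices X p"
    and degen_closed:
      "\<lbrakk>x \<in> simplices X p; i \<le> p\<rbrakk> \<Longrightarrow> degen X p i x \<in> simplices X (Suc p)"
    and face_face:
      "\<lbrakk>x \<in> simplices X (Suc (Suc p)); i < j; j \<le> Suc (Suc p)\<rbrakk> \<Longrightarrow>
        face X (Suc p) i (face X (Suc (Suc p)) j x)
          = face X (Suc p) (j - 1) (face X (Suc (Suc p)) i x)"
    and degen_degen:
      "\<lbrakk>x \<in> simplices X p; i \<le> j; j \<le> p\<rbrakk> \<Longrightarrow>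
        degen X (Suc p) i (degen X p j x) = degen X (Suc p) (Suc j) (degen X p i x)"
    and face_degen_less:
      "\<lbrakk>x \<in> simplices X p; i < j; j \<le> p\<rbrakk> \<Longrightarrow>
        face X (Suc p) i (degen X p j x) = degen X (p - 1) (j - 1) (face X p i x)"
    and face_degen_same:
      "\<lbrakk>x \<in> simplices X p; j \<le> p\<rbrakk> \<Longrightarrow> face X (Suc p) j (degen X p j x) = x"
    and face_degen_Suc:
      "\<lbrakk>x \<in> simplices X p; j \<le> p\<rbrakk> \<Longrightarrow> face X (Suc p) (Suc j) (degen X p j x) = x"
    and face_degen_greater:
      "\<lbrakk>x \<in> simplices X p; Suc j < i; i \<le> Suc p\<rbrakk> \<Longrightarrow>
        face X (Suc p) i (degen X p j x) = degen X (p - 1) j (face X p (i - 1) x)"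

record 'g sgroup = "'g sset" +
  grp :: "nat \<Rightarrow> 'g monoid"

locale simplicial_group = simplicial_set G
  for G :: "('g, 'm) sgroup_scheme" +
  assumes group_grp: "group (grp G p)"
    and carrier_grp: "carrier (grp G p) = simplices G p"
    and face_hom: "i \<le> Suc p \<Longrightarrow> face G (Suc p) i \<in> hom (grp G (Suc p)) (grp G p)"
    and degen_hom: "i \<le> p \<Longrightarrow> degen G p i \<in> hom (grp G p) (grp G (Suc p))"

locale simplicial_action =
  fixes G :: "('g, 'm) sgroup_scheme" and F :: "('f, 'n) sset_scheme"
    and act :: "nat \<Rightarrow> 'g \<Rightarrow> 'f \<Rightarrow> 'f"
  assumes action: "group_action (grp G p) (simplices F p) (act p)"
    and face_act:
      "\<lbrakk>g \<in> simplices G (Suc p); x \<in> simplices F (Suc p); i \<le> Suc p\<rbrakk> \<Longrightarrow>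
        face F (Suc p) i (act (Suc p) g x) = act p (face G (Suc p) i g) (face F (Suc p) i x)"
    and degen_act:
      "\<lbrakk>g \<in> simplices G p; x \<in> simplices F p; i \<le> p\<rbrakk> \<Longrightarrow>
        degen F p i (act p g x) = act (Suc p) (degen G p i g) (degen F p i x)"

text \<open>
  \<open>\<tau> p\<close> is only meaningful for \<open>p > 0\<close>. The two face conditions compare elements of the group in
  dimension \<open>p - 2\<close>, hence concern simplices of dimension at least 2.
\<close>

locale twisting_function =
  fixes B :: "('b, 'm) sset_scheme" and G :: "('g, 'n) sgroup_scheme"
    and \<tau> :: "nat \<Rightarrow> 'b \<Rightarrow> 'g"
  assumes twist_closed: "b \<in> simplices B (Suc p) \<Longrightarrow> \<tau> (Suc p) b \<in> simplices G p"
    and face_0_twist: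
      "b \<in> simplices B (Suc (Suc p)) \<Longrightarrow>
        face G (Suc p) 0 (\<tau> (Suc (Suc p)) b)
          = (inv\<^bsub>grp G p\<^esub> (\<tau> (Suc p) (face B (Suc (Suc p)) 0 b)))
              \<otimes>\<^bsub>grp G p\<^esub> \<tau> (Suc p) (face B (Suc (Suc p)) 1 b)"
    and face_twist:
      "\<lbrakk>b \<in> simplices B (Suc (Suc p)); 0 < i; i \<le> Suc p\<rbrakk> \<Longrightarrow>
        face G (Suc p) i (\<tau> (Suc (Suc p)) b) = \<tau> (Suc p) (face B (Suc (Suc p)) (Suc i) b)"
    and degen_twist:
      "\<lbrakk>b \<in> simplices B (Suc p); i \<le> p\<rbrakk> \<Longrightarrow>
        degen G p i (\<tau> (Suc p) b) = \<tau> (Suc (Suc p)) (degen B (Suc p) (Suc i) b)"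
    and twist_degen_0: "b \<in> simplices B p \<Longrightarrow> \<tau> (Suc p) (degen B p 0 b) = \<one>\<^bsub>grp G p\<^esub>"

definition product_sset :: "'f sset \<Rightarrow> 'b sset \<Rightarrow> ('f \<times> 'b) sset" where
  "product_sset F B =
    \<lparr>simplices = (\<lambda>p. simplices F p \<times> simplices B p),
     face = (\<lambda>p i (f, b). (face F p i f, face B p i b)),
     degen = (\<lambda>p i (f, b). (degen F p i f, degen B p i b))\<rparr>"

definition twisted_product ::
  "'f sset \<Rightarrow> 'b sset \<Rightarrow> (nat \<Rightarrow> 'g \<Rightarrow> 'f \<Rightarrow> 'f) \<Rightarrow> (nat \<Rightarrow> 'b \<Rightarrow> 'g) \<Rightarrow> ('f \<times> 'b) sset" where
  "twisted_product F B act \<tau> =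
    \<lparr>simplices = (\<lambda>p. simplices F p \<times> simplices B p),
     face = (\<lambda>p i (f, b).
       (if i = 0 then act (p - 1) (\<tau> p b) (face F p 0 f) else face F p i f, face B p i b)),
     degen = (\<lambda>p i (f, b). (degen F p i f, degen B p i b))\<rparr>"

definition nondegenerate :: "('a, 'm) sset_scheme \<Rightarrow> nat \<Rightarrow> 'a set" where
  "nondegenerate X p =
    {x \<in> simplices X p. \<not> (\<exists>q i y. p = Suc q \<and> i \<le> q \<and> y \<in> simplices X q \<and> x = degen X q i y)}"


section \<open>Chain complexes with distinguished bases\<close>

text \<open>
  The module in degree \<open>p\<close> is \<open>free_Abelian_group (cells C p)\<close>; there is nothing in negative
  degrees, so the differential in degree 0 vanishes.
\<close>

record 'a based_cpx =
  cells :: "nat \<Rightarrow> 'a set"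
  bdry :: "nat \<Rightarrow> ('a \<Rightarrow>\<^sub>0 int) \<Rightarrow> ('a \<Rightarrow>\<^sub>0 int)"

abbreviation chain_group :: "'a based_cpx \<Rightarrow> nat \<Rightarrow> ('a \<Rightarrow>\<^sub>0 int) monoid" where
  "chain_group C p \<equiv> free_Abelian_group (cells C p)"

definition chain_complex :: "'a based_cpx \<Rightarrow> bool" where
  "chain_complex C \<longleftrightarrow>
    (\<forall>p. bdry C (Suc p) \<in> hom (chain_group C (Suc p)) (chain_group C p)) \<and>
    (\<forall>c \<in> carrier (chain_group C 0). bdry C 0 c = 0) \<and>
    (\<forall>p. \<forall>c \<in> carrier (chain_group C (Suc p)). bdry C p (bdry C (Suc p) c) = 0)"

definition normalized_chains :: "('a, 'm) sset_scheme \<Rightarrow> 'a based_cpx" where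
  "normalized_chains X =
    \<lparr>cells = nondegenerate X,
     bdry = (\<lambda>p. frag_extend (\<lambda>x. if p = 0 then 0 else
       (\<Sum>i\<le>p. frag_cmul ((-1) ^ i)
         (if face X p i x \<in> nondegenerate X (p - 1) then frag_of (face X p i x) else 0))))\<rparr>"

text \<open>
  The generator \<open>x \<otimes> y\<close> is encoded as \<open>((p, x), (q, y))\<close>, with \<open>p\<close> and \<open>q\<close> the degrees of \<open>x\<close>
  and \<open>y\<close>. The boundary of \<open>x \<otimes> y\<close> is \<open>dx \<otimes> y + (-1)^p x \<otimes> dy\<close>.
\<close>

definition tensor_cpx ::
  "'a based_cpx \<Rightarrow> 'b based_cpx \<Rightarrow> ((nat \<times> 'a) \<times> (nat \<times> 'b)) based_cpx" where
  "tensor_cpx C D =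
    \<lparr>cells = (\<lambda>n. {((p, x), (q, y)) | p x q y. p + q = n \<and> x \<in> cells C p \<and> y \<in> cells D q}),
     bdry = (\<lambda>n. frag_extend (\<lambda>((p, x), (q, y)).
       frag_extend (\<lambda>x'. frag_of ((p - 1, x'), (q, y))) (bdry C p (frag_of x)) +
       frag_cmul ((-1) ^ p)
         (frag_extend (\<lambda>y'. frag_of ((p, x), (q - 1, y'))) (bdry D q (frag_of y)))))\<rparr>"

text \<open>
  In degree 0 the term \<open>h (p - 1) (bdry C p c)\<close> is \<open>h 0 0 = 0\<close>, as it should be.
\<close>

definition reduction ::
  "'a based_cpx \<Rightarrow> 'b based_cpx \<Rightarrow> (nat \<Rightarrow> ('a \<Rightarrow>\<^sub>0 int) \<Rightarrow> ('b \<Rightarrow>\<^sub>0 int)) \<Rightarrow>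
    (nat \<Rightarrow> ('b \<Rightarrow>\<^sub>0 int) \<Rightarrow> ('a \<Rightarrow>\<^sub>0 int)) \<Rightarrow> (nat \<Rightarrow> ('a \<Rightarrow>\<^sub>0 int) \<Rightarrow> ('a \<Rightarrow>\<^sub>0 int)) \<Rightarrow> bool" where
  "reduction C D f g h \<longleftrightarrow>
    chain_complex C \<and> chain_complex D \<and>
    (\<forall>p. f p \<in> hom (chain_group C p) (chain_group D p)) \<and>
    (\<forall>p. g p \<in> hom (chain_group D p) (chain_group C p)) \<and>
    (\<forall>p. h p \<in> hom (chain_group C p) (chain_group C (Suc p))) \<and>
    (\<forall>p. \<forall>c \<in> carrier (chain_group C (Suc p)).
      f p (bdry C (Suc p) c) = bdry D (Suc p) (f (Suc p) c)) \<and>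
    (\<forall>p. \<forall>c \<in> carrier (chain_group D (Suc p)).
      g p (bdry D (Suc p) c) = bdry C (Suc p) (g (Suc p) c)) \<and>
    (\<forall>p. \<forall>c \<in> carrier (chain_group D p). f p (g p c) = c) \<and>
    (\<forall>p. \<forall>c \<in> carrier (chain_group C p).
      g p (f p c) + bdry C (Suc p) (h p c) + h (p - 1) (bdry C p c) = c) \<and>
    (\<forall>p. \<forall>c \<in> carrier (chain_group C p). f (Suc p) (h p c) = 0) \<and>
    (\<forall>p. \<forall>c \<in> carrier (chain_group D p). h p (g p c) = 0) \<and>
    (\<forall>p. \<forall>c \<in> carrier (chain_group C p). h (Suc p) (h p c) = 0)"


section \<open>Discrete vector fields\<close>

definition is_face :: "'a based_cpx \<Rightarrow> nat \<Rightarrow> 'a \<Rightarrow> 'a \<Rightarrow> bool" where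
  "is_face C p s t \<longleftrightarrow>
    s \<in> cells C p \<and> t \<in> cells C (Suc p) \<and>
    Poly_Mapping.lookup (bdry C (Suc p) (frag_of t)) s \<noteq> 0"

definition is_regular_face :: "'a based_cpx \<Rightarrow> nat \<Rightarrow> 'a \<Rightarrow> 'a \<Rightarrow> bool" where
  "is_regular_face C p s t \<longleftrightarrow>
    s \<in> cells C p \<and> t \<in> cells C (Suc p) \<and>
    Poly_Mapping.lookup (bdry C (Suc p) (frag_of t)) s \<in> {1, -1}"

text \<open>
  A vector field is given degreewise: \<open>V p\<close> contains the pairs whose source has degree \<open>p\<close> and
  whose target has degree \<open>p + 1\<close>. A cell of degree \<open>p + 1\<close> can thus appear in \<open>V (p + 1)\<close> as a
  source and in \<open>V p\<close> as a target.
\<close>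

definition discrete_vector_field :: "'a based_cpx \<Rightarrow> (nat \<Rightarrow> ('a \<times> 'a) set) \<Rightarrow> bool" where
  "discrete_vector_field C V \<longleftrightarrow>
    (\<forall>p. \<forall>(s, t) \<in> V p. is_regular_face C p s t) \<and>
    (\<forall>p. inj_on fst (V p) \<and> inj_on snd (V p) \<and> fst ` V (Suc p) \<inter> snd ` V p = {})"

definition V_path :: "'a based_cpx \<Rightarrow> (nat \<Rightarrow> ('a \<times> 'a) set) \<Rightarrow> nat \<Rightarrow> ('a \<times> 'a) list \<Rightarrow> bool" where
  "V_path C V p xs \<longleftrightarrow>
    set xs \<subseteq> V p \<and>
    (\<forall>k. Suc k < length xs \<longrightarrow>
      is_face C p (fst (xs ! Suc k)) (snd (xs ! k)) \<and> fst (xs ! Suc k) \<noteq> fst (xs ! k))"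

definition admissible_field :: "'a based_cpx \<Rightarrow> (nat \<Rightarrow> ('a \<times> 'a) set) \<Rightarrow> bool" where
  "admissible_field C V \<longleftrightarrow>
    (\<forall>p. \<forall>s \<in> cells C p. \<exists>l :: nat. \<forall>xs.
      V_path C V p xs \<and> xs \<noteq> [] \<and> fst (hd xs) = s \<longrightarrow> length xs \<le> l)"

definition source_cells :: "(nat \<Rightarrow> ('a \<times> 'a) set) \<Rightarrow> nat \<Rightarrow> 'a set" where
  "source_cells V p = fst ` V p"

definition target_cells :: "(nat \<Rightarrow> ('a \<times> 'a) set) \<Rightarrow> nat \<Rightarrow> 'a set" where
  "target_cells V p = (case p of 0 \<Rightarrow> {} | Suc q \<Rightarrow> snd ` V q)"

definition critical_cells :: "'a based_cpx \<Rightarrow> (nat \<Rightarrow> ('a \<times> 'a) set) \<Rightarrow> nat \<Rightarrow> 'a set" where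
  "critical_cells C V p = cells C p - (source_cells V p \<union> target_cells V p)"

definition span_proj :: "'a set \<Rightarrow> ('a \<Rightarrow>\<^sub>0 int) \<Rightarrow> ('a \<Rightarrow>\<^sub>0 int)" where
  "span_proj S = frag_extend (\<lambda>x. if x \<in> S then frag_of x else 0)"

text \<open>
  \<open>d21 C V p\<close> is the component of the differential from the span of the target cells of degree \<open>p\<close>
  to the span of the source cells of degree \<open>p - 1\<close>, and \<open>d21_inv C V p\<close> is its inverse. The
  formulas below are the usual ones for a block \<open>d21\<close> of the differential that is invertible:
  \<open>d' = d33 - d31 d21\<^sup>-\<^sup>1 d23\<close>, \<open>f = [0, - d31 d21\<^sup>-\<^sup>1, 1]\<close>, \<open>g = [- d21\<^sup>-\<^sup>1 d23, 0, 1]\<^sup>T\<close> and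
  \<open>h = d21\<^sup>-\<^sup>1\<close> on source cells. In \<open>f\<close> and \<open>h\<close> the inverse goes from degree \<open>p\<close> to \<open>p + 1\<close>, so
  the blocks of the differential of degree \<open>p + 1\<close> occur there. In degree 0, the differential
  being zero, \<open>p - 1 = 0\<close> is harmless.
\<close>

definition d21 :: "'a based_cpx \<Rightarrow> (nat \<Rightarrow> ('a \<times> 'a) set) \<Rightarrow> nat \<Rightarrow> ('a \<Rightarrow>\<^sub>0 int) \<Rightarrow> ('a \<Rightarrow>\<^sub>0 int)" where
  "d21 C V p c = span_proj (source_cells V (p - 1)) (bdry C p c)"

definition d21_inv :: "'a based_cpx \<Rightarrow> (nat \<Rightarrow> ('a \<times> 'a) set) \<Rightarrow> nat \<Rightarrow> ('a \<Rightarrow>\<^sub>0 int) \<Rightarrow> ('a \<Rightarrow>\<^sub>0 int)" where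
  "d21_inv C V p = inv_into (carrier (free_Abelian_group (target_cells V p))) (d21 C V p)"

definition critical_cpx :: "'a based_cpx \<Rightarrow> (nat \<Rightarrow> ('a \<times> 'a) set) \<Rightarrow> 'a based_cpx" where
  "critical_cpx C V =
    \<lparr>cells = critical_cells C V,
     bdry = (\<lambda>p c.
       span_proj (critical_cells C V (p - 1)) (bdry C p c)
       - span_proj (critical_cells C V (p - 1)) (bdry C p
           (d21_inv C V p (span_proj (source_cells V (p - 1)) (bdry C p c)))))\<rparr>"

definition field_f :: "'a based_cpx \<Rightarrow> (nat \<Rightarrow> ('a \<times> 'a) set) \<Rightarrow> nat \<Rightarrow> ('a \<Rightarrow>\<^sub>0 int) \<Rightarrow> ('a \<Rightarrow>\<^sub>0 int)" where
  "field_f C V p c =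
    span_proj (critical_cells C V p) c
    - span_proj (critical_cells C V p) (bdry C (Suc p)
        (d21_inv C V (Suc p) (span_proj (source_cells V p) c)))"

definition field_g :: "'a based_cpx \<Rightarrow> (nat \<Rightarrow> ('a \<times> 'a) set) \<Rightarrow> nat \<Rightarrow> ('a \<Rightarrow>\<^sub>0 int) \<Rightarrow> ('a \<Rightarrow>\<^sub>0 int)" where
  "field_g C V p c = c - d21_inv C V p (span_proj (source_cells V (p - 1)) (bdry C p c))"

definition field_h :: "'a based_cpx \<Rightarrow> (nat \<Rightarrow> ('a \<times> 'a) set) \<Rightarrow> nat \<Rightarrow> ('a \<Rightarrow>\<^sub>0 int) \<Rightarrow> ('a \<Rightarrow>\<^sub>0 int)" where
  "field_h C V p c = d21_inv C V (Suc p) (span_proj (source_cells V p) c)"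


section \<open>The Eilenberg-Zilber vector field\<close>

text \<open>
  An order-preserving surjection \<open>\<alpha>\<close> from \<open>{0..n}\<close> to \<open>{0..p}\<close> is a function on \<open>nat\<close> of which only
  the values on \<open>{..n}\<close> matter. If \<open>i\<^sub>1 < ... < i\<^sub>k\<close> are the indices \<open>i < n\<close> with
  \<open>\<alpha> i = \<alpha> (i + 1)\<close>, the operator induced by \<open>\<alpha>\<close> applies the degeneracies of indices
  \<open>i\<^sub>1\<close>, ..., \<open>i\<^sub>k\<close> in this order.
\<close>

definition mono_surj :: "nat \<Rightarrow> nat \<Rightarrow> (nat \<Rightarrow> nat) \<Rightarrow> bool" where
  "mono_surj n p \<alpha> \<longleftrightarrow> mono_on {..n} \<alpha> \<and> \<alpha> ` {..n} = {..p}"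

fun degens :: "('a, 'm) sset_scheme \<Rightarrow> nat \<Rightarrow> nat list \<Rightarrow> 'a \<Rightarrow> 'a" where
  "degens X p [] x = x"
| "degens X p (i # is) x = degens X (Suc p) is (degen X p i x)"

definition surj_pullback :: "('a, 'm) sset_scheme \<Rightarrow> nat \<Rightarrow> nat \<Rightarrow> (nat \<Rightarrow> nat) \<Rightarrow> 'a \<Rightarrow> 'a" where
  "surj_pullback X n p \<alpha> x = degens X p (filter (\<lambda>i. \<alpha> i = \<alpha> (Suc i)) [0..<n]) x"

definition EZ_path ::
  "'f sset \<Rightarrow> 'b sset \<Rightarrow> nat \<Rightarrow> 'f \<times> 'b \<Rightarrow> nat \<Rightarrow> 'f \<Rightarrow> nat \<Rightarrow> 'b \<Rightarrow> (nat \<times> nat) list \<Rightarrow> bool" where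
  "EZ_path F B n \<rho> p \<phi> q b \<pi> \<longleftrightarrow>
    \<rho> \<in> nondegenerate (product_sset F B) n \<and>
    \<phi> \<in> nondegenerate F p \<and> b \<in> nondegenerate B q \<and>
    (\<exists>\<alpha> \<beta>. mono_surj n p \<alpha> \<and> mono_surj n q \<beta> \<and>
      \<rho> = (surj_pullback F n p \<alpha> \<phi>, surj_pullback B n q \<beta> b) \<and>
      \<pi> = map (\<lambda>i. (\<alpha> i, \<beta> i)) [0..<Suc n])"

definition h_step :: "(nat \<times> nat) list \<Rightarrow> nat \<Rightarrow> bool" where
  "h_step \<pi> k \<longleftrightarrow> Suc k < length \<pi> \<and> \<pi> ! Suc k = (Suc (fst (\<pi> ! k)), snd (\<pi> ! k))"

definition v_step :: "(nat \<times> nat) list \<Rightarrow> nat \<Rightarrow> bool" where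
  "v_step \<pi> k \<longleftrightarrow> Suc k < length \<pi> \<and> \<pi> ! Suc k = (fst (\<pi> ! k), Suc (snd (\<pi> ! k)))"

definition diag_step :: "(nat \<times> nat) list \<Rightarrow> nat \<Rightarrow> bool" where
  "diag_step \<pi> k \<longleftrightarrow> Suc k < length \<pi> \<and> \<pi> ! Suc k = (Suc (fst (\<pi> ! k)), Suc (snd (\<pi> ! k)))"

definition bend :: "(nat \<times> nat) list \<Rightarrow> nat \<Rightarrow> bool" where
  "bend \<pi> k \<longleftrightarrow> 0 < k \<and> v_step \<pi> (k - 1) \<and> h_step \<pi> k"

text \<open>
  The path is run backward, so the first event is the one with the largest index. A diagonal step
  from the \<open>k\<close>-th point to the next one gets the index \<open>k\<close>; since the steps around a bend point are
  not diagonal, two events never have the same index.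
\<close>

definition first_event :: "(nat \<times> nat) list \<Rightarrow> nat \<Rightarrow> bool" where
  "first_event \<pi> k \<longleftrightarrow>
    (diag_step \<pi> k \<or> bend \<pi> k) \<and> (\<forall>j>k. \<not> diag_step \<pi> j \<and> \<not> bend \<pi> j)"

definition EZ_field :: "'f sset \<Rightarrow> 'b sset \<Rightarrow> nat \<Rightarrow> (('f \<times> 'b) \<times> ('f \<times> 'b)) set" where
  "EZ_field F B n =
    {(\<rho>\<^sub>1, \<rho>\<^sub>2). \<exists>p \<phi> q b \<pi>\<^sub>1 \<pi>\<^sub>2.
      EZ_path F B n \<rho>\<^sub>1 p \<phi> q b \<pi>\<^sub>1 \<and> EZ_path F B (Suc n) \<rho>\<^sub>2 p \<phi> q b \<pi>\<^sub>2 \<and>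
      (\<exists>j. first_event \<pi>\<^sub>1 j \<and> diag_step \<pi>\<^sub>1 j) \<and>
      (\<exists>k. first_event \<pi>\<^sub>2 k \<and> bend \<pi>\<^sub>2 k \<and> \<pi>\<^sub>1 = take k \<pi>\<^sub>2 @ drop (Suc k) \<pi>\<^sub>2)}"

text \<open>
  The critical simplex identified with \<open>\<phi> \<otimes> b\<close>: its path goes horizontally from \<open>(0, 0)\<close> to
  \<open>(p, 0)\<close> and then vertically to \<open>(p, q)\<close>.
\<close>

fun critical_simplex :: "'f sset \<Rightarrow> 'b sset \<Rightarrow> (nat \<times> 'f) \<times> (nat \<times> 'b) \<Rightarrow> 'f \<times> 'b" where
  "critical_simplex F B ((p, \<phi>), (q, b)) =
    (surj_pullback F (p + q) p (\<lambda>i. min i p) \<phi>, surj_pullback B (p + q) q (\<lambda>i. i - p) b)"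


section \<open>The twisted Eilenberg-Zilber reduction\<close>

abbreviation twisted_chains ::
  "'f sset \<Rightarrow> 'b sset \<Rightarrow> (nat \<Rightarrow> 'g \<Rightarrow> 'f \<Rightarrow> 'f) \<Rightarrow> (nat \<Rightarrow> 'b \<Rightarrow> 'g) \<Rightarrow> ('f \<times> 'b) based_cpx" where
  "twisted_chains F B act \<tau> \<equiv> normalized_chains (twisted_product F B act \<tau>)"

text \<open>
  The critical complex and the maps of the reduction are transported along the bijection
  \<open>critical_simplex\<close> between the generators of the tensor product and the critical simplices.
\<close>

definition from_tensor ::
  "'f sset \<Rightarrow> 'b sset \<Rightarrow> (((nat \<times> 'f) \<times> (nat \<times> 'b)) \<Rightarrow>\<^sub>0 int) \<Rightarrow> (('f \<times> 'b) \<Rightarrow>\<^sub>0 int)" where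
  "from_tensor F B = frag_extend (\<lambda>x. frag_of (critical_simplex F B x))"

definition to_tensor ::
  "'f sset \<Rightarrow> 'b sset \<Rightarrow> nat \<Rightarrow> (('f \<times> 'b) \<Rightarrow>\<^sub>0 int) \<Rightarrow> (((nat \<times> 'f) \<times> (nat \<times> 'b)) \<Rightarrow>\<^sub>0 int)" where
  "to_tensor F B n = frag_extend (\<lambda>\<rho>. frag_of
    (inv_into (cells (tensor_cpx (normalized_chains F) (normalized_chains B)) n)
      (critical_simplex F B) \<rho>))"

definition twisted_tensor ::
  "'f sset \<Rightarrow> 'b sset \<Rightarrow> (nat \<Rightarrow> 'g \<Rightarrow> 'f \<Rightarrow> 'f) \<Rightarrow> (nat \<Rightarrow> 'b \<Rightarrow> 'g) \<Rightarrow>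
    ((nat \<times> 'f) \<times> (nat \<times> 'b)) based_cpx" where
  "twisted_tensor F B act \<tau> =
    (tensor_cpx (normalized_chains F) (normalized_chains B))
      \<lparr>bdry := (\<lambda>n c. to_tensor F B (n - 1)
        (bdry (critical_cpx (twisted_chains F B act \<tau>) (EZ_field F B)) n (from_tensor F B c)))\<rparr>"

definition TEZ_f ::
  "'f sset \<Rightarrow> 'b sset \<Rightarrow> (nat \<Rightarrow> 'g \<Rightarrow> 'f \<Rightarrow> 'f) \<Rightarrow> (nat \<Rightarrow> 'b \<Rightarrow> 'g) \<Rightarrow>
    nat \<Rightarrow> (('f \<times> 'b) \<Rightarrow>\<^sub>0 int) \<Rightarrow> (((nat \<times> 'f) \<times> (nat \<times> 'b)) \<Rightarrow>\<^sub>0 int)" where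
  "TEZ_f F B act \<tau> n c =
    to_tensor F B n (field_f (twisted_chains F B act \<tau>) (EZ_field F B) n c)"

definition TEZ_g ::
  "'f sset \<Rightarrow> 'b sset \<Rightarrow> (nat \<Rightarrow> 'g \<Rightarrow> 'f \<Rightarrow> 'f) \<Rightarrow> (nat \<Rightarrow> 'b \<Rightarrow> 'g) \<Rightarrow>
    nat \<Rightarrow> (((nat \<times> 'f) \<times> (nat \<times> 'b)) \<Rightarrow>\<^sub>0 int) \<Rightarrow> (('f \<times> 'b) \<Rightarrow>\<^sub>0 int)" where
  "TEZ_g F B act \<tau> n c =
    field_g (twisted_chains F B act \<tau>) (EZ_field F B) n (from_tensor F B c)"

definition TEZ_h ::
  "'f sset \<Rightarrow> 'b sset \<Rightarrow> (nat \<Rightarrow> 'g \<Rightarrow> 'f \<Rightarrow> 'f) \<Rightarrow> (nat \<Rightarrow> 'b \<Rightarrow> 'g) \<Rightarrow>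
    nat \<Rightarrow> (('f \<times> 'b) \<Rightarrow>\<^sub>0 int) \<Rightarrow> (('f \<times> 'b) \<Rightarrow>\<^sub>0 int)" where
  "TEZ_h F B act \<tau> = field_h (twisted_chains F B act \<tau>) (EZ_field F B)"

end

theory Submission
  imports Defs
begin

text \<open>
  A simplex of the product is a pair of iterated degeneracies of non-degenerate simplices, hence is
  determined by these two simplices and by the two sets of degeneracy indices, which together describe
  its lattice path. Removing the bend of a target simplex is an inner face operator, so it is not
  affected by the twisting. For another face of the target simplex that is a source simplex, either the
  dimension of the base component drops; or it stays the same, the twisting is trivial, and the
  dimension of the fibre component drops; or the face cuts a corner of the path made of a horizontal
  and then a vertical step, and the area below the path is larger than for the source that belongs to
  the target. The area is bounded, so a lexicographic measure bounds the lengths of the paths of the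
  vector field. This makes the component of the differential from target cells to source cells
  triangular, with \<open>1\<close> or \<open>-1\<close> on the diagonal, hence invertible; the reduction is then Gaussian
  elimination.
\<close>

section \<open>Homomorphisms of free abelian groups\<close>

text \<open>Twisting can do harm only in the fibre component of the face of index 0: a group element
  acts there, and nothing is known about the degeneracies of the result. This is why the dimension
  of the base component comes first in the measure. If the face lowers it, the comparison is settled
  whatever the fibre has become; if not, the base component is a degeneracy of index 0, on which a
  twisting function takes the neutral element. When both dimensions are kept, the face removes a
  point between a vertical and a horizontal step. Such a point may also be an earlier bend, but then
  the last bend survives and the face is a target, so it never competes with the source. For the
  other kind of corner the areas are compared through the target: its own source loses half a unit
  square, the competing face gains half. The strict decrease gives more than bounded paths: no
  second face of a target can coincide with its source, hence the incidence is a single sign, as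
  regularity requires. Sets of degeneracy indices are used in place of surjections because faces and
  degeneracies act on them by explicit reindexing.\<close>

lemma hom_free_keys:
  assumes "f \<in> hom (free_Abelian_group S) (free_Abelian_group T)" "Poly_Mapping.keys c \<subseteq> S"
  shows "Poly_Mapping.keys (f c) \<subseteq> T"
  using hom_in_carrier[OF assms(1), of c] assms(2) by simp

lemma hom_free_add:
  assumes "f \<in> hom (free_Abelian_group S) (free_Abelian_group T)"
    "Poly_Mapping.keys a \<subseteq> S" "Poly_Mapping.keys b \<subseteq> S"
  shows "f (a + b) = f a + f b"
  using hom_mult[OF assms(1), of a b] assms(2,3) by simp

lemma hom_free_zero:
  assumes "f \<in> hom (free_Abelian_group S) (free_Abelian_group T)"
  shows "f 0 = 0"
  using hom_free_add[OF assms, of 0 0] by simp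

lemma keys_diff_subset:
  fixes a b :: "'a \<Rightarrow>\<^sub>0 int"
  shows "Poly_Mapping.keys a \<subseteq> S \<Longrightarrow> Poly_Mapping.keys b \<subseteq> S \<Longrightarrow> Poly_Mapping.keys (a - b) \<subseteq> S"
  using keys_diff[of a b] by blast

lemma keys_add_subset:
  fixes a b :: "'a \<Rightarrow>\<^sub>0 int"
  shows "Poly_Mapping.keys a \<subseteq> S \<Longrightarrow> Poly_Mapping.keys b \<subseteq> S \<Longrightarrow> Poly_Mapping.keys (a + b) \<subseteq> S"
  using keys_add[of a b] by blast

lemma hom_free_diff:
  assumes "f \<in> hom (free_Abelian_group S) (free_Abelian_group T)"
    "Poly_Mapping.keys a \<subseteq> S" "Poly_Mapping.keys b \<subseteq> S"
  shows "f (a - b) = f a - f b"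
  using hom_free_add[OF assms(1), of "a - b" b] assms(2,3) keys_diff_subset[OF assms(2,3)]
  by (simp add: algebra_simps)

lemma hom_freeI:
  assumes "\<And>c. Poly_Mapping.keys c \<subseteq> S \<Longrightarrow> Poly_Mapping.keys (f c) \<subseteq> T"
    and "\<And>a b. Poly_Mapping.keys a \<subseteq> S \<Longrightarrow> Poly_Mapping.keys b \<subseteq> S \<Longrightarrow> f (a + b) = f a + f b"
  shows "f \<in> hom (free_Abelian_group S) (free_Abelian_group T)"
  using assms by (auto intro!: homI)

lemma hom_free_comp:
  assumes "f \<in> hom (free_Abelian_group S) (free_Abelian_group T)"
    "g \<in> hom (free_Abelian_group T) (free_Abelian_group U)"
  shows "(\<lambda>c. g (f c)) \<in> hom (free_Abelian_group S) (free_Abelian_group U)"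
  using assms by (intro hom_freeI) (simp_all add: hom_free_keys hom_free_add)

lemma hom_free_minus:
  assumes "f \<in> hom (free_Abelian_group S) (free_Abelian_group T)"
    "g \<in> hom (free_Abelian_group S) (free_Abelian_group T)"
  shows "(\<lambda>c. f c - g c) \<in> hom (free_Abelian_group S) (free_Abelian_group T)"
  using assms by (intro hom_freeI) (simp_all add: hom_free_keys hom_free_add keys_diff_subset)

lemma hom_free_id:
  assumes "S \<subseteq> T"
  shows "(\<lambda>c. c) \<in> hom (free_Abelian_group S) (free_Abelian_group T)"
  using assms by (intro hom_freeI) auto

lemma hom_free_mono:
  assumes "f \<in> hom (free_Abelian_group S) (free_Abelian_group T)" "S' \<subseteq> S" "T \<subseteq> T'"
  shows "f \<in> hom (free_Abelian_group S') (free_Abelian_group T')"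
  using hom_free_comp[OF hom_free_comp[OF hom_free_id[OF assms(2)] assms(1)] hom_free_id[OF assms(3)]]
  by simp

lemma frag_extend_hom:
  assumes "\<And>x. x \<in> S \<Longrightarrow> Poly_Mapping.keys (b x) \<subseteq> T"
  shows "frag_extend b \<in> hom (free_Abelian_group S) (free_Abelian_group T)"
proof (rule hom_freeI)
  fix c :: "'a \<Rightarrow>\<^sub>0 int" assume "Poly_Mapping.keys c \<subseteq> S"
  with assms show "Poly_Mapping.keys (frag_extend b c) \<subseteq> T"
    using keys_frag_extend[of b c] by blast
qed (simp add: frag_extend_add)

lemma hom_free_eqI:
  assumes f: "f \<in> hom (free_Abelian_group S) (free_Abelian_group T)"
    and g: "g \<in> hom (free_Abelian_group S) (free_Abelian_group T)"
    and eq: "\<And>x. x \<in> S \<Longrightarrow> f (frag_of x) = g (frag_of x)"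
    and c: "Poly_Mapping.keys c \<subseteq> S"
  shows "f c = g c"
proof -
  \<comment> \<open>The difference case of the induction says nothing about the supports of its two
    terms, so the support condition is made part of the claim.\<close>
  have "Poly_Mapping.keys c \<subseteq> S \<and> f c = g c"
    using c
  proof (induction c rule: frag_induction)
    case zero
    show ?case using hom_free_zero[OF f] hom_free_zero[OF g] by simp
  next
    case (diff a b)
    then show ?case
      by (simp add: hom_free_diff[OF f] hom_free_diff[OF g] keys_diff_subset)
  qed (use eq in simp)
  then show ?thesis by simp
qed

lemma hom_free_eq_frag_extend:
  assumes f: "f \<in> hom (free_Abelian_group S) (free_Abelian_group T)"
    and c: "Poly_Mapping.keys c \<subseteq> S"
  shows "f c = frag_extend (\<lambda>x. f (frag_of x)) c"
proof (rule hom_free_eqI[OF f _ _ c])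
  show "frag_extend (\<lambda>x. f (frag_of x)) \<in> hom (free_Abelian_group S) (free_Abelian_group T)"
    by (rule frag_extend_hom) (simp add: hom_free_keys[OF f])
qed simp

section \<open>Coefficients and projections onto spans of generators\<close>

lemma lookup_frag_extend:
  "Poly_Mapping.lookup (frag_extend b c) y =
    (\<Sum>x \<in> Poly_Mapping.keys c. Poly_Mapping.lookup c x * Poly_Mapping.lookup (b x) y)"
  by (simp add: frag_extend_def lookup_sum)

lemma lookup_span_proj:
  "Poly_Mapping.lookup (span_proj S c) y = (if y \<in> S then Poly_Mapping.lookup c y else 0)"
proof -
  have "Poly_Mapping.lookup (span_proj S c) y
      = (\<Sum>x \<in> Poly_Mapping.keys c. if x = y then (if y \<in> S then Poly_Mapping.lookup c y else 0) else 0)"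
    unfolding span_proj_def lookup_frag_extend by (rule sum.cong) auto
  then show ?thesis by (simp add: in_keys_iff)
qed

lemma keys_span_proj: "Poly_Mapping.keys (span_proj S c) = Poly_Mapping.keys c \<inter> S"
  by (auto simp: in_keys_iff lookup_span_proj split: if_splits)

lemma span_proj_hom:
  "T \<inter> S \<subseteq> U \<Longrightarrow> span_proj S \<in> hom (free_Abelian_group T) (free_Abelian_group U)"
proof (rule hom_freeI)
  fix c :: "'a \<Rightarrow>\<^sub>0 int" assume "T \<inter> S \<subseteq> U" "Poly_Mapping.keys c \<subseteq> T"
  then show "Poly_Mapping.keys (span_proj S c) \<subseteq> U" unfolding keys_span_proj by blast
qed (simp add: span_proj_def frag_extend_add)

lemma span_proj_add: "span_proj S (a + b) = span_proj S a + span_proj S b"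
  by (simp add: span_proj_def frag_extend_add)

lemma span_proj_diff: "span_proj S (a - b) = span_proj S a - span_proj S b"
  by (simp add: span_proj_def frag_extend_diff)

lemma span_proj_zero [simp]: "span_proj S 0 = 0"
  by (simp add: span_proj_def)

lemma span_proj_id: "Poly_Mapping.keys c \<subseteq> S \<Longrightarrow> span_proj S c = c"
  by (rule poly_mapping_eqI) (auto simp: lookup_span_proj in_keys_iff subset_iff)

lemma span_proj_disjoint: "Poly_Mapping.keys c \<inter> S = {} \<Longrightarrow> span_proj S c = 0"
  using keys_span_proj[of S c] by simp

lemma span_proj_split:
  assumes "Poly_Mapping.keys c \<subseteq> S \<union> T \<union> U" "S \<inter> T = {}" "S \<inter> U = {}" "T \<inter> U = {}"
  shows "span_proj S c + span_proj T c + span_proj U c = c"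
  using assms
  by (intro poly_mapping_eqI) (auto simp: lookup_span_proj lookup_add in_keys_iff subset_iff)

section \<open>The reduction defined by an admissible vector field\<close>

text \<open>Each continuation of a path lowers the measure of its current source, so a path from
  \<open>s\<close> has at most \<open>\<mu> p s + 1\<close> pairs.\<close>

lemma admissible_fieldI:
  fixes \<mu> :: "nat \<Rightarrow> 'a \<Rightarrow> nat"
  assumes "\<And>p s t s'. (s, t) \<in> V p \<Longrightarrow> s' \<in> source_cells V p \<Longrightarrow> is_face C p s' t \<Longrightarrow> s' \<noteq> s \<Longrightarrow>
    \<mu> p s' < \<mu> p s"
  shows "admissible_field C V"
proof -
  have "V_path C V p xs \<Longrightarrow> xs \<noteq> [] \<Longrightarrow> length xs \<le> Suc (\<mu> p (fst (hd xs)))" for p xs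
  proof (induction xs)
    case (Cons x xs)
    show ?case
    proof (cases xs)
      case (Cons y ys)
      have "V_path C V p xs"
        using Cons.prems(1) by (auto simp: V_path_def)
      then have "length xs \<le> Suc (\<mu> p (fst y))" using Cons.IH Cons by simp
      moreover have "is_face C p (fst y) (snd x)" "fst y \<noteq> fst x" "x \<in> V p" "y \<in> V p"
        using Cons.prems(1) Cons by (auto simp: V_path_def)
      then have "\<mu> p (fst y) < \<mu> p (fst x)"
        using assms[of "fst x" "snd x" p "fst y"] by (simp add: source_cells_def)
      ultimately show ?thesis by simp
    qed simp
  qed simp
  then have "\<forall>xs. V_path C V p xs \<and> xs \<noteq> [] \<and> fst (hd xs) = s \<longrightarrow> length xs \<le> Suc (\<mu> p s)" for p s
    by blast
  then show ?thesis unfolding admissible_field_def by meson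
qed

text \<open>The truncation \<open>0 - 1 = 0\<close> makes degree 0 a separate case: there the
  differential is the zero endomorphism.\<close>

lemma chain_complex_bdry_hom:
  assumes "chain_complex C"
  shows "bdry C p \<in> hom (chain_group C p) (chain_group C (p - 1))"
proof (cases p)
  case 0
  with assms show ?thesis
    by (intro hom_freeI) (simp_all add: chain_complex_def keys_add_subset)
next
  case (Suc q)
  with assms show ?thesis by (simp add: chain_complex_def)
qed

locale admissible_vector_field =
  fixes C :: "'a based_cpx" and V :: "nat \<Rightarrow> ('a \<times> 'a) set"
  assumes cpx: "chain_complex C"
    and field: "discrete_vector_field C V"
    and adm: "admissible_field C V"
begin

abbreviation d where "d \<equiv> bdry C"
abbreviation src where "src \<equiv> source_cells V"
abbreviation tgt where "tgt \<equiv> target_cells V"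
abbreviation crit where "crit \<equiv> critical_cells C V"

lemma pair_regular: "(s, t) \<in> V p \<Longrightarrow> is_regular_face C p s t"
  using field by (auto simp: discrete_vector_field_def)

lemma src_cells: "src p \<subseteq> cells C p"
  using pair_regular by (fastforce simp: source_cells_def is_regular_face_def)

lemma tgt_cells: "tgt p \<subseteq> cells C p"
  using pair_regular
  by (fastforce simp: target_cells_def is_regular_face_def split: nat.splits)

lemma src_tgt_disjoint: "src p \<inter> tgt p = {}"
  using field by (auto simp: discrete_vector_field_def source_cells_def target_cells_def split: nat.splits)

lemma crit_cells: "crit p \<subseteq> cells C p"
  by (auto simp: critical_cells_def)

lemma crit_disjoint: "crit p \<inter> src p = {}" "crit p \<inter> tgt p = {}"
  by (auto simp: critical_cells_def)

lemma d_hom: "d p \<in> hom (chain_group C p) (chain_group C (p - 1))"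
  by (rule chain_complex_bdry_hom[OF cpx])

lemma d_d: "Poly_Mapping.keys c \<subseteq> cells C (Suc p) \<Longrightarrow> d p (d (Suc p) c) = 0"
  using cpx by (simp add: chain_complex_def)

lemma d_0: "Poly_Mapping.keys c \<subseteq> cells C 0 \<Longrightarrow> d 0 c = 0"
  using cpx by (simp add: chain_complex_def)

text \<open>The length of a longest path from \<open>s\<close>, which exists by admissibility. It
  orders the source cells so that the block from targets to sources becomes triangular.\<close>

definition path_bound :: "nat \<Rightarrow> 'a \<Rightarrow> nat" where
  "path_bound p s = (LEAST l. \<forall>xs. V_path C V p xs \<and> xs \<noteq> [] \<and> fst (hd xs) = s \<longrightarrow> length xs \<le> l)"

lemma length_le_path_bound:
  assumes "V_path C V p xs" "xs \<noteq> []" "fst (hd xs) \<in> cells C p"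
  shows "length xs \<le> path_bound p (fst (hd xs))"
proof -
  have "\<exists>l. \<forall>ys. V_path C V p ys \<and> ys \<noteq> [] \<and> fst (hd ys) = fst (hd xs) \<longrightarrow> length ys \<le> l"
    using adm assms(3) by (simp add: admissible_field_def)
  from LeastI_ex[OF this] assms show ?thesis by (simp add: path_bound_def)
qed

lemma longest_path:
  assumes "(s, t) \<in> V p"
  shows "\<exists>xs. V_path C V p xs \<and> xs \<noteq> [] \<and> fst (hd xs) = s \<and> length xs = path_bound p s"
proof (rule ccontr)
  assume *: "\<not> ?thesis"
  have s: "s \<in> cells C p" using pair_regular[OF assms] by (simp add: is_regular_face_def)
  have "V_path C V p [(s, t)]" using assms by (simp add: V_path_def)
  \<comment> \<open>The path consisting of one pair makes the bound positive, so that subtracting 1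
    really lowers it.\<close>
  from length_le_path_bound[OF this] s have pos: "path_bound p s \<ge> 1" by simp
  have "length xs \<le> path_bound p s - 1"
    if "V_path C V p xs \<and> xs \<noteq> [] \<and> fst (hd xs) = s" for xs
    using length_le_path_bound[of p xs] that s * by fastforce
  then have "path_bound p s \<le> path_bound p s - 1"
    unfolding path_bound_def[of p s] by (intro Least_le) (auto simp: path_bound_def)
  with pos show False by simp
qed

text \<open>A longest path from \<open>s'\<close> can be prolonged at its front by the pair
  \<open>(s, t)\<close>.\<close>

lemma path_bound_less:
  assumes st: "(s, t) \<in> V p" and st': "(s', t') \<in> V p" and "is_face C p s' t" "s' \<noteq> s"
  shows "path_bound p s' < path_bound p s"
proof -
  obtain xs where xs: "V_path C V p xs" "xs \<noteq> []" "fst (hd xs) = s'" "length xs = path_bound p s'"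
    using longest_path[OF st'] by blast
  have "V_path C V p ((s, t) # xs)"
    unfolding V_path_def
  proof (intro conjI allI impI)
    fix k assume "Suc k < length ((s, t) # xs)"
    then show "is_face C p (fst (((s, t) # xs) ! Suc k)) (snd (((s, t) # xs) ! k))"
      "fst (((s, t) # xs) ! Suc k) \<noteq> fst (((s, t) # xs) ! k)"
      using xs assms by (cases k; auto simp: V_path_def hd_conv_nth)+
  qed (use xs st in \<open>auto simp: V_path_def\<close>)
  from length_le_path_bound[OF this] src_cells st xs(4) show ?thesis
    by (force simp: source_cells_def)
qed

section \<open>Invertibility of the block from target chains to source chains\<close>

lemma d21_hom: "d21 C V (Suc p) \<in> hom (free_Abelian_group (tgt (Suc p))) (free_Abelian_group (src p))"
proof -
  have "d (Suc p) \<in> hom (free_Abelian_group (tgt (Suc p))) (free_Abelian_group (cells C p))"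
    using hom_free_mono[OF d_hom[of "Suc p"] tgt_cells order_refl] by simp
  from hom_free_comp[OF this span_proj_hom[of _ "src p"]] show ?thesis
    by (force simp: d21_def[abs_def])
qed

text \<open>This is triangularity with respect to \<open>path_bound\<close>: a nonzero entry in the
  column of \<open>t\<close> outside the row of its own source is a possible continuation of a path
  through \<open>t\<close>.\<close>

lemma d21_pair:
  assumes "(s, t) \<in> V p"
  shows "Poly_Mapping.lookup (d21 C V (Suc p) (frag_of t)) s \<in> {1, -1}"
    and "\<And>s'. s' \<in> Poly_Mapping.keys (d21 C V (Suc p) (frag_of t)) \<Longrightarrow> s' \<noteq> s \<Longrightarrow>
      s' \<in> src p \<and> path_bound p s' < path_bound p s"
proof -
  have r: "is_regular_face C p s t" by (rule pair_regular[OF assms])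
  have s: "s \<in> src p" using assms by (force simp: source_cells_def)
  show "Poly_Mapping.lookup (d21 C V (Suc p) (frag_of t)) s \<in> {1, -1}"
    using r s by (simp add: d21_def lookup_span_proj is_regular_face_def)
  fix s' assume s': "s' \<in> Poly_Mapping.keys (d21 C V (Suc p) (frag_of t))" "s' \<noteq> s"
  then have src': "s' \<in> src p" by (simp add: d21_def keys_span_proj)
  then obtain t' where t': "(s', t') \<in> V p" by (force simp: source_cells_def)
  have "is_face C p s' t"
    using s' src' src_cells r
    by (auto simp: is_face_def is_regular_face_def d21_def keys_span_proj in_keys_iff lookup_span_proj)
  with path_bound_less[OF assms t'] s' src' show "s' \<in> src p \<and> path_bound p s' < path_bound p s"
    by simp
qed

text \<open>Back substitution: the image of the target paired with \<open>s\<close> is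
  \<open>s\<close> up to sign plus generators of smaller \<open>path_bound\<close>, which are
  reached by induction.\<close>

lemma d21_surj_generator:
  "s \<in> src p \<Longrightarrow> \<exists>c. Poly_Mapping.keys c \<subseteq> tgt (Suc p) \<and> d21 C V (Suc p) c = frag_of s"
proof (induction "path_bound p s" arbitrary: s rule: less_induct)
  case less
  let ?D = "d21 C V (Suc p)" and ?T = "tgt (Suc p)"
  let ?I = "\<lambda>u. \<exists>c. Poly_Mapping.keys c \<subseteq> ?T \<and> ?D c = u"
  have diff: "?I (a - b)" if "?I a" "?I b" for a b
    using that hom_free_diff[OF d21_hom, of _ p] by (metis keys_diff_subset)
  have zero: "?I 0" using hom_free_zero[OF d21_hom, of p] by (intro exI[of _ 0]) simp
  obtain t where t: "(s, t) \<in> V p" using less.prems by (force simp: source_cells_def)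
  define u where "u = ?D (frag_of t)"
  define e where "e = Poly_Mapping.lookup u s"
  have e: "e = 1 \<or> e = -1" using d21_pair(1)[OF t] by (simp add: u_def e_def)
  have "frag_of t \<in> carrier (free_Abelian_group ?T)"
    using t by (force simp: target_cells_def)
  then have Iu: "?I u" unfolding u_def by (intro exI[of _ "frag_of t"]) simp
  have "Poly_Mapping.keys (u - frag_cmul e (frag_of s)) \<subseteq> {s'. s' \<in> src p \<and> path_bound p s' < path_bound p s}"
  proof
    fix s' assume s': "s' \<in> Poly_Mapping.keys (u - frag_cmul e (frag_of s))"
    then have "s' \<noteq> s" by (auto simp: in_keys_iff lookup_minus e_def)
    moreover from this s' have "s' \<in> Poly_Mapping.keys u" by (auto simp: in_keys_iff lookup_minus)
    ultimately show "s' \<in> {s'. s' \<in> src p \<and> path_bound p s' < path_bound p s}"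
      using d21_pair(2)[OF t] by (simp add: u_def)
  qed
  then have "?I (u - frag_cmul e (frag_of s))"
  proof (induction rule: frag_induction)
    case zero show ?case by (rule \<open>?I 0\<close>)
  next
    case (one x) with less.hyps show ?case by blast
  next
    case (diff a b) then show ?case by (rule \<open>\<And>a b. ?I a \<Longrightarrow> ?I b \<Longrightarrow> ?I (a - b)\<close>)
  qed
  from diff[OF Iu this] have I: "?I (frag_cmul e (frag_of s))" by simp
  \<comment> \<open>Negation is subtraction from 0; with both signs available the unit
    \<open>e\<close> can be divided out.\<close>
  from diff[OF zero I] have "?I (- frag_cmul e (frag_of s))" by simp
  with I e show ?case by auto
qed

lemma d21_surj:
  assumes "Poly_Mapping.keys u \<subseteq> src p"
  shows "\<exists>c. Poly_Mapping.keys c \<subseteq> tgt (Suc p) \<and> d21 C V (Suc p) c = u"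
  using assms
proof (induction u rule: frag_induction)
  case zero
  show ?case using hom_free_zero[OF d21_hom, of p] by (intro exI[of _ 0]) simp
next
  case (one x) then show ?case by (rule d21_surj_generator)
next
  case (diff a b) then show ?case
    using hom_free_diff[OF d21_hom, of _ p] by (metis keys_diff_subset)
qed

text \<open>In a nonzero chain of targets take a generator whose source has the largest
  \<open>path_bound\<close>. No other generator contributes to the coefficient of that source, so
  this coefficient cannot cancel.\<close>

lemma d21_kernel:
  assumes c: "Poly_Mapping.keys c \<subseteq> tgt (Suc p)" and 0: "d21 C V (Suc p) c = 0"
  shows "c = 0"
proof (rule ccontr)
  assume "c \<noteq> 0"
  then have ne: "Poly_Mapping.keys c \<noteq> {}" by simp
  let ?P = "\<lambda>t. SOME s. (s, t) \<in> V p"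
  have P: "(?P t, t) \<in> V p" if "t \<in> Poly_Mapping.keys c" for t
  proof -
    have "\<exists>s. (s, t) \<in> V p" using c that by (force simp: target_cells_def)
    then show ?thesis by (rule someI_ex)
  qed
  obtain t where t: "t \<in> Poly_Mapping.keys c"
    and max: "\<And>t'. t' \<in> Poly_Mapping.keys c \<Longrightarrow> path_bound p (?P t') \<le> path_bound p (?P t)"
  proof -
    let ?M = "(\<lambda>t. path_bound p (?P t)) ` Poly_Mapping.keys c"
    have "Max ?M \<in> ?M" using ne by (intro Max_in) simp_all
    then obtain t where "t \<in> Poly_Mapping.keys c" "path_bound p (?P t) = Max ?M" by force
    then show thesis by (intro that[of t]) simp_all
  qed
  let ?l = "\<lambda>t'. Poly_Mapping.lookup (d21 C V (Suc p) (frag_of t')) (?P t)"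
  have "?l t' = 0" if "t' \<in> Poly_Mapping.keys c" "t' \<noteq> t" for t'
  proof (rule ccontr)
    assume "?l t' \<noteq> 0"
    then have "?P t \<in> Poly_Mapping.keys (d21 C V (Suc p) (frag_of t'))" by (simp add: in_keys_iff)
    moreover have "?P t \<noteq> ?P t'"
    proof
      assume "?P t = ?P t'"
      with P[OF t] P[OF that(1)] have mem: "(?P t, t) \<in> V p" "(?P t, t') \<in> V p" by simp_all
      have "inj_on fst (V p)" using field by (simp add: discrete_vector_field_def)
      from inj_onD[OF this _ mem] that(2) show False by simp
    qed
    ultimately have "path_bound p (?P t) < path_bound p (?P t')"
      using d21_pair(2)[OF P[OF that(1)]] by blast
    with max[OF that(1)] show False by simp
  qed
  then have "(\<Sum>t'\<in>Poly_Mapping.keys c. Poly_Mapping.lookup c t' * ?l t')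
      = (\<Sum>t'\<in>{t}. Poly_Mapping.lookup c t' * ?l t')"
    using t by (intro sum.mono_neutral_right) auto
  also have "\<dots> \<noteq> 0" using d21_pair(1)[OF P[OF t]] t by (auto simp: in_keys_iff)
  finally have "Poly_Mapping.lookup (d21 C V (Suc p) c) (?P t) \<noteq> 0"
    by (simp add: hom_free_eq_frag_extend[OF d21_hom c] lookup_frag_extend)
  with 0 show False by simp
qed

theorem d21_iso: "d21 C V (Suc p) \<in> iso (free_Abelian_group (tgt (Suc p))) (free_Abelian_group (src p))"
proof -
  have "inj_on (d21 C V (Suc p)) (carrier (free_Abelian_group (tgt (Suc p))))"
  proof (rule inj_onI)
    fix a b assume ab: "a \<in> carrier (free_Abelian_group (tgt (Suc p)))"
      "b \<in> carrier (free_Abelian_group (tgt (Suc p)))" "d21 C V (Suc p) a = d21 C V (Suc p) b"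
    then have "d21 C V (Suc p) (a - b) = 0" by (simp add: hom_free_diff[OF d21_hom])
    with ab d21_kernel[of "a - b" p] show "a = b" by (simp add: keys_diff_subset)
  qed
  moreover have "d21 C V (Suc p) ` carrier (free_Abelian_group (tgt (Suc p)))
      = carrier (free_Abelian_group (src p))"
  proof (intro equalityI subsetI)
    fix u assume "u \<in> d21 C V (Suc p) ` carrier (free_Abelian_group (tgt (Suc p)))"
    then obtain c where "Poly_Mapping.keys c \<subseteq> tgt (Suc p)" "u = d21 C V (Suc p) c" by auto
    then show "u \<in> carrier (free_Abelian_group (src p))" using hom_free_keys[OF d21_hom] by simp
  next
    fix u assume "u \<in> carrier (free_Abelian_group (src p))"
    with d21_surj[of u p] show "u \<in> d21 C V (Suc p) ` carrier (free_Abelian_group (tgt (Suc p)))"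
      by force
  qed
  ultimately show ?thesis using d21_hom[of p] by (simp add: iso_def bij_betw_def)
qed

section \<open>Identities of the reduction\<close>

abbreviation h where "h \<equiv> field_h C V"

lemma d21_inv_hom:
  "d21_inv C V (Suc p) \<in> hom (free_Abelian_group (src p)) (free_Abelian_group (tgt (Suc p)))"
  using group.iso_set_sym[OF group_free_Abelian_group d21_iso]
  by (simp add: d21_inv_def iso_def)

lemma d21_d21_inv: "Poly_Mapping.keys u \<subseteq> src p \<Longrightarrow> d21 C V (Suc p) (d21_inv C V (Suc p) u) = u"
  using d21_iso[of p] by (simp add: d21_inv_def iso_def bij_betw_def f_inv_into_f)

lemma d21_inv_d21: "Poly_Mapping.keys c \<subseteq> tgt (Suc p) \<Longrightarrow> d21_inv C V (Suc p) (d21 C V (Suc p) c) = c"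
  using d21_iso[of p] by (simp add: d21_inv_def iso_def bij_betw_def)

lemma h_hom_tgt: "h p \<in> hom (chain_group C p) (free_Abelian_group (tgt (Suc p)))"
  unfolding field_h_def[abs_def] by (rule hom_free_comp[OF span_proj_hom d21_inv_hom]) auto

lemma h_hom: "h p \<in> hom (chain_group C p) (chain_group C (Suc p))"
  by (rule hom_free_mono[OF h_hom_tgt]) (auto simp: tgt_cells)

lemma h_eq_0: "Poly_Mapping.keys c \<inter> src p = {} \<Longrightarrow> h p c = 0"
  using hom_free_zero[OF d21_inv_hom, of p] by (simp add: field_h_def span_proj_disjoint)

text \<open>The homotopy annihilates target chains, and inverts the part of the differential that ends
  in source chains; all identities of the reduction follow from these two facts and \<open>d d = 0\<close>.\<close>

lemma span_proj_d_h: "Poly_Mapping.keys c \<subseteq> cells C p \<Longrightarrow>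
    span_proj (src p) (d (Suc p) (h p c)) = span_proj (src p) c"
  using d21_d21_inv[of "span_proj (src p) c" p]
  by (simp add: field_h_def d21_def keys_span_proj)

lemma h_d_tgt: "Poly_Mapping.keys c \<subseteq> tgt (Suc p) \<Longrightarrow> h p (d (Suc p) c) = c"
  using d21_inv_d21[of c p] by (simp add: field_h_def d21_def)

text \<open>As operators, \<open>minus_hd\<close> and \<open>minus_dh\<close> are
  \<open>1 - hd\<close> and \<open>1 - dh\<close>. The critical part of the second is
  \<open>f\<close>, the first restricted to critical chains is \<open>g\<close>, and their product
  is \<open>1 - hd - dh\<close>.\<close>

definition minus_hd :: "nat \<Rightarrow> ('a \<Rightarrow>\<^sub>0 int) \<Rightarrow> ('a \<Rightarrow>\<^sub>0 int)" where
  "minus_hd p c = c - h (p - 1) (d p c)"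

definition minus_dh :: "nat \<Rightarrow> ('a \<Rightarrow>\<^sub>0 int) \<Rightarrow> ('a \<Rightarrow>\<^sub>0 int)" where
  "minus_dh p c = c - d (Suc p) (h p c)"

lemma hd_hom: "(\<lambda>c. h (p - 1) (d p c)) \<in> hom (chain_group C p) (chain_group C p)"
proof (cases p)
  case 0
  then have "h (p - 1) (d p c) = 0" if "Poly_Mapping.keys c \<subseteq> cells C p" for c
    using that d_0 hom_free_zero[OF h_hom, of 0] by simp
  then show ?thesis by (intro hom_freeI) (simp_all add: keys_add_subset)
next
  case (Suc q)
  then show ?thesis using hom_free_comp[OF d_hom[of p] h_hom[of "p - 1"]] by simp
qed

lemma minus_hd_hom: "minus_hd p \<in> hom (chain_group C p) (chain_group C p)"
  unfolding minus_hd_def[abs_def] by (rule hom_free_minus[OF hom_free_id hd_hom]) simp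

lemma minus_dh_hom: "minus_dh p \<in> hom (chain_group C p) (chain_group C p)"
  unfolding minus_dh_def[abs_def]
  using hom_free_comp[OF h_hom[of p] d_hom[of "Suc p"]] by (intro hom_free_minus hom_free_id) simp_all

text \<open>\<open>d h\<close> reproduces the source part of a chain, so subtracting it leaves no
  source part.\<close>

lemma minus_dh_hom': "minus_dh p \<in> hom (chain_group C p) (free_Abelian_group (tgt p \<union> crit p))"
proof (rule hom_freeI)
  fix c :: "'a \<Rightarrow>\<^sub>0 int" assume c: "Poly_Mapping.keys c \<subseteq> cells C p"
  have "span_proj (src p) (minus_dh p c) = 0"
    using span_proj_d_h[OF c] by (simp add: minus_dh_def span_proj_diff)
  moreover have "Poly_Mapping.keys (minus_dh p c) \<subseteq> cells C p" by (rule hom_free_keys[OF minus_dh_hom c])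
  ultimately show "Poly_Mapping.keys (minus_dh p c) \<subseteq> tgt p \<union> crit p"
    using keys_span_proj[of "src p" "minus_dh p c"] by (auto simp: critical_cells_def)
qed (rule hom_free_add[OF minus_dh_hom])

lemma minus_hd_tgt: "Poly_Mapping.keys c \<subseteq> tgt p \<Longrightarrow> minus_hd p c = 0"
proof (cases p)
  case 0
  moreover assume "Poly_Mapping.keys c \<subseteq> tgt p"
  ultimately show ?thesis
    using hom_free_zero[OF minus_hd_hom] by (simp add: target_cells_def)
qed (simp add: minus_hd_def h_d_tgt)

lemma h_h: "Poly_Mapping.keys c \<subseteq> cells C p \<Longrightarrow> h (Suc p) (h p c) = 0"
  using hom_free_keys[OF h_hom_tgt, of c p] src_tgt_disjoint[of "Suc p"] by (intro h_eq_0) blast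

text \<open>The target part lost in the projection is killed by \<open>1 - hd\<close>. This is what
  makes \<open>g f\<close> equal to the product of \<open>1 - hd\<close> and
  \<open>1 - dh\<close>.\<close>

lemma minus_hd_crit_proj:
  assumes "Poly_Mapping.keys c \<subseteq> tgt p \<union> crit p"
  shows "minus_hd p (span_proj (crit p) c) = minus_hd p c"
proof -
  have "span_proj (tgt p) c + span_proj (crit p) c + span_proj {} c = c"
    using assms crit_disjoint(2)[of p] by (intro span_proj_split) auto
  then have c: "c = span_proj (tgt p) c + span_proj (crit p) c" by (simp add: span_proj_disjoint)
  have "minus_hd p c = minus_hd p (span_proj (tgt p) c) + minus_hd p (span_proj (crit p) c)"
    by (subst c, rule hom_free_add[OF minus_hd_hom]) (use tgt_cells crit_cells in \<open>auto simp: keys_span_proj\<close>)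
  then show ?thesis by (simp add: minus_hd_tgt keys_span_proj)
qed

text \<open>When the product is expanded, the mixed term \<open>h d d h\<close> vanishes.\<close>

lemma minus_hd_phi: "Poly_Mapping.keys c \<subseteq> cells C p \<Longrightarrow>
    minus_hd p (minus_dh p c) = c - h (p - 1) (d p c) - d (Suc p) (h p c)"
proof -
  assume c: "Poly_Mapping.keys c \<subseteq> cells C p"
  have hc: "Poly_Mapping.keys (h p c) \<subseteq> cells C (Suc p)" by (rule hom_free_keys[OF h_hom c])
  have dhc: "Poly_Mapping.keys (d (Suc p) (h p c)) \<subseteq> cells C p"
    using hom_free_keys[OF d_hom hc] by simp
  have "h (p - 1) (d p (minus_dh p c)) = h (p - 1) (d p c) - h (p - 1) (d p (d (Suc p) (h p c)))"
    unfolding minus_dh_def by (rule hom_free_diff[OF hd_hom c dhc])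
  then show ?thesis using d_d[OF hc] hom_free_zero[OF h_hom, of "p - 1"]
    by (simp add: minus_hd_def minus_dh_def algebra_simps)
qed

lemma field_f_eq: "field_f C V p c = span_proj (crit p) (minus_dh p c)"
  by (simp add: field_f_def minus_dh_def field_h_def span_proj_diff)

lemma field_g_eq: "Poly_Mapping.keys c \<subseteq> cells C p \<Longrightarrow> field_g C V p c = minus_hd p c"
proof (cases p)
  case 0
  assume c: "Poly_Mapping.keys c \<subseteq> cells C p"
  \<comment> \<open>The inverse in degree 0 is an \<open>inv_into\<close> on the zero group. It is
    known to return 0 at 0 because 0 is the image of 0.\<close>
  have "carrier (free_Abelian_group (tgt 0)) = {0}" by (auto simp: target_cells_def)
  moreover have "d21 C V 0 0 = 0" using d_0[of 0] by (simp add: d21_def)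
  ultimately have "d21_inv C V 0 0 = 0"
    using inv_into_into[of 0 "d21 C V 0" "carrier (free_Abelian_group (tgt 0))"]
    by (simp add: d21_inv_def)
  with 0 c show ?thesis
    using hom_free_zero[OF h_hom, of 0] by (simp add: field_g_def minus_hd_def d_0)
qed (simp add: field_g_def minus_hd_def field_h_def)

lemma cells_critical_cpx [simp]: "cells (critical_cpx C V) = crit"
  by (simp add: critical_cpx_def)

lemma bdry_critical_cpx:
  assumes "Poly_Mapping.keys c \<subseteq> cells C p"
  shows "bdry (critical_cpx C V) p c = span_proj (crit (p - 1)) (d p (minus_hd p c))"
proof -
  have "Poly_Mapping.keys (h (p - 1) (d p c)) \<subseteq> cells C p"
    by (rule hom_free_keys[OF hd_hom assms])
  then have "d p (minus_hd p c) = d p c - d p (h (p - 1) (d p c))"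
    unfolding minus_hd_def by (rule hom_free_diff[OF d_hom assms])
  moreover have "d21_inv C V p (span_proj (src (p - 1)) (d p c)) = h (p - 1) (d p c)"
    using field_g_eq[OF assms] by (simp add: field_g_def minus_hd_def)
  ultimately show ?thesis by (simp add: critical_cpx_def span_proj_diff)
qed

text \<open>Both \<open>d (1 - hd)\<close> and \<open>(1 - dh) d\<close> equal
  \<open>d - d h d\<close>. The small differential thus becomes \<open>f d\<close>, the form in
  which its identities are easy to check.\<close>

lemma bdry_critical_eq_f:
  assumes "Poly_Mapping.keys c \<subseteq> cells C (Suc p)"
  shows "bdry (critical_cpx C V) (Suc p) c = field_f C V p (d (Suc p) c)"
proof -
  have "Poly_Mapping.keys (h p (d (Suc p) c)) \<subseteq> cells C (Suc p)"
    using hom_free_keys[OF hd_hom assms] by simp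
  then have "d (Suc p) (minus_hd (Suc p) c) = minus_dh p (d (Suc p) c)"
    unfolding minus_hd_def minus_dh_def using hom_free_diff[OF d_hom assms] by simp
  with bdry_critical_cpx[OF assms] show ?thesis by (simp add: field_f_eq)
qed

lemma f_hom: "field_f C V p \<in> hom (chain_group C p) (free_Abelian_group (crit p))"
  unfolding field_f_eq[abs_def] by (rule hom_free_comp[OF minus_dh_hom span_proj_hom]) auto

lemma g_hom: "field_g C V p \<in> hom (free_Abelian_group (crit p)) (chain_group C p)"
proof -
  have *: "Poly_Mapping.keys c \<subseteq> crit p \<Longrightarrow> Poly_Mapping.keys c \<subseteq> cells C p" for c :: "'a \<Rightarrow>\<^sub>0 int"
    using crit_cells by blast
  show ?thesis
    by (intro hom_freeI)
      (simp_all only: * keys_add_subset field_g_eq hom_free_keys[OF minus_hd_hom] hom_free_add[OF minus_hd_hom])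
qed

theorem reduction_critical_cpx:
  "reduction C (critical_cpx C V) (field_f C V) (field_g C V) (field_h C V)"
proof -
  let ?D = "critical_cpx C V" and ?f = "field_f C V" and ?g = "field_g C V"
  note cr = subset_trans[OF _ crit_cells]
  \<comment> \<open>\<open>1 - hd\<close> applied to \<open>f c\<close> gives
    \<open>(1 - hd) c - d h c\<close>, and \<open>d\<close> kills the last term.\<close>
  have D_f: "bdry ?D (Suc p) (?f (Suc p) c) = ?f p (d (Suc p) c)"
    if c: "Poly_Mapping.keys c \<subseteq> cells C (Suc p)" for p c
  proof -
    have fc: "Poly_Mapping.keys (?f (Suc p) c) \<subseteq> cells C (Suc p)"
      by (rule cr[OF hom_free_keys[OF f_hom c]])
    have ph: "Poly_Mapping.keys (minus_dh (Suc p) c) \<subseteq> tgt (Suc p) \<union> crit (Suc p)"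
      by (rule hom_free_keys[OF minus_dh_hom' c])
    have hdc: "Poly_Mapping.keys (h p (d (Suc p) c)) \<subseteq> cells C (Suc p)"
      using hom_free_keys[OF hd_hom c] by simp
    have hc: "Poly_Mapping.keys (h (Suc p) c) \<subseteq> cells C (Suc (Suc p))"
      by (rule hom_free_keys[OF h_hom c])
    have dhc: "Poly_Mapping.keys (d (Suc (Suc p)) (h (Suc p) c)) \<subseteq> cells C (Suc p)"
      using hom_free_keys[OF d_hom hc] by simp
    have "minus_hd (Suc p) (?f (Suc p) c) = minus_hd (Suc p) c - d (Suc (Suc p)) (h (Suc p) c)"
      using minus_hd_crit_proj[OF ph] minus_hd_phi[OF c] by (simp add: field_f_eq minus_hd_def)
    then have "d (Suc p) (minus_hd (Suc p) (?f (Suc p) c)) = d (Suc p) (minus_hd (Suc p) c)"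
      using hom_free_diff[OF d_hom hom_free_keys[OF minus_hd_hom c] dhc] d_d[OF hc] by simp
    then show ?thesis
      using bdry_critical_cpx[OF fc] bdry_critical_cpx[OF c] bdry_critical_eq_f[OF c] by simp
  qed
  have D_hom: "bdry ?D (Suc p) \<in> hom (chain_group ?D (Suc p)) (chain_group ?D p)" for p
  proof -
    have "(\<lambda>c. ?f p (d (Suc p) c)) \<in> hom (chain_group C (Suc p)) (free_Abelian_group (crit p))"
      using hom_free_comp[OF d_hom[of "Suc p"]] f_hom[of p] by simp
    then have *: "(\<lambda>c. ?f p (d (Suc p) c)) \<in> hom (free_Abelian_group (crit (Suc p))) (free_Abelian_group (crit p))"
      by (rule hom_free_mono) (auto simp: crit_cells)
    show ?thesis
      using hom_free_keys[OF *] hom_free_add[OF *]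
      by (intro hom_freeI) (simp_all add: bdry_critical_eq_f[OF cr] keys_add_subset)
  qed
  \<comment> \<open>With the small differential written as \<open>f d\<close>, its square is
    \<open>f d d\<close> by \<open>D_f\<close>.\<close>
  have D_D: "bdry ?D p (bdry ?D (Suc p) c) = 0" if "Poly_Mapping.keys c \<subseteq> crit (Suc p)" for p c
  proof -
    have c: "Poly_Mapping.keys c \<subseteq> cells C (Suc p)" by (rule cr[OF that])
    have dc: "Poly_Mapping.keys (d (Suc p) c) \<subseteq> cells C p" using hom_free_keys[OF d_hom c] by simp
    have fdc: "Poly_Mapping.keys (?f p (d (Suc p) c)) \<subseteq> cells C p"
      by (rule cr[OF hom_free_keys[OF f_hom dc]])
    show ?thesis
    proof (cases p)
      case 0
      have "bdry ?D 0 (?f 0 (d (Suc 0) c)) = 0"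
        using 0 bdry_critical_cpx[OF fdc] hom_free_keys[OF minus_hd_hom fdc] by (simp add: d_0)
      with 0 bdry_critical_eq_f[OF c] show ?thesis by simp
    next
      case (Suc q)
      with D_f[of "d (Suc p) c" q] dc d_d[OF c] hom_free_zero[OF f_hom, of q]
      have "bdry ?D p (?f p (d (Suc p) c)) = 0" by simp
      then show ?thesis by (simp only: bdry_critical_eq_f[OF c])
    qed
  qed
  have D_0: "bdry ?D 0 c = 0" if "Poly_Mapping.keys c \<subseteq> crit 0" for c
    using bdry_critical_cpx[OF cr[OF that]] hom_free_keys[OF minus_hd_hom cr[OF that]] by (simp add: d_0)
  have g_D: "?g p (bdry ?D (Suc p) c) = d (Suc p) (?g (Suc p) c)"
    if "Poly_Mapping.keys c \<subseteq> crit (Suc p)" for p c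
  proof -
    have c: "Poly_Mapping.keys c \<subseteq> cells C (Suc p)" by (rule cr[OF that])
    have dc: "Poly_Mapping.keys (d (Suc p) c) \<subseteq> cells C p" using hom_free_keys[OF d_hom c] by simp
    have fdc: "Poly_Mapping.keys (?f p (d (Suc p) c)) \<subseteq> cells C p"
      by (rule cr[OF hom_free_keys[OF f_hom dc]])
    have hdc: "Poly_Mapping.keys (h p (d (Suc p) c)) \<subseteq> cells C (Suc p)"
      by (rule hom_free_keys[OF h_hom dc])
    have "?g p (bdry ?D (Suc p) c) = minus_hd p (minus_dh p (d (Suc p) c))"
      using minus_hd_crit_proj[OF hom_free_keys[OF minus_dh_hom' dc]]
      by (simp add: bdry_critical_eq_f[OF c] field_g_eq[OF fdc]) (simp add: field_f_eq)
    also have "\<dots> = d (Suc p) c - d (Suc p) (h p (d (Suc p) c))"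
      using d_d[OF c] hom_free_zero[OF h_hom, of "p - 1"] by (simp add: minus_hd_phi[OF dc])
    also have "\<dots> = d (Suc p) (minus_hd (Suc p) c)"
      using hom_free_diff[OF d_hom c hdc] by (simp add: minus_hd_def)
    finally show ?thesis by (simp add: field_g_eq[OF c])
  qed
  have f_h: "?f (Suc p) (h p c) = 0" if c: "Poly_Mapping.keys c \<subseteq> cells C p" for p c
  proof -
    have "minus_dh (Suc p) (h p c) = h p c"
      using h_h[OF c] hom_free_zero[OF d_hom, of "Suc (Suc p)"] by (simp add: minus_dh_def)
    moreover have "Poly_Mapping.keys (h p c) \<inter> crit (Suc p) = {}"
      using hom_free_keys[OF h_hom_tgt c] crit_disjoint(2)[of "Suc p"] by blast
    ultimately show ?thesis by (simp add: field_f_eq span_proj_disjoint)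
  qed
  have f_g: "?f p (?g p c) = c" if "Poly_Mapping.keys c \<subseteq> crit p" for p c
  proof -
    have c: "Poly_Mapping.keys c \<subseteq> cells C p" by (rule cr[OF that])
    have hdc: "Poly_Mapping.keys (h (p - 1) (d p c)) \<subseteq> cells C p"
      by (rule hom_free_keys[OF hd_hom c])
    have "?f p (h (p - 1) (d p c)) = 0"
    proof (cases p)
      case 0 then show ?thesis using d_0 c hom_free_zero[OF h_hom] hom_free_zero[OF f_hom] by simp
    next
      case (Suc q)
      then show ?thesis using f_h[of "d p c" q] hom_free_keys[OF d_hom c] by simp
    qed
    moreover have "?f p c = c"
    proof -
      have "h p c = 0" using that crit_disjoint by (intro h_eq_0) blast
      then show ?thesis using that hom_free_zero[OF d_hom, of "Suc p"]
        by (simp add: field_f_eq minus_dh_def span_proj_id)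
    qed
    ultimately show ?thesis
      using hom_free_diff[OF f_hom c hdc] by (simp add: field_g_eq[OF c] minus_hd_def)
  qed
  have g_f: "?g p (?f p c) + d (Suc p) (h p c) + h (p - 1) (d p c) = c"
    if c: "Poly_Mapping.keys c \<subseteq> cells C p" for p c
  proof -
    have "?g p (?f p c) = minus_hd p (minus_dh p c)"
      using minus_hd_crit_proj[OF hom_free_keys[OF minus_dh_hom' c]]
        field_g_eq[OF cr[OF hom_free_keys[OF f_hom c]]]
      by (simp add: field_f_eq)
    then show ?thesis by (simp add: minus_hd_phi[OF c])
  qed
  have h_g: "h p (?g p c) = 0" if "Poly_Mapping.keys c \<subseteq> crit p" for p c
  proof -
    have c: "Poly_Mapping.keys c \<subseteq> cells C p" by (rule cr[OF that])
    have hdc: "Poly_Mapping.keys (h (p - 1) (d p c)) \<subseteq> cells C p"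
      by (rule hom_free_keys[OF hd_hom c])
    have "h p c = 0" using that crit_disjoint by (intro h_eq_0) blast
    moreover have "h p (h (p - 1) (d p c)) = 0"
    proof (cases p)
      case 0 then show ?thesis using d_0 c hom_free_zero[OF h_hom] by simp
    next
      case (Suc q)
      then show ?thesis using h_h[of "d p c" q] hom_free_keys[OF d_hom c] by simp
    qed
    ultimately show ?thesis
      using hom_free_diff[OF h_hom c hdc] by (simp add: field_g_eq[OF c] minus_hd_def)
  qed
  have "chain_complex ?D"
    using D_hom D_D D_0 by (simp add: chain_complex_def)
  then show ?thesis
    unfolding reduction_def cells_critical_cpx
    by (intro conjI allI ballI)
      (simp_all only: carrier_free_Abelian_group_iff cpx f_hom g_hom h_hom D_f g_D f_g g_f f_h h_g h_h)
qed

end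

text \<open>The differential of \<open>D'\<close> is given only as a conjugate of that of
  \<open>D\<close>; that it squares to zero is part of what is proved. This suits a complex defined
  by transport along a bijection of generators.\<close>

lemma reduction_transport:
  fixes D' :: "'c based_cpx"
  assumes red: "reduction C D f g h"
    and to_hom: "\<And>n. to n \<in> hom (chain_group D n) (chain_group D' n)"
    and from_hom: "\<And>n. from n \<in> hom (chain_group D' n) (chain_group D n)"
    and from_to: "\<And>n c. Poly_Mapping.keys c \<subseteq> cells D n \<Longrightarrow> from n (to n c) = c"
    and to_from: "\<And>n c. Poly_Mapping.keys c \<subseteq> cells D' n \<Longrightarrow> to n (from n c) = c"
    and bdry: "\<And>n c. bdry D' n c = to (n - 1) (bdry D n (from n c))"
  shows "reduction C D' (\<lambda>n c. to n (f n c)) (\<lambda>n c. g n (from n c)) h"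
proof -
  have D: "chain_complex D" and f: "\<And>p. f p \<in> hom (chain_group C p) (chain_group D p)"
    and g: "\<And>p. g p \<in> hom (chain_group D p) (chain_group C p)"
    and fd: "\<And>p c. Poly_Mapping.keys c \<subseteq> cells C (Suc p) \<Longrightarrow>
      f p (bdry C (Suc p) c) = bdry D (Suc p) (f (Suc p) c)"
    and gd: "\<And>p c. Poly_Mapping.keys c \<subseteq> cells D (Suc p) \<Longrightarrow>
      g p (bdry D (Suc p) c) = bdry C (Suc p) (g (Suc p) c)"
    and rest: "chain_complex C" "\<And>p. h p \<in> hom (chain_group C p) (chain_group C (Suc p))"
      "\<And>p c. Poly_Mapping.keys c \<subseteq> cells D p \<Longrightarrow> f p (g p c) = c"
      "\<And>p c. Poly_Mapping.keys c \<subseteq> cells C p \<Longrightarrow>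
        g p (f p c) + bdry C (Suc p) (h p c) + h (p - 1) (bdry C p c) = c"
      "\<And>p c. Poly_Mapping.keys c \<subseteq> cells C p \<Longrightarrow> f (Suc p) (h p c) = 0"
      "\<And>p c. Poly_Mapping.keys c \<subseteq> cells D p \<Longrightarrow> h p (g p c) = 0"
      "\<And>p c. Poly_Mapping.keys c \<subseteq> cells C p \<Longrightarrow> h (Suc p) (h p c) = 0"
    using red by (simp_all add: reduction_def)
  note bh = chain_complex_bdry_hom[OF D]
  note fr = hom_free_keys[OF from_hom]
  have "bdry D' (Suc p) \<in> hom (chain_group D' (Suc p)) (chain_group D' p)" for p
    unfolding bdry[abs_def]
    using hom_free_comp[OF from_hom[of "Suc p"] hom_free_comp[OF bh to_hom]] by simp
  moreover have "bdry D' 0 c = 0" if "Poly_Mapping.keys c \<subseteq> cells D' 0" for c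
    using D fr[OF that] hom_free_zero[OF to_hom] by (simp add: bdry chain_complex_def)
  moreover have "bdry D' p (bdry D' (Suc p) c) = 0" if "Poly_Mapping.keys c \<subseteq> cells D' (Suc p)" for p c
  proof -
    have "bdry D p (bdry D (Suc p) (from (Suc p) c)) = 0"
      using D fr[OF that] by (simp add: chain_complex_def)
    moreover have "from p (to p (bdry D (Suc p) (from (Suc p) c))) = bdry D (Suc p) (from (Suc p) c)"
      using hom_free_keys[OF bh fr[OF that]] by (simp add: from_to)
    ultimately show ?thesis using hom_free_zero[OF to_hom] by (simp add: bdry)
  qed
  ultimately have D': "chain_complex D'" by (simp add: chain_complex_def)
  have f': "to p (f p (bdry C (Suc p) c)) = bdry D' (Suc p) (to (Suc p) (f (Suc p) c))"
    if "Poly_Mapping.keys c \<subseteq> cells C (Suc p)" for p c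
    using hom_free_keys[OF f that] by (simp add: bdry from_to fd[OF that])
  have g': "g p (from p (bdry D' (Suc p) c)) = bdry C (Suc p) (g (Suc p) (from (Suc p) c))"
    if "Poly_Mapping.keys c \<subseteq> cells D' (Suc p)" for p c
    using hom_free_keys[OF bh fr[OF that]] by (simp add: bdry from_to gd[OF fr[OF that]])
  show ?thesis
    unfolding reduction_def
    using D' rest hom_free_comp[OF f to_hom] hom_free_comp[OF from_hom g] f' g'
      hom_free_keys[OF f] fr hom_free_zero[OF to_hom]
    by (intro conjI allI ballI) (simp_all add: from_to to_from)
qed

section \<open>Degeneracies in simplicial sets\<close>

text \<open>For the simplex induced from a non-degenerate one by a surjection
  \<open>\<alpha>\<close>, this is the set of indices where \<open>\<alpha>\<close> is stationary;
  it replaces \<open>\<alpha>\<close> and involves no choice.\<close>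

definition degen_set :: "('a, 'm) sset_scheme \<Rightarrow> nat \<Rightarrow> 'a \<Rightarrow> nat set" where
  "degen_set X n x = {i. \<exists>m y. n = Suc m \<and> i \<le> m \<and> y \<in> simplices X m \<and> x = degen X m i y}"

lemma nondegenerate_iff: "x \<in> nondegenerate X n \<longleftrightarrow> x \<in> simplices X n \<and> degen_set X n x = {}"
  by (auto simp: nondegenerate_def degen_set_def)

lemma degen_set_bound: "i \<in> degen_set X n x \<Longrightarrow> i < n"
  by (auto simp: degen_set_def)

lemma finite_degen_set [simp]: "finite (degen_set X n x)"
  by (rule finite_subset[of _ "{..<n}"]) (auto dest: degen_set_bound)

lemma degen_setE:
  assumes "i \<in> degen_set X (Suc n) x"
  obtains y where "i \<le> n" "y \<in> simplices X n" "x = degen X n i y"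
  using assms by (auto simp: degen_set_def)

lemma degen_setI: "i \<le> n \<Longrightarrow> y \<in> simplices X n \<Longrightarrow> i \<in> degen_set X (Suc n) (degen X n i y)"
  by (auto simp: degen_set_def)

text \<open>The order of the degeneracies is left open, which keeps inductions simple; their indices
  are recovered from \<open>degen_set\<close>.\<close>

inductive core_of :: "('a, 'm) sset_scheme \<Rightarrow> nat \<Rightarrow> 'a \<Rightarrow> nat \<Rightarrow> 'a \<Rightarrow> bool" for X p \<phi> where
  refl: "\<phi> \<in> nondegenerate X p \<Longrightarrow> core_of X p \<phi> p \<phi>"
| step: "core_of X p \<phi> n x \<Longrightarrow> i \<le> n \<Longrightarrow> core_of X p \<phi> (Suc n) (degen X n i x)"

lemma core_of_nondegenerate: "core_of X p \<phi> n x \<Longrightarrow> \<phi> \<in> nondegenerate X p"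
  by (induction rule: core_of.induct)

text \<open>The order-preserving surjection that is stationary exactly at the indices in
  \<open>D\<close>: its value counts the earlier rises.\<close>

definition rank :: "nat set \<Rightarrow> nat \<Rightarrow> nat" where
  "rank D i = card ({..<i} - D)"

lemma rank_0 [simp]: "rank D 0 = 0"
  by (simp add: rank_def)

lemma rank_Suc: "rank D (Suc i) = (if i \<in> D then rank D i else Suc (rank D i))"
  by (simp add: rank_def lessThan_Suc insert_Diff_if)

lemma rank_mono: "i \<le> j \<Longrightarrow> rank D i \<le> rank D j"
  unfolding rank_def by (rule card_mono) auto

lemma rank_image: "rank D ` {..n} = {..rank D n}"
  by (induction n) (auto simp: atMost_Suc rank_Suc)

lemma mono_surj_rank: "mono_surj n (rank D n) (rank D)"
  by (auto simp: mono_surj_def rank_image intro: mono_onI rank_mono)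

section \<open>Order-preserving surjections recovered from their stationary indices\<close>

lemma mono_surj_0: "mono_surj n p \<alpha> \<Longrightarrow> \<alpha> 0 = 0"
  and mono_surj_last: "mono_surj n p \<alpha> \<Longrightarrow> \<alpha> n = p"
proof -
  assume a: "mono_surj n p \<alpha>"
  then have mono: "\<And>i j. i \<le> j \<Longrightarrow> j \<le> n \<Longrightarrow> \<alpha> i \<le> \<alpha> j" and im: "\<alpha> ` {..n} = {..p}"
    by (auto simp: mono_surj_def mono_on_def)
  obtain i where "i \<le> n" "\<alpha> i = 0" using im by (force simp: image_iff set_eq_iff)
  then show "\<alpha> 0 = 0" using mono[of 0 i] by simp
  obtain i where "i \<le> n" "\<alpha> i = p" using im by (force simp: image_iff set_eq_iff)
  moreover have "\<alpha> n \<le> p" using im by blast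
  ultimately show "\<alpha> n = p" using mono[of i n] by simp
qed

lemma mono_surj_Suc:
  assumes "mono_surj n p \<alpha>" "i < n"
  shows "\<alpha> (Suc i) = \<alpha> i \<or> \<alpha> (Suc i) = Suc (\<alpha> i)"
proof -
  have mono: "\<And>i j. i \<le> j \<Longrightarrow> j \<le> n \<Longrightarrow> \<alpha> i \<le> \<alpha> j" and im: "\<alpha> ` {..n} = {..p}"
    using assms(1) by (auto simp: mono_surj_def mono_on_def)
  have "\<alpha> (Suc i) \<le> Suc (\<alpha> i)"
  proof (rule ccontr)
    assume less: "\<not> ?thesis"
    have "\<alpha> (Suc i) \<le> p" using im assms(2) by (metis Suc_leI atMost_iff imageI)
    with less have "Suc (\<alpha> i) \<in> \<alpha> ` {..n}" using im by simp
    then obtain j where j: "j \<le> n" "\<alpha> j = Suc (\<alpha> i)" by auto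
    show False
    proof (cases "j \<le> i")
      case True
      then have "\<alpha> j \<le> \<alpha> i" using mono assms(2) by simp
      with j show False by simp
    next
      case False
      then have "\<alpha> (Suc i) \<le> \<alpha> j" by (intro mono j) simp
      with j less show False by simp
    qed
  qed
  moreover have "\<alpha> i \<le> \<alpha> (Suc i)" using mono assms(2) by simp
  ultimately show ?thesis by auto
qed

lemma mono_surj_eq_rank:
  assumes "mono_surj n p \<alpha>"
  shows "i \<le> n \<Longrightarrow> \<alpha> i = rank {j. j < n \<and> \<alpha> j = \<alpha> (Suc j)} i"
proof (induction i)
  case 0 show ?case using mono_surj_0[OF assms] by simp
next
  case (Suc i)
  then show ?case using mono_surj_Suc[OF assms, of i] by (auto simp: rank_Suc)
qed

lemma degens_append:
  "degens X p (is @ [i]) x = degen X (p + length is) i (degens X p is x)"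
  by (induction X p "is" x rule: degens.induct) simp_all

text \<open>The degeneracy indices of the face of index \<open>k\<close> that are forced by those of the simplex.\<close>

definition merge_at :: "nat \<Rightarrow> nat set \<Rightarrow> nat set" where
  "merge_at k D = {i. if Suc i < k then i \<in> D else if Suc i = k then i \<in> D \<and> k \<in> D else Suc i \<in> D}"

lemma mem_merge_at:
  "i \<in> merge_at k D \<longleftrightarrow> (if Suc i < k then i \<in> D else if Suc i = k then i \<in> D \<and> k \<in> D else Suc i \<in> D)"
  by (simp add: merge_at_def)

context simplicial_set
begin

section \<open>The Eilenberg-Zilber decomposition in terms of degeneracy indices\<close>

lemma degen_inj:
  "\<lbrakk>x \<in> simplices X n; y \<in> simplices X n; i \<le> n; degen X n i x = degen X n i y\<rbrakk> \<Longrightarrow> x = y"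
  using face_degen_same by metis

text \<open>The face \<open>i\<close> of both sides shows that \<open>x\<close> is the degeneracy
  \<open>j - 1\<close> of the face \<open>i\<close> of \<open>y\<close>; this face is the witness
  \<open>w\<close>. Injectivity of the degeneracy \<open>j\<close> then gives the formula for
  \<open>y\<close>.\<close>

lemma degen_eq_degen:
  assumes x: "x \<in> simplices X n" "y \<in> simplices X n" and ij: "i < j" "j \<le> n"
    and eq: "degen X n i x = degen X n j y"
  obtains m w where "n = Suc m" "w \<in> simplices X m" "x = degen X m (j - 1) w" "y = degen X m i w"
proof -
  obtain m where m: "n = Suc m" using ij by (cases n) auto
  let ?w = "face X n i y"
  have w: "?w \<in> simplices X m" using x ij face_closed m by simp
  have 1: "x = degen X m (j - 1) ?w"
    using face_degen_same[OF x(1), of i] face_degen_less[OF x(2) ij] eq ij m by simp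
  have "degen X n j (degen X m i ?w) = degen X n j y"
    using degen_degen[OF w, of i "j - 1"] ij 1 eq m by simp
  then have "y = degen X m i ?w"
    using degen_inj[OF x(2) _ ij(2)] degen_closed[OF w, of i] ij m by simp
  with 1 w m that show thesis by blast
qed

text \<open>From left to right, \<open>degen_eq_degen\<close> compares two presentations of one
  simplex; from right to left, the two degeneracies are commuted.\<close>

lemma degen_set_degen:
  assumes y: "y \<in> simplices X n" and k: "k \<le> n"
  shows "degen_set X (Suc n) (degen X n k y) =
    {i. if i < k then i \<in> degen_set X n y else i = k \<or> i - 1 \<in> degen_set X n y}"
proof (intro equalityI subsetI)
  fix j assume "j \<in> degen_set X (Suc n) (degen X n k y)"
  then obtain z where z: "j \<le> n" "z \<in> simplices X n" "degen X n k y = degen X n j z"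
    by (rule degen_setE)
  consider "j = k" | "k < j" | "j < k" by linarith
  then show "j \<in> {i. if i < k then i \<in> degen_set X n y else i = k \<or> i - 1 \<in> degen_set X n y}"
  proof cases
    case 2
    obtain m w where "n = Suc m" "w \<in> simplices X m" "y = degen X m (j - 1) w"
      using degen_eq_degen[OF y z(2) 2 z(1) z(3)] by blast
    with z(1) have "j - 1 \<in> degen_set X n y" using degen_setI[of "j - 1" m w X] by simp
    with 2 show ?thesis by simp
  next
    case 3
    obtain m w where "n = Suc m" "w \<in> simplices X m" "y = degen X m j w"
      using degen_eq_degen[OF z(2) y 3 k z(3)[symmetric]] by blast
    with 3 k have "j \<in> degen_set X n y" using degen_setI[of j m w X] by simp
    with 3 show ?thesis by simp
  qed simp
next
  fix i assume i: "i \<in> {i. if i < k then i \<in> degen_set X n y else i = k \<or> i - 1 \<in> degen_set X n y}"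
  consider "i = k" | "i < k" "i \<in> degen_set X n y" | "k < i" "i - 1 \<in> degen_set X n y"
    using i by (cases i k rule: linorder_cases) auto
  then show "i \<in> degen_set X (Suc n) (degen X n k y)"
  proof cases
    case 1 with y k show ?thesis by (simp add: degen_setI)
  next
    case 2
    then obtain m z where z: "n = Suc m" "i \<le> m" "z \<in> simplices X m" "y = degen X m i z"
      by (auto simp: degen_set_def)
    have "degen X n k y = degen X n i (degen X m (k - 1) z)"
      using degen_degen[OF z(3), of i "k - 1"] 2 k z by simp
    then show ?thesis
      using degen_setI[of i n "degen X m (k - 1) z" X] degen_closed[OF z(3), of "k - 1"] 2 k z by simp
  next
    case 3
    then obtain m z where z: "n = Suc m" "i - 1 \<le> m" "z \<in> simplices X m" "y = degen X m (i - 1) z"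
      by (auto simp: degen_set_def)
    have "degen X n k y = degen X n i (degen X m k z)"
      using degen_degen[OF z(3), of k "i - 1"] 3 z by simp
    then show ?thesis
      using degen_setI[of i n "degen X m k z" X] degen_closed[OF z(3), of k] 3 z by simp
  qed
qed

lemma degen_set_of_degen:
  assumes "y \<in> simplices X n" "k \<le> n"
  shows "degen_set X n y = {i. if i < k then i \<in> degen_set X (Suc n) (degen X n k y)
    else Suc i \<in> degen_set X (Suc n) (degen X n k y)}"
  using assms by (auto simp: degen_set_degen)

lemma core_of_closed: "core_of X p \<phi> n x \<Longrightarrow> x \<in> simplices X n"
  by (induction rule: core_of.induct) (auto simp: nondegenerate_iff degen_closed)

lemma ex_core_of: "x \<in> simplices X n \<Longrightarrow> \<exists>p \<phi>. core_of X p \<phi> n x"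
proof (induction n arbitrary: x)
  case 0
  then have "x \<in> nondegenerate X 0" by (simp add: nondegenerate_def)
  then show ?case by (blast intro: core_of.refl)
next
  case (Suc n)
  show ?case
  proof (cases "degen_set X (Suc n) x = {}")
    case True
    with Suc.prems have "x \<in> nondegenerate X (Suc n)" by (simp add: nondegenerate_iff)
    then show ?thesis by (blast intro: core_of.refl)
  next
    case False
    then obtain i where "i \<in> degen_set X (Suc n) x" by blast
    then obtain y where "i \<le> n" "y \<in> simplices X n" "x = degen X n i y" by (rule degen_setE)
    with Suc.IH[of y] show ?thesis by (blast intro: core_of.step)
  qed
qed

lemma core_of_cases:
  assumes "core_of X p \<phi> n x"
  obtains "n = p" "x = \<phi>" "x \<in> nondegenerate X n"
    | m i y where "n = Suc m" "i \<le> m" "x = degen X m i y" "core_of X p \<phi> m y"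
  using assms by cases blast+

text \<open>If one simplex is a degeneracy of \<open>y\<close> and of \<open>z\<close> with
  different indices, then \<open>y\<close> and \<open>z\<close> are degeneracies of a common
  \<open>w\<close> and inherit its core, so the induction hypothesis applies to both.\<close>

lemma core_of_unique: "core_of X p \<phi> n x \<Longrightarrow> core_of X q \<psi> n x \<Longrightarrow> p = q \<and> \<phi> = \<psi>"
proof (induction n arbitrary: p \<phi> q \<psi> x rule: less_induct)
  case (less n)
  have degenerate: "x \<notin> nondegenerate X n"
    if "n = Suc m" "i \<le> m" "x = degen X m i y" "core_of X r \<chi> m y" for m i y r \<chi>
    using that core_of_closed degen_setI[of i m y X] by (auto simp: nondegenerate_iff)
  have aux: "r = s \<and> \<chi> = \<omega>"
    if n: "n = Suc m" and ij: "i < j" "j \<le> m" and eq: "degen X m i y = degen X m j z"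
      and y: "core_of X r \<chi> m y" and z: "core_of X s \<omega> m z" for m i j y z r s \<chi> \<omega>
  proof -
    obtain l w where w: "m = Suc l" "w \<in> simplices X l" "y = degen X l (j - 1) w" "z = degen X l i w"
      using degen_eq_degen[OF core_of_closed[OF y] core_of_closed[OF z] ij eq] .
    obtain t \<theta> where "core_of X t \<theta> l w" using ex_core_of w(2) by blast
    then have "core_of X t \<theta> m y" "core_of X t \<theta> m z"
      using w ij core_of.step[of X t \<theta> l w] by auto
    with less.IH[of m] y z n show ?thesis by blast
  qed
  from less.prems(1) show ?case
  proof (cases rule: core_of_cases)
    case 1
    from less.prems(2) show ?thesis
      by (cases rule: core_of_cases) (use 1 degenerate in blast)+
  next
    case (2 m i y)
    note y = this
    from less.prems(2) show ?thesis
    proof (cases rule: core_of_cases)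
      case 1 with degenerate[OF y] show ?thesis by simp
    next
      case (2 m' j z)
      note z = this
      from y z have m': "m' = m" by simp
      consider "i = j" | "i < j" | "j < i" by linarith
      then show ?thesis
      proof cases
        case 1
        with y z m' have "y = z"
          using degen_inj[OF core_of_closed[OF y(4)], of z i] core_of_closed[OF z(4)] by simp
        with less.IH[OF _ y(4)] z m' show ?thesis by simp
      next
        case 2
        then show ?thesis
          using aux[of m i j y z] y z m' by simp
      next
        case 3
        then show ?thesis
          using aux[of m j i z y q \<psi> p \<phi>] y z m' by simp
      qed
    qed
  qed
qed

lemma core_of_degen_iff:
  assumes "y \<in> simplices X n" "i \<le> n"
  shows "core_of X p \<phi> (Suc n) (degen X n i y) \<longleftrightarrow> core_of X p \<phi> n y"
proof
  assume c: "core_of X p \<phi> (Suc n) (degen X n i y)"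
  obtain q \<psi> where y: "core_of X q \<psi> n y" using ex_core_of assms(1) by blast
  from core_of_unique[OF c core_of.step[OF y assms(2)]] y show "core_of X p \<phi> n y" by simp
qed (rule core_of.step, use assms in auto)

lemma core_of_dim: "core_of X p \<phi> n x \<Longrightarrow> p + card (degen_set X n x) = n"
proof (induction rule: core_of.induct)
  case refl then show ?case by (simp add: nondegenerate_iff)
next
  case (step n x i)
  let ?D = "degen_set X n x" and ?f = "\<lambda>j. if j < i then j else Suc j"
  \<comment> \<open>The degeneracy \<open>i\<close> adds the index \<open>i\<close> and moves the
    indices from \<open>i\<close> on up by one, hence adds exactly one element.\<close>
  have "degen_set X (Suc n) (degen X n i x) = insert i (?f ` ?D)"
    unfolding degen_set_degen[OF core_of_closed[OF step(1)] step(2)]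
  proof (intro equalityI subsetI)
    fix j assume j: "j \<in> {j. if j < i then j \<in> ?D else j = i \<or> j - 1 \<in> ?D}"
    consider "j = i" | "j < i" | "i < j" by linarith
    then show "j \<in> insert i (?f ` ?D)"
    proof cases
      case 3
      with j have "j = ?f (j - 1)" "j - 1 \<in> ?D" by auto
      then show ?thesis by blast
    qed (use j in auto)
  qed auto
  moreover have "card (?f ` ?D) = card ?D"
    by (rule card_image) (auto simp: inj_on_def split: if_splits)
  moreover have "i \<notin> ?f ` ?D" by auto
  ultimately show ?case using step by simp
qed

text \<open>A common degeneracy index is removed from both simplices. What remains has the same
  core, and the same index set because the degeneracy acts on index sets invertibly.\<close>

lemma core_of_degen_set_determine:
  "\<lbrakk>core_of X p \<phi> n x; core_of X p \<phi> n y; degen_set X n x = degen_set X n y\<rbrakk> \<Longrightarrow> x = y"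
proof (induction n arbitrary: x y)
  case 0
  then show ?case by (auto elim!: core_of_cases)
next
  case (Suc n)
  show ?case
  proof (cases "degen_set X (Suc n) x = {}")
    case True
    then have "p = Suc n" using core_of_dim[OF Suc.prems(1)] by simp
    have "z = \<phi>" if "core_of X p \<phi> (Suc n) z" "degen_set X (Suc n) z = {}" for z
      using that(1)
    proof (cases rule: core_of_cases)
      case (2 m i y)
      then have "i \<in> degen_set X (Suc n) z" using degen_setI[of i n y X] core_of_closed by simp
      with that(2) show ?thesis by simp
    qed simp
    with Suc.prems True show ?thesis by metis
  next
    case False
    then obtain i where i: "i \<in> degen_set X (Suc n) x" by blast
    then obtain x' where x': "i \<le> n" "x' \<in> simplices X n" "x = degen X n i x'" by (rule degen_setE)
    obtain y' where y': "y' \<in> simplices X n" "y = degen X n i y'"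
      using i Suc.prems(3) by (auto elim: degen_setE)
    have "x' = y'"
      using Suc.IH[of x' y'] Suc.prems x' y' degen_set_of_degen[OF x'(2,1)] degen_set_of_degen[OF y'(1) x'(1)]
      by (simp add: core_of_degen_iff)
    with x' y' show ?thesis by simp
  qed
qed

text \<open>The degeneracies are applied with increasing indices, so a new one never moves the
  indices obtained before.\<close>

lemma surj_pullback_core:
  assumes \<phi>: "\<phi> \<in> nondegenerate X p" and \<alpha>: "mono_surj n p \<alpha>"
  shows "core_of X p \<phi> n (surj_pullback X n p \<alpha> \<phi>)"
    and "degen_set X n (surj_pullback X n p \<alpha> \<phi>) = {i. i < n \<and> \<alpha> i = \<alpha> (Suc i)}"
proof -
  let ?L = "\<lambda>k. filter (\<lambda>i. \<alpha> i = \<alpha> (Suc i)) [0..<k]"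
  have le: "\<alpha> k \<le> p" if "k \<le> n" for k using \<alpha> that by (auto simp: mono_surj_def)
  \<comment> \<open>After the indices below \<open>k\<close> the dimension reached is
    \<open>p + k - \<alpha> k\<close>, which is at least \<open>k\<close>; so the degeneracy
    \<open>k\<close> exists when its turn comes.\<close>
  have "k \<le> n \<Longrightarrow> length (?L k) + \<alpha> k = k \<and> core_of X p \<phi> (p + length (?L k)) (degens X p (?L k) \<phi>) \<and>
      degen_set X (p + length (?L k)) (degens X p (?L k) \<phi>) = {i. i < k \<and> \<alpha> i = \<alpha> (Suc i)}" for k
  proof (induction k)
    case 0
    show ?case using \<phi> mono_surj_0[OF \<alpha>] by (auto simp: nondegenerate_iff intro: core_of.refl)
  next
    case (Suc k)
    let ?x = "degens X p (?L k) \<phi>" and ?m = "p + length (?L k)"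
    have IH: "length (?L k) + \<alpha> k = k" "core_of X p \<phi> ?m ?x"
      "degen_set X ?m ?x = {i. i < k \<and> \<alpha> i = \<alpha> (Suc i)}"
      using Suc by auto
    show ?case
    proof (cases "\<alpha> k = \<alpha> (Suc k)")
      case False
      with mono_surj_Suc[OF \<alpha>, of k] Suc.prems have "\<alpha> (Suc k) = Suc (\<alpha> k)" by auto
      moreover have "{i. i < Suc k \<and> \<alpha> i = \<alpha> (Suc i)} = {i. i < k \<and> \<alpha> i = \<alpha> (Suc i)}"
        using False less_Suc_eq by auto
      ultimately show ?thesis using IH False by simp
    next
      case True
      have k: "k \<le> ?m" using IH(1) le[of k] Suc.prems by linarith
      have L: "?L (Suc k) = ?L k @ [k]" using True by simp
      have "degen_set X (Suc ?m) (degen X ?m k ?x) = {i. if i < k then \<alpha> i = \<alpha> (Suc i) else i = k}"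
        unfolding degen_set_degen[OF core_of_closed[OF IH(2)] k] IH(3) by auto
      also have "\<dots> = {i. i < Suc k \<and> \<alpha> i = \<alpha> (Suc i)}" using True by (auto simp: less_Suc_eq)
      finally have "degen_set X (Suc ?m) (degen X ?m k ?x) = {i. i < Suc k \<and> \<alpha> i = \<alpha> (Suc i)}" .
      with IH core_of.step[OF IH(2) k] True show ?thesis
        unfolding L degens_append by simp
    qed
  qed
  from this[of n] have *: "length (?L n) + p = n" "core_of X p \<phi> (p + length (?L n)) (degens X p (?L n) \<phi>)"
     "degen_set X (p + length (?L n)) (degens X p (?L n) \<phi>) = {i. i < n \<and> \<alpha> i = \<alpha> (Suc i)}"
    using mono_surj_last[OF \<alpha>] by auto
  then have n: "p + length (?L n) = n" by simp
  show "core_of X p \<phi> n (surj_pullback X n p \<alpha> \<phi>)"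
    "degen_set X n (surj_pullback X n p \<alpha> \<phi>) = {i. i < n \<and> \<alpha> i = \<alpha> (Suc i)}"
    using *(2,3) unfolding n surj_pullback_def by auto
qed

lemma surj_pullback_eq_iff:
  assumes \<phi>: "\<phi> \<in> nondegenerate X p" and \<alpha>: "mono_surj n p \<alpha>"
  shows "x = surj_pullback X n p \<alpha> \<phi> \<longleftrightarrow>
    core_of X p \<phi> n x \<and> degen_set X n x = {i. i < n \<and> \<alpha> i = \<alpha> (Suc i)}"
  using surj_pullback_core[OF assms] core_of_degen_set_determine by metis

lemma core_of_rank: "core_of X p \<phi> n x \<Longrightarrow> rank (degen_set X n x) n = p"
  using core_of_dim[of p \<phi> n x] degen_set_bound[of _ X n x]
  by (simp add: rank_def card_Diff_subset subset_iff)

text \<open>By the simplicial identities a face keeps the degeneracies away from the vertex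
  \<open>k\<close>, up to a shift, and merges the indices \<open>k - 1\<close> and \<open>k\<close>.
  Equality can fail, since a face of a non-degenerate simplex may be degenerate.\<close>

lemma merge_at_subset_degen_set:
  assumes x: "x \<in> simplices X (Suc n)" and k: "k \<le> Suc n"
  shows "merge_at k (degen_set X (Suc n) x) \<subseteq> degen_set X n (face X (Suc n) k x)"
proof
  fix i assume i: "i \<in> merge_at k (degen_set X (Suc n) x)"
  consider (below) "Suc i < k" "i \<in> degen_set X (Suc n) x"
    | (at) "Suc i = k" "i \<in> degen_set X (Suc n) x" "Suc i \<in> degen_set X (Suc n) x"
    | (above) "k \<le> i" "Suc i \<in> degen_set X (Suc n) x"
    using i by (auto simp: merge_at_def split: if_splits)
  then show "i \<in> degen_set X n (face X (Suc n) k x)"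
  proof cases
    case below
    then obtain z where z: "i \<le> n" "z \<in> simplices X n" "x = degen X n i z" by (auto elim: degen_setE)
    obtain m where m: "n = Suc m" using below k by (cases n) auto
    have "face X (Suc n) k x = degen X m i (face X n (k - 1) z)"
      using face_degen_greater[OF z(2) below(1) k] z(3) m by simp
    then show ?thesis
      using degen_setI[of i m "face X n (k - 1) z" X] face_closed[of z m "k - 1"] z m below k by simp
  next
    case at
    then obtain z where z: "i \<le> n" "z \<in> simplices X n" "x = degen X n i z" by (auto elim: degen_setE)
    with at face_degen_Suc[OF z(2,1)] degen_set_of_degen[OF z(2,1)] show ?thesis by auto
  next
    case above
    then obtain z where z: "Suc i \<le> n" "z \<in> simplices X n" "x = degen X n (Suc i) z"
      by (auto elim: degen_setE)
    obtain m where m: "n = Suc m" using z by (cases n) auto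
    have "face X (Suc n) k x = degen X m i (face X n k z)"
      using face_degen_less[OF z(2) _ z(1), of k] above z(3) m by simp
    then show ?thesis
      using degen_setI[of i m "face X n k z" X] face_closed[of z m k] z m above by simp
  qed
qed

text \<open>The face \<open>k\<close> undoes a degeneracy of index \<open>k\<close> or
  \<open>k - 1\<close>, so it is the simplex before that degeneracy.\<close>

lemma face_of_degenerate:
  assumes x: "x \<in> simplices X (Suc n)"
    and k: "k \<in> degen_set X (Suc n) x \<or> 0 < k \<and> k - 1 \<in> degen_set X (Suc n) x"
  shows "degen_set X n (face X (Suc n) k x) = merge_at k (degen_set X (Suc n) x)"
    and "core_of X p \<phi> n (face X (Suc n) k x) \<longleftrightarrow> core_of X p \<phi> (Suc n) x"
proof -
  obtain i where i: "k = i \<or> k = Suc i" "i \<in> degen_set X (Suc n) x"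
    using k by (metis Suc_diff_1)
  then obtain z where z: "i \<le> n" "z \<in> simplices X n" "x = degen X n i z"
    by (auto elim: degen_setE)
  have f: "face X (Suc n) k x = z"
    using i z face_degen_same[OF z(2,1)] face_degen_Suc[OF z(2,1)] by auto
  show "degen_set X n (face X (Suc n) k x) = merge_at k (degen_set X (Suc n) x)"
    unfolding f degen_set_of_degen[OF z(2,1), folded z(3)] using i
    by (auto simp: merge_at_def not_less split: if_splits dest!: le_antisym)
  show "core_of X p \<phi> n (face X (Suc n) k x) \<longleftrightarrow> core_of X p \<phi> (Suc n) x"
    unfolding f using core_of_degen_iff[OF z(2,1)] z(3) by simp
qed

lemma rank_degen_set:
  assumes "x \<in> simplices X n"
  shows "rank (degen_set X n x) n + card (degen_set X n x) = n"
  using ex_core_of[OF assms] core_of_rank core_of_dim by metis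

text \<open>This face undoes no degeneracy: all indices survive although the dimension is one less.
  Since the dimension is the rank plus the number of degeneracy indices, the rank drops, by more
  than 1 if the face acquires new degeneracies.\<close>

lemma rank_face_less:
  assumes x: "x \<in> simplices X (Suc n)" and k: "k \<le> Suc n"
    and "k \<notin> degen_set X (Suc n) x" "k = 0 \<or> k - 1 \<notin> degen_set X (Suc n) x"
  shows "rank (degen_set X n (face X (Suc n) k x)) n < rank (degen_set X (Suc n) x) (Suc n)"
proof -
  let ?D = "degen_set X (Suc n) x" and ?D' = "degen_set X n (face X (Suc n) k x)"
  let ?f = "\<lambda>i. if Suc i < k then i else Suc i"
  have "j \<in> ?f ` merge_at k ?D" if "j \<in> ?D" for j
  proof (cases "j < k")
    case True
    with that assms have "Suc j < k" by (cases "Suc j = k") auto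
    with that have "j = ?f j" "j \<in> merge_at k ?D" by (auto simp: merge_at_def)
    then show ?thesis by blast
  next
    case False
    with that assms have "k < j" by (cases "j = k") auto
    with that have "j = ?f (j - 1)" "j - 1 \<in> merge_at k ?D" by (auto simp: merge_at_def)
    then show ?thesis by blast
  qed
  then have "?D \<subseteq> ?f ` ?D'" using merge_at_subset_degen_set[OF x k] by blast
  then have "card ?D \<le> card ?D'" by (rule surj_card_le[rotated]) simp
  with rank_degen_set[OF x] rank_degen_set[OF face_closed[OF x k]] show ?thesis by linarith
qed

end

section \<open>Normalized chains\<close>

text \<open>The unnormalized differential of a simplex. The normalized one is its projection to the
  non-degenerate simplices, which allows \<open>d d = 0\<close> to be proved before
  normalization.\<close>

definition alternating_faces :: "('a, 'm) sset_scheme \<Rightarrow> nat \<Rightarrow> 'a \<Rightarrow> ('a \<Rightarrow>\<^sub>0 int)" where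
  "alternating_faces X p x = (\<Sum>i\<le>p. frag_cmul ((-1) ^ i) (frag_of (face X p i x)))"

lemma span_proj_sum: "finite I \<Longrightarrow> span_proj S (\<Sum>i\<in>I. f i) = (\<Sum>i\<in>I. span_proj S (f i))"
  unfolding span_proj_def by (simp add: frag_extend_sum o_def)

lemma span_proj_frag_cmul: "span_proj S (frag_cmul a c) = frag_cmul a (span_proj S c)"
  by (simp add: span_proj_def frag_extend_cmul)

lemma span_proj_frag_of: "span_proj S (frag_of x) = (if x \<in> S then frag_of x else 0)"
  by (simp add: span_proj_def)

lemma cells_normalized_chains [simp]: "cells (normalized_chains X) = nondegenerate X"
  by (simp add: normalized_chains_def)

lemma bdry_normalized_chains_0: "bdry (normalized_chains X) 0 c = 0"
  by (simp add: normalized_chains_def frag_extend_eq_0)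

lemma bdry_normalized_chains_Suc:
  "bdry (normalized_chains X) (Suc p) c =
    span_proj (nondegenerate X p) (frag_extend (alternating_faces X (Suc p)) c)"
proof -
  have "bdry (normalized_chains X) (Suc p) c
      = frag_extend (\<lambda>x. span_proj (nondegenerate X p) (alternating_faces X (Suc p) x)) c"
    by (simp add: normalized_chains_def alternating_faces_def span_proj_sum span_proj_frag_cmul
        span_proj_frag_of del: sum.atMost_Suc)
  also have "\<dots> = span_proj (nondegenerate X p) (frag_extend (alternating_faces X (Suc p)) c)"
    by (simp add: frag_extend_def span_proj_sum span_proj_frag_cmul)
  finally show ?thesis .
qed

lemma lookup_bdry_normalized_chains:
  assumes "s \<in> nondegenerate X p"
  shows "Poly_Mapping.lookup (bdry (normalized_chains X) (Suc p) (frag_of t)) s =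
    (\<Sum>i\<le>Suc p. if face X (Suc p) i t = s then (-1) ^ i else 0)"
  using assms
  by (simp add: bdry_normalized_chains_Suc lookup_span_proj alternating_faces_def lookup_sum
      if_distrib eq_commute cong: if_cong del: sum.atMost_Suc)

context simplicial_set
begin

lemma alternating_faces_faces:
  assumes x: "x \<in> simplices X (Suc (Suc p))"
  shows "frag_extend (alternating_faces X (Suc p)) (alternating_faces X (Suc (Suc p)) x) = 0"
proof -
  let ?t = "\<lambda>(j, i). frag_cmul ((-1) ^ (i + j)) (frag_of (face X (Suc p) i (face X (Suc (Suc p)) j x)))"
  let ?I = "{..Suc (Suc p)} \<times> {..Suc p}"
  let ?A = "{(j, i). i < j \<and> j \<le> Suc (Suc p)}" and ?B = "{(j, i). j \<le> i \<and> i \<le> Suc p}"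
  have fin: "finite ?A" "finite ?B"
    by (auto intro: finite_subset[of _ "{..Suc (Suc p)} \<times> {..Suc p}"])
  have "frag_extend (alternating_faces X (Suc p)) (alternating_faces X (Suc (Suc p)) x)
      = (\<Sum>j\<le>Suc (Suc p). \<Sum>i\<le>Suc p. ?t (j, i))"
    unfolding alternating_faces_def[of _ "Suc (Suc p)"]
    by (simp add: frag_extend_sum frag_extend_cmul alternating_faces_def frag_cmul_sum o_def
        power_add mult.commute del: sum.atMost_Suc)
  also have "\<dots> = sum ?t ?I" by (simp add: sum.cartesian_product del: sum.atMost_Suc)
  also have "?I = ?A \<union> ?B" by auto
  also have "sum ?t (?A \<union> ?B) = sum ?t ?A + sum ?t ?B"
    by (rule sum.union_disjoint[OF fin]) auto
  \<comment> \<open>The term of \<open>(j, i)\<close> with \<open>i < j\<close> cancels against that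
    of \<open>(i, j - 1)\<close>: the iterated faces agree by the simplicial identity and the signs
    are opposite.\<close>
  also have "sum ?t ?A = sum (\<lambda>u. - ?t u) ?B"
  proof (rule sum.reindex_bij_witness[where i = "\<lambda>(j, i). (Suc i, j)" and j = "\<lambda>(j, i). (i, j - 1)"])
    fix a assume "a \<in> ?A"
    then obtain j i where a: "a = (j, i)" "i < j" "j \<le> Suc (Suc p)" by auto
    have "(-1 :: int) ^ (j - 1 + i) = - ((-1) ^ (i + j))"
      using a by (cases j) (simp_all add: add.commute)
    then show "- ?t (case a of (j, i) \<Rightarrow> (i, j - 1)) = ?t a"
      using face_face[OF x a(2,3)] a by simp
  qed auto
  finally show ?thesis by (simp add: sum_negf)
qed

text \<open>The faces \<open>k\<close> and \<open>k + 1\<close> are both \<open>y\<close>, with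
  opposite signs; all other faces are degenerate.\<close>

lemma span_proj_alternating_faces_degen:
  assumes y: "y \<in> simplices X p" and k: "k \<le> p"
  shows "span_proj (nondegenerate X p) (alternating_faces X (Suc p) (degen X p k y)) = 0"
proof -
  let ?t = "\<lambda>i. frag_cmul ((-1) ^ i) (span_proj (nondegenerate X p)
    (frag_of (face X (Suc p) i (degen X p k y))))"
  have "?t i = 0" if i: "i \<le> Suc p" "i \<noteq> k" "i \<noteq> Suc k" for i
  proof -
    obtain m where m: "p = Suc m" using i k by (cases p) auto
    have "degen_set X p (face X (Suc p) i (degen X p k y)) \<noteq> {}"
    proof (cases "i < k")
      case True
      then have "k - 1 \<in> degen_set X (Suc m) (degen X m (k - 1) (face X p i y))"
        using face_closed[of y m i] y k m by (intro degen_setI) simp_all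
      then show ?thesis using face_degen_less[OF y True k] m by auto
    next
      case False
      with i have "Suc k < i" by simp
      then show ?thesis
        using face_degen_greater[OF y _ i(1), of k] degen_setI[of k m "face X p (i - 1) y" X]
          face_closed[of y m "i - 1"] y k m i by auto
    qed
    then show ?thesis by (simp add: span_proj_frag_of nondegenerate_iff)
  qed
  then have "(\<Sum>i\<le>Suc p. ?t i) = (\<Sum>i\<in>{k, Suc k}. ?t i)"
    using k by (intro sum.mono_neutral_right) auto
  also have "\<dots> = 0"
    using face_degen_same[OF y k] face_degen_Suc[OF y k] by (simp add: frag_cmul_distrib[symmetric])
  finally show ?thesis
    by (simp add: alternating_faces_def span_proj_sum span_proj_frag_cmul del: sum.atMost_Suc)
qed

lemma alternating_faces_keys:
  "x \<in> simplices X (Suc p) \<Longrightarrow> Poly_Mapping.keys (alternating_faces X (Suc p) x) \<subseteq> simplices X p"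
  using face_closed[of x p]
  by (auto simp: alternating_faces_def simp del: sum.atMost_Suc dest!: subsetD[OF keys_sum] split: if_splits)

theorem chain_complex_normalized_chains: "chain_complex (normalized_chains X)"
proof -
  let ?N = "\<lambda>p. span_proj (nondegenerate X p)" and ?d = "\<lambda>p. frag_extend (alternating_faces X p)"
  have bdry_hom: "bdry (normalized_chains X) (Suc p)
      \<in> hom (free_Abelian_group (nondegenerate X (Suc p))) (free_Abelian_group (nondegenerate X p))" for p
    by (rule hom_freeI) (auto simp: bdry_normalized_chains_Suc keys_span_proj frag_extend_add span_proj_add)
  \<comment> \<open>Degenerate simplices span a subcomplex, so a projection before the differential
    changes nothing once the result is projected as well.\<close>
  have N_d: "?N p (?d (Suc p) (?N (Suc p) c)) = ?N p (?d (Suc p) c)"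
    if "Poly_Mapping.keys c \<subseteq> simplices X (Suc p)" for p c
    using that
  proof (induction c rule: frag_induction)
    case (one x)
    show ?case
    proof (cases "x \<in> nondegenerate X (Suc p)")
      case False
      with one obtain i y where "i \<le> p" "y \<in> simplices X p" "x = degen X p i y"
        by (auto simp: nondegenerate_def)
      with False show ?thesis by (simp add: span_proj_frag_of span_proj_alternating_faces_degen)
    qed (simp add: span_proj_frag_of)
  qed (simp_all add: span_proj_diff frag_extend_diff)
  have "bdry (normalized_chains X) p (bdry (normalized_chains X) (Suc p) c) = 0"
    if c: "Poly_Mapping.keys c \<subseteq> nondegenerate X (Suc p)" for p c
  proof (cases p)
    case 0 then show ?thesis by (simp add: bdry_normalized_chains_0)
  next
    case (Suc q)
    have c': "Poly_Mapping.keys c \<subseteq> simplices X (Suc (Suc q))"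
      using c Suc by (auto simp: nondegenerate_def)
    have "frag_extend (alternating_faces X (Suc (Suc q)))
        \<in> hom (free_Abelian_group (simplices X (Suc (Suc q)))) (free_Abelian_group (simplices X (Suc q)))"
      by (rule frag_extend_hom[OF alternating_faces_keys])
    from hom_free_keys[OF this c']
    have k: "Poly_Mapping.keys (?d (Suc (Suc q)) c) \<subseteq> simplices X (Suc q)" .
    have "?d (Suc q) (?d (Suc (Suc q)) c) = 0"
      using c' by (induction c rule: frag_induction)
        (simp_all add: alternating_faces_faces frag_extend_diff)
    with N_d[OF k] show ?thesis by (simp add: Suc bdry_normalized_chains_Suc)
  qed
  with bdry_hom show ?thesis by (simp add: chain_complex_def bdry_normalized_chains_0)
qed

end

section \<open>Lattice paths\<close>

text \<open>A lattice path of length \<open>n\<close> is encoded by the set \<open>D\<close> of its vertical and the set \<open>E\<close> of its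
  horizontal steps, which are the sets of degeneracy indices of the two components of a simplex of the
  product.\<close>

definition lattice_path :: "nat \<Rightarrow> nat set \<Rightarrow> nat set \<Rightarrow> (nat \<times> nat) list" where
  "lattice_path n D E = map (\<lambda>i. (rank D i, rank E i)) [0..<Suc n]"

definition event :: "nat \<Rightarrow> nat set \<Rightarrow> nat set \<Rightarrow> nat \<Rightarrow> bool" where
  "event n D E k \<longleftrightarrow> k < n \<and> (k \<notin> D \<and> k \<notin> E \<or> 0 < k \<and> k - 1 \<in> D \<and> k \<in> E)"

text \<open>At an event, \<open>k\<close> lies in \<open>E\<close> for a bend and outside
  \<open>E\<close> for a diagonal step, so this membership alone separates the two kinds.\<close>

definition source_at :: "nat \<Rightarrow> nat set \<Rightarrow> nat set \<Rightarrow> nat \<Rightarrow> bool" where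
  "source_at n D E k \<longleftrightarrow> event n D E k \<and> k \<notin> E \<and> (\<forall>j>k. \<not> event n D E j)"

definition target_at :: "nat \<Rightarrow> nat set \<Rightarrow> nat set \<Rightarrow> nat \<Rightarrow> bool" where
  "target_at n D E k \<longleftrightarrow> event n D E k \<and> k \<in> E \<and> (\<forall>j>k. \<not> event n D E j)"

lemma length_lattice_path [simp]: "length (lattice_path n D E) = Suc n"
  by (simp add: lattice_path_def)

lemma nth_lattice_path: "i \<le> n \<Longrightarrow> lattice_path n D E ! i = (rank D i, rank E i)"
  by (simp add: lattice_path_def del: upt_Suc)

lemma diag_step_lattice_path: "diag_step (lattice_path n D E) k \<longleftrightarrow> k < n \<and> k \<notin> D \<and> k \<notin> E"
  by (auto simp: diag_step_def nth_lattice_path rank_Suc)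

lemma bend_lattice_path:
  assumes "D \<inter> E = {}"
  shows "bend (lattice_path n D E) k \<longleftrightarrow> 0 < k \<and> k < n \<and> k - 1 \<in> D \<and> k \<in> E"
proof (cases k)
  case (Suc j)
  with assms show ?thesis
    by (auto simp: bend_def v_step_def h_step_def nth_lattice_path rank_Suc)
qed (simp add: bend_def)

lemma event_lattice_path:
  assumes "D \<inter> E = {}"
  shows "event n D E k \<longleftrightarrow> diag_step (lattice_path n D E) k \<or> bend (lattice_path n D E) k"
  by (auto simp: event_def diag_step_lattice_path bend_lattice_path[OF assms])

lemma first_event_lattice_path:
  assumes "D \<inter> E = {}"
  shows "first_event (lattice_path n D E) k \<and> diag_step (lattice_path n D E) k \<longleftrightarrow> source_at n D E k"
    and "first_event (lattice_path n D E) k \<and> bend (lattice_path n D E) k \<longleftrightarrow> target_at n D E k"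
  using assms
  by (auto simp: first_event_def source_at_def target_at_def event_lattice_path[OF assms]
      diag_step_lattice_path bend_lattice_path[OF assms])

lemma lattice_path_inject:
  assumes "lattice_path n D E = lattice_path n D' E'"
    "D \<subseteq> {..<n}" "E \<subseteq> {..<n}" "D' \<subseteq> {..<n}" "E' \<subseteq> {..<n}"
  shows "D = D' \<and> E = E'"
proof -
  have eq: "rank D i = rank D' i \<and> rank E i = rank E' i" if "i \<le> n" for i
    using arg_cong[OF assms(1), of "\<lambda>\<pi>. \<pi> ! i"] that by (simp add: nth_lattice_path)
  have "i \<in> D \<longleftrightarrow> i \<in> D'" "i \<in> E \<longleftrightarrow> i \<in> E'" if "i < n" for i
    using eq[of i] eq[of "Suc i"] that by (auto simp: rank_Suc split: if_splits)
  with assms(2-) show ?thesis by blast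
qed

text \<open>Without the point \<open>k\<close> the steps \<open>k - 1\<close> and \<open>k\<close>
  become one. The coordinate is constant on at least one of them, so it still rises by at most
  1.\<close>

lemma rank_merge_at:
  assumes "0 < k" "k \<in> D \<or> k - 1 \<in> D"
  shows "rank (merge_at k D) i = rank D (if i < k then i else Suc i)"
proof (induction i)
  case 0 with assms show ?case by simp
next
  case (Suc i)
  consider "Suc i < k" | "Suc i = k" | "k \<le> i" by linarith
  then show ?case
    by cases (use Suc assms in \<open>auto simp: rank_Suc mem_merge_at\<close>)
qed

lemma lattice_path_merge_at:
  assumes "0 < k" "k \<le> n" "k \<in> D \<or> k - 1 \<in> D" "k \<in> E \<or> k - 1 \<in> E"
  shows "take k (lattice_path (Suc n) D E) @ drop (Suc k) (lattice_path (Suc n) D E)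
    = lattice_path n (merge_at k D) (merge_at k E)"
proof (rule nth_equalityI)
  fix i assume "i < length (take k (lattice_path (Suc n) D E) @ drop (Suc k) (lattice_path (Suc n) D E))"
  with assms(2) have "i \<le> n" by simp
  with assms show "(take k (lattice_path (Suc n) D E) @ drop (Suc k) (lattice_path (Suc n) D E)) ! i
      = lattice_path n (merge_at k D) (merge_at k E) ! i"
    by (auto simp: nth_append nth_lattice_path rank_merge_at)
qed (use assms in simp)

lemma source_at_not_target_at: "source_at n D E j \<Longrightarrow> \<not> target_at n D E k"
  unfolding source_at_def target_at_def by (cases j k rule: linorder_cases) auto

lemma source_at_unique: "source_at n D E j \<Longrightarrow> source_at n D E k \<Longrightarrow> j = k"
  unfolding source_at_def by (cases j k rule: linorder_cases) auto

lemma target_at_unique: "target_at n D E j \<Longrightarrow> target_at n D E k \<Longrightarrow> j = k"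
  unfolding target_at_def by (cases j k rule: linorder_cases) auto

lemma no_event_if_critical:
  assumes "\<And>k. \<not> source_at n D E k" "\<And>k. \<not> target_at n D E k"
  shows "\<not> event n D E k"
proof
  assume e: "event n D E k"
  let ?S = "{k. event n D E k}"
  have fin: "finite ?S" by (rule finite_subset[of _ "{..<n}"]) (auto simp: event_def)
  have "event n D E (Max ?S)" using Max_in[OF fin] e by blast
  moreover have "\<not> event n D E j" if "Max ?S < j" for j
    using Max_ge[OF fin, of j] that by auto
  ultimately show False
    using assms[of "Max ?S"] by (auto simp: source_at_def target_at_def)
qed

text \<open>Without diagonal steps every step is vertical or horizontal, and without bends the step
  before a horizontal one is horizontal. So the horizontal steps form an initial segment, and
  \<open>rank D n\<close> is their number.\<close>

lemma critical_steps:
  assumes D: "D \<subseteq> {..<n}" and E: "E \<subseteq> {..<n}" and disj: "D \<inter> E = {}"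
    and none: "\<And>k. \<not> event n D E k"
  shows "E = {..<rank D n}" "D = {rank D n..<n}"
proof -
  have union: "D \<union> E = {..<n}"
    using D E none unfolding event_def by blast
  have down: "k - 1 \<in> E" if "k \<in> E" "0 < k" for k
  proof -
    have "k - 1 < n" "k < n" using that E by auto
    then show ?thesis using none[of k] that union unfolding event_def by blast
  qed
  have down': "j \<in> E" if "i \<in> E" "j \<le> i" for i j
    using that(2,1) by (induction rule: inc_induct) (use down in force)+
  define m where "m = (LEAST m. m \<notin> E)"
  have "n \<notin> E" using E by auto
  then have m: "m \<notin> E" unfolding m_def by (rule LeastI)
  have "E = {..<m}"
  proof (intro equalityI subsetI)
    fix i assume "i \<in> E" then show "i \<in> {..<m}" using down' m by (metis lessThan_iff not_less)
  next
    fix i assume "i \<in> {..<m}" then show "i \<in> E" using not_less_Least unfolding m_def by blast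
  qed
  moreover have "rank D n = card E"
  proof -
    have "{..<n} - D = E" using union disj by blast
    then show ?thesis by (simp add: rank_def)
  qed
  ultimately show "E = {..<rank D n}" by simp
  moreover have "D = {..<n} - E" using union disj by blast
  moreover have "{..<n} - {..<r} = {r..<n}" for r :: nat by auto
  ultimately show "D = {rank D n..<n}" by metis
qed

section \<open>Removing a bend and restoring it\<close>

lemma target_atD:
  assumes "target_at n D E k" "D \<inter> E = {}"
  shows "0 < k" "k < n" "k - 1 \<in> D" "k \<in> E" "k \<notin> D" "k - 1 \<notin> E"
    and "\<And>j. k < j \<Longrightarrow> \<not> event n D E j"
  using assms by (auto simp: target_at_def event_def)

lemma merge_at_disjoint:
  assumes "D \<inter> E = {}"
  shows "merge_at k D \<inter> merge_at k E = {}"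
  using assms by (auto simp: mem_merge_at split: if_splits)

text \<open>Behind the removed point the path is only reindexed. For \<open>j = i\<close> the
  preceding step is the merged one; the second alternative keeps it from being vertical, so no new
  bend arises there.\<close>

lemma event_merge_at:
  assumes "event n (merge_at i D) (merge_at i E) j" "i < j \<or> i = j \<and> \<not> (i - 1 \<in> D \<and> i \<in> D)"
  shows "event (Suc n) D E (Suc j)"
  using assms by (auto simp: event_def mem_merge_at split: if_splits)

text \<open>The two steps around the bend become the diagonal step \<open>k - 1\<close>, and no
  event is created behind it.\<close>

lemma source_at_merge_at:
  assumes t: "target_at (Suc n) D E k" and disj: "D \<inter> E = {}"
  shows "source_at n (merge_at k D) (merge_at k E) (k - 1)"
proof -
  note k = target_atD[OF t disj]
  have "k - 1 \<notin> merge_at k D" "k - 1 \<notin> merge_at k E" using k by (auto simp: mem_merge_at)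
  moreover have "\<not> event n (merge_at k D) (merge_at k E) j" if "k - 1 < j" for j
  proof
    assume "event n (merge_at k D) (merge_at k E) j"
    then have "event (Suc n) D E (Suc j)" by (rule event_merge_at) (use that k in auto)
    with k(7) that show False by simp
  qed
  ultimately show ?thesis using k by (auto simp: source_at_def event_def)
qed

text \<open>Removing an earlier bend leaves the last one in place, with its index lowered by
  one.\<close>

lemma target_at_merge_at:
  assumes t: "target_at (Suc n) D E k" and disj: "D \<inter> E = {}"
    and i: "0 < i" "i < k" "i - 1 \<in> D" "i \<in> E"
  shows "target_at n (merge_at i D) (merge_at i E) (k - 1)"
proof -
  note k = target_atD[OF t disj]
  \<comment> \<open>The step \<open>k - 1\<close> is vertical and the step \<open>i\<close> is
    horizontal, so the two bends are not adjacent.\<close>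
  have "i \<noteq> k - 1" using k i disj by blast
  with i have i': "i < k - 1" by simp
  have "k - 2 \<in> merge_at i D" "k - 1 \<in> merge_at i E"
    using k i' by (auto simp: mem_merge_at numeral_2_eq_2 Suc_diff_Suc)
  moreover have "\<not> event n (merge_at i D) (merge_at i E) j" if "k - 1 < j" for j
  proof
    assume "event n (merge_at i D) (merge_at i E) j"
    then have "event (Suc n) D E (Suc j)" by (rule event_merge_at) (use that i' in auto)
    with k(7) that show False by simp
  qed
  ultimately show ?thesis
    using k(2) i' by (auto simp: target_at_def event_def numeral_2_eq_2)
qed

text \<open>The effect of the degeneracy \<open>k\<close> on a set of degeneracy indices.\<close>

definition insert_at :: "nat \<Rightarrow> nat set \<Rightarrow> nat set" where
  "insert_at k D = {i. if i < k then i \<in> D else i = k \<or> i - 1 \<in> D}"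

text \<open>The diagonal step \<open>k\<close> is split into a vertical step \<open>k\<close> and a
  horizontal step \<open>k + 1\<close>: the fibre component gets the new degeneracy
  \<open>k\<close>, the base component \<open>k + 1\<close>.\<close>

lemma target_at_insert_at:
  assumes s: "source_at n D E k" and disj: "D \<inter> E = {}"
  shows "target_at (Suc n) (insert_at k D) (insert_at (Suc k) E) (Suc k)"
    and "insert_at k D \<inter> insert_at (Suc k) E = {}"
proof -
  have k: "k < n" "k \<notin> D" "k \<notin> E" "\<And>j. k < j \<Longrightarrow> \<not> event n D E j"
    using s by (auto simp: source_at_def event_def)
  have "\<not> event (Suc n) (insert_at k D) (insert_at (Suc k) E) j" if "Suc k < j" for j
  proof
    assume e: "event (Suc n) (insert_at k D) (insert_at (Suc k) E) j"
    define i where "i = j - 2"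
    with that have "j = Suc (Suc i)" "k \<le> i" by auto
    with e have "event n D E (j - 1)" using k(2) by (auto simp: event_def insert_at_def split: if_splits)
    moreover have "k < j - 1" using that by simp
    ultimately show False using k(4) by blast
  qed
  then show "target_at (Suc n) (insert_at k D) (insert_at (Suc k) E) (Suc k)"
    using k by (auto simp: target_at_def event_def insert_at_def)
  show "insert_at k D \<inter> insert_at (Suc k) E = {}"
  proof (rule equals0I)
    fix i assume i: "i \<in> insert_at k D \<inter> insert_at (Suc k) E"
    consider "i < k" | "i = k" | "i = Suc k" | "Suc k < i" by linarith
    then show False by cases (use i k disj in \<open>auto simp: insert_at_def\<close>)
  qed
qed

text \<open>Twice the area below a path given by its list of steps, a step being a pair that tells whether
  it rises and whether it advances.\<close>

fun area :: "(bool \<times> bool) list \<Rightarrow> nat" where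
  "area [] = 0"
| "area ((v, h) # w) = (if v then (if h then 1 else 0) + 2 * length (filter snd w) else 0) + area w"

text \<open>A step in front of \<open>w\<close> contributes at most \<open>2 * length w + 1\<close>,
  the difference of two consecutive squares.\<close>

lemma area_le: "area w \<le> length w * length w"
proof (induction w rule: area.induct)
  case (2 v h w)
  have "length (filter snd w) \<le> length w" by simp
  moreover have "area w \<le> length w * length w" by (rule 2)
  ultimately show ?case by (cases v; cases h; simp; linarith)
qed simp

text \<open>Across a unit square, going up then right, diagonally, or right then up encloses the
  doubled areas 2, 1 and 0; the rest of the path sees the same total rise and advance.\<close>

lemma area_corner:
  "area (u @ [(True, False), (False, True)] @ w) = Suc (area (u @ [(True, True)] @ w))"
  "area (u @ [(True, True)] @ w) = Suc (area (u @ [(False, True), (True, False)] @ w))"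
  by (induction u rule: area.induct) auto

definition steps :: "nat \<Rightarrow> nat set \<Rightarrow> nat set \<Rightarrow> (bool \<times> bool) list" where
  "steps n D E = map (\<lambda>i. (i \<notin> E, i \<notin> D)) [0..<n]"

text \<open>Only the two letters around the removed point change: they become one letter, which
  rises or advances as soon as one of them does.\<close>

lemma steps_merge_at:
  assumes k: "0 < k" "k \<le> n"
  shows "\<exists>u w. steps (Suc n) D E = u @ [(k - 1 \<notin> E, k - 1 \<notin> D), (k \<notin> E, k \<notin> D)] @ w \<and>
    steps n (merge_at k D) (merge_at k E)
      = u @ [(\<not> (k - 1 \<in> E \<and> k \<in> E), \<not> (k - 1 \<in> D \<and> k \<in> D))] @ w"
proof -
  obtain j where j: "k = Suc j" using k by (cases k) auto
  let ?f = "\<lambda>i. (i \<notin> E, i \<notin> D)" and ?g = "\<lambda>i. (i \<notin> merge_at k E, i \<notin> merge_at k D)"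
  have "[0..<Suc n] = [0..<j] @ [j, k] @ [Suc k..<Suc n]"
    using k j upt_add_eq_append[of 0 j "Suc n - j"] by (simp add: upt_conv_Cons del: upt_Suc)
  then have 1: "steps (Suc n) D E = map ?f [0..<j] @ [?f j, ?f k] @ map ?f [Suc k..<Suc n]"
    unfolding steps_def by simp
  have "[0..<n] = [0..<j] @ [j] @ [k..<n]"
    using k j upt_add_eq_append[of 0 j "n - j"] by (simp add: upt_conv_Cons)
  then have 2: "steps n (merge_at k D) (merge_at k E) = map ?g [0..<j] @ [?g j] @ map ?g [k..<n]"
    unfolding steps_def by simp
  have 3: "map ?g [0..<j] = map ?f [0..<j]" by (auto simp: mem_merge_at j)
  have 4: "map ?g [k..<n] = map ?f [Suc k..<Suc n]"
    unfolding map_Suc_upt[symmetric] map_map by (auto simp: mem_merge_at j)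
  have 5: "?g j = (\<not> (k - 1 \<in> E \<and> k \<in> E), \<not> (k - 1 \<in> D \<and> k \<in> D))"
    by (auto simp: mem_merge_at j)
  have 6: "?f j = (k - 1 \<notin> E, k - 1 \<notin> D)" by (simp add: j)
  show ?thesis
    unfolding 1 2 3 4 5 6 by blast
qed

lemma area_merge_bend:
  assumes "0 < k" "k \<le> n" "k - 1 \<in> D" "k \<in> E" "D \<inter> E = {}"
  shows "area (steps (Suc n) D E) = Suc (area (steps n (merge_at k D) (merge_at k E)))"
proof -
  have "k \<notin> D" "k - 1 \<notin> E" using assms by auto
  with assms steps_merge_at[OF assms(1,2), of D E] show ?thesis
    by (auto simp: area_corner(1)[simplified])
qed

lemma area_merge_corner:
  assumes "0 < k" "k \<le> n" "k - 1 \<in> E" "k \<in> D" "D \<inter> E = {}"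
  shows "area (steps n (merge_at k D) (merge_at k E)) = Suc (area (steps (Suc n) D E))"
proof -
  have "k \<notin> E" "k - 1 \<notin> D" using assms by auto
  with assms steps_merge_at[OF assms(1,2), of D E] show ?thesis
    by (auto simp: area_corner(2)[simplified])
qed

text \<open>The lexicographic order on (height, width, - area), as a natural number.\<close>

definition path_measure :: "nat \<Rightarrow> nat set \<Rightarrow> nat set \<Rightarrow> nat" where
  "path_measure n D E =
    (rank E n * Suc n + rank D n) * Suc (n * n) + (n * n - area (steps n D E))"

lemma rank_le: "rank D i \<le> i"
  by (induction i) (auto simp: rank_Suc)

text \<open>The weights \<open>Suc n\<close> and \<open>Suc (n * n)\<close> exceed the largest
  values of the lower components, \<open>n\<close> for a rank and \<open>n * n\<close> for the area
  term, so a drop in a rank outweighs whatever happens below it.\<close>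

lemma path_measure_less:
  assumes "rank E' n < rank E n \<or> rank E' n = rank E n \<and> rank D' n < rank D n"
  shows "path_measure n D' E' < path_measure n D E"
proof -
  let ?a = "rank E' n * Suc n + rank D' n" and ?b = "rank E n * Suc n + rank D n"
  have "?a < ?b"
  proof (cases "rank E' n < rank E n")
    case True
    then have "Suc (rank E' n) * Suc n \<le> rank E n * Suc n" by (intro mult_le_mono1) simp
    then have "rank E' n * Suc n + Suc n \<le> rank E n * Suc n" by simp
    with rank_le[of D' n] show ?thesis by linarith
  qed (use assms in auto)
  then have "Suc ?a * Suc (n * n) \<le> ?b * Suc (n * n)" by (intro mult_le_mono1) simp
  then have "?a * Suc (n * n) + Suc (n * n) \<le> ?b * Suc (n * n)" by simp
  then show ?thesis unfolding path_measure_def by linarith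
qed

lemma path_measure_less_area:
  assumes "rank E' n = rank E n" "rank D' n = rank D n"
    "area (steps n D E) < area (steps n D' E')"
  shows "path_measure n D' E' < path_measure n D E"
proof -
  \<comment> \<open>The subtraction in the measure is truncated; bounding the larger area makes the
    comparison strict.\<close>
  have "area (steps n D' E') \<le> n * n" using area_le[of "steps n D' E'"] by (simp add: steps_def)
  with assms(3) have "n * n - area (steps n D' E') < n * n - area (steps n D E)" by simp
  then show ?thesis using assms(1,2) by (simp add: path_measure_def)
qed

section \<open>Twisted products\<close>

locale twisted_product_data =
  F: simplicial_set F + B: simplicial_set B + G: simplicial_group G +
  simplicial_action G F act + twisting_function B G \<tau>
  for F :: "'f sset" and B :: "'b sset" and G :: "'g sgroup" and act \<tau>
begin

abbreviation T where "T \<equiv> twisted_product F B act \<tau>"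

lemma act_closed: "g \<in> simplices G p \<Longrightarrow> x \<in> simplices F p \<Longrightarrow> act p g x \<in> simplices F p"
  using group_action.element_image[OF action] G.carrier_grp by blast

lemma act_one: "x \<in> simplices F p \<Longrightarrow> act p \<one>\<^bsub>grp G p\<^esub> x = x"
  using group_action.id_eq_one[OF action] by (metis restrict_apply')

lemma act_mult:
  "\<lbrakk>g \<in> simplices G p; h \<in> simplices G p; x \<in> simplices F p\<rbrakk> \<Longrightarrow>
    act p g (act p h x) = act p (g \<otimes>\<^bsub>grp G p\<^esub> h) x"
  using group_action.composition_rule[OF action] G.carrier_grp by simp

lemma simplices_T [simp]: "simplices T p = simplices F p \<times> simplices B p"
  by (simp add: twisted_product_def)

lemma face_T [simp]:
  "face T p i (f, b) = (if i = 0 then act (p - 1) (\<tau> p b) (face F p 0 f) else face F p i f, face B p i b)"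
  by (simp add: twisted_product_def)

lemma degen_T [simp]: "degen T p i (f, b) = (degen F p i f, degen B p i b)"
  by (simp add: twisted_product_def)

text \<open>The only simplicial identity with a twist in three places: the inverse in
  \<open>face_0_twist\<close> cancels the outer action of \<open>?t0\<close>, and \<open>?t1\<close>
  remains.\<close>

lemma twisted_face_0_face_0:
  assumes "f \<in> simplices F (Suc (Suc p))" "b \<in> simplices B (Suc (Suc p))"
  shows "act p (\<tau> (Suc p) (face B (Suc (Suc p)) 1 b)) (face F (Suc p) 0 (face F (Suc (Suc p)) 1 f))
    = act p (\<tau> (Suc p) (face B (Suc (Suc p)) 0 b))
        (face F (Suc p) 0 (act (Suc p) (\<tau> (Suc (Suc p)) b) (face F (Suc (Suc p)) 0 f)))"
proof -
  interpret grp: group "grp G p" by (rule G.group_grp)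
  let ?t0 = "\<tau> (Suc p) (face B (Suc (Suc p)) 0 b)" and ?t1 = "\<tau> (Suc p) (face B (Suc (Suc p)) 1 b)"
  let ?f = "face F (Suc p) 0 (face F (Suc (Suc p)) 0 f)"
  have t: "?t0 \<in> carrier (grp G p)" "?t1 \<in> carrier (grp G p)"
    using assms twist_closed B.face_closed G.carrier_grp by simp_all
  have f0: "face F (Suc (Suc p)) 0 f \<in> simplices F (Suc p)" using assms F.face_closed by simp
  have f: "?f \<in> simplices F p" using f0 F.face_closed by simp
  have "face F (Suc p) 0 (act (Suc p) (\<tau> (Suc (Suc p)) b) (face F (Suc (Suc p)) 0 f))
      = act p (inv\<^bsub>grp G p\<^esub> ?t0 \<otimes>\<^bsub>grp G p\<^esub> ?t1) ?f"
    using face_act[OF twist_closed[OF assms(2)] f0, of 0] face_0_twist[OF assms(2)] by simp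
  moreover have "act p ?t0 (act p (inv\<^bsub>grp G p\<^esub> ?t0 \<otimes>\<^bsub>grp G p\<^esub> ?t1) ?f) = act p ?t1 ?f"
  proof -
    have "inv\<^bsub>grp G p\<^esub> ?t0 \<otimes>\<^bsub>grp G p\<^esub> ?t1 \<in> carrier (grp G p)" using t by simp
    then have "act p ?t0 (act p (inv\<^bsub>grp G p\<^esub> ?t0 \<otimes>\<^bsub>grp G p\<^esub> ?t1) ?f)
        = act p (?t0 \<otimes>\<^bsub>grp G p\<^esub> (inv\<^bsub>grp G p\<^esub> ?t0 \<otimes>\<^bsub>grp G p\<^esub> ?t1)) ?f"
      using t f act_mult G.carrier_grp by simp
    then show ?thesis using t by (simp only: grp.m_assoc[symmetric] grp.inv_closed grp.r_inv grp.l_one)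
  qed
  moreover have "face F (Suc p) 0 (face F (Suc (Suc p)) 1 f) = ?f"
    using F.face_face[OF assms(1), of 0 1] by simp
  ultimately show ?thesis by simp
qed

lemma simplicial_set_T: "simplicial_set T"
proof
  fix x p i assume "x \<in> simplices T (Suc p)" "i \<le> Suc p"
  then show "face T (Suc p) i x \<in> simplices T p"
    by (auto intro!: act_closed twist_closed F.face_closed B.face_closed)
next
  fix x p i assume "x \<in> simplices T p" "i \<le> p"
  then show "degen T p i x \<in> simplices T (Suc p)"
    by (auto intro!: F.degen_closed B.degen_closed)
next
  fix x p i and j :: nat
  assume x: "x \<in> simplices T (Suc (Suc p))" and ij: "i < j" "j \<le> Suc (Suc p)"
  obtain f b where fb: "x = (f, b)" "f \<in> simplices F (Suc (Suc p))" "b \<in> simplices B (Suc (Suc p))"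
    using x by auto
  \<comment> \<open>For \<open>j > 1\<close> the face \<open>j - 1\<close> passes through the action
    and becomes the face \<open>j\<close> inside the twisting function.\<close>
  have *: "face F (Suc p) (j - 1) (act (Suc p) (\<tau> (Suc (Suc p)) b) (face F (Suc (Suc p)) 0 f))
      = act p (\<tau> (Suc p) (face B (Suc (Suc p)) j b)) (face F (Suc p) 0 (face F (Suc (Suc p)) j f))"
    if "1 < j"
  proof -
    have "face F (Suc p) (j - 1) (act (Suc p) (\<tau> (Suc (Suc p)) b) (face F (Suc (Suc p)) 0 f))
        = act p (face G (Suc p) (j - 1) (\<tau> (Suc (Suc p)) b)) (face F (Suc p) (j - 1) (face F (Suc (Suc p)) 0 f))"
      using fb ij by (intro face_act twist_closed F.face_closed) auto
    also have "face G (Suc p) (j - 1) (\<tau> (Suc (Suc p)) b) = \<tau> (Suc p) (face B (Suc (Suc p)) j b)"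
      using face_twist[OF fb(3), of "j - 1"] that ij by simp
    also have "face F (Suc p) (j - 1) (face F (Suc (Suc p)) 0 f) = face F (Suc p) 0 (face F (Suc (Suc p)) j f)"
      using F.face_face[OF fb(2), of 0 j] that ij by simp
    finally show ?thesis .
  qed
  consider "0 < i" | "i = 0" "1 < j" | "i = 0" "j = 1" using ij by linarith
  then show "face T (Suc p) i (face T (Suc (Suc p)) j x) = face T (Suc p) (j - 1) (face T (Suc (Suc p)) i x)"
  proof cases
    case 1
    then show ?thesis
      using fb ij F.face_face[OF fb(2) ij] B.face_face[OF fb(3) ij] by simp
  next
    case 2
    then show ?thesis using fb ij * B.face_face[OF fb(3) ij] by simp
  next
    case 3
    then show ?thesis
      using fb ij twisted_face_0_face_0[OF fb(2,3)] B.face_face[OF fb(3) ij] by simp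
  qed
next
  fix x p i j assume "x \<in> simplices T p" "i \<le> j" "j \<le> p"
  then show "degen T (Suc p) i (degen T p j x) = degen T (Suc p) (Suc j) (degen T p i x)"
    by (auto simp: F.degen_degen B.degen_degen)
next
  fix x p i j assume x: "x \<in> simplices T p" and ij: "i < (j::nat)" "j \<le> p"
  obtain f b where fb: "x = (f, b)" "f \<in> simplices F p" "b \<in> simplices B p"
    using x by auto
  obtain m where p: "p = Suc m" using ij by (cases p) auto
  \<comment> \<open>Since \<open>j > 0\<close>, the twisting function turns the degeneracy
    \<open>j\<close> of the base into the degeneracy \<open>j - 1\<close> of the group element,
    which can be pulled out of the action.\<close>
  have "act p (\<tau> (Suc p) (degen B p j b)) (degen F m (j - 1) (face F p 0 f))
      = degen F m (j - 1) (act m (\<tau> p b) (face F p 0 f))" if "i = 0"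
  proof -
    have "\<tau> (Suc p) (degen B p j b) = degen G m (j - 1) (\<tau> p b)"
      using degen_twist[of b m "j - 1"] fb ij p that by simp
    then show ?thesis
      using degen_act[of "\<tau> p b" m "face F p 0 f" "j - 1"] twist_closed[of b m] F.face_closed[of f m 0]
        fb p ij by simp
  qed
  then show "face T (Suc p) i (degen T p j x) = degen T (p - 1) (j - 1) (face T p i x)"
    using fb p ij F.face_degen_less[OF fb(2) ij] B.face_degen_less[OF fb(3) ij] by auto
next
  fix x p j assume "x \<in> simplices T p" "j \<le> p"
  then show "face T (Suc p) j (degen T p j x) = x"
    by (auto simp: F.face_degen_same B.face_degen_same twist_degen_0 act_one)
next
  fix x p j assume "x \<in> simplices T p" "j \<le> p"
  then show "face T (Suc p) (Suc j) (degen T p j x) = x"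
    by (auto simp: F.face_degen_Suc B.face_degen_Suc)
next
  fix x p i and j :: nat assume "x \<in> simplices T p" "Suc j < i" "i \<le> Suc p"
  then show "face T (Suc p) i (degen T p j x) = degen T (p - 1) j (face T p (i - 1) x)"
    by (auto simp: F.face_degen_greater B.face_degen_greater)
qed

text \<open>Only the face 0 is twisted, and on a base component that is a degeneracy of index 0 the
  twisting function takes the neutral element.\<close>

lemma face_T_untwisted:
  assumes "x \<in> simplices F (Suc n)" "y \<in> simplices B (Suc n)"
    and "0 < i \<or> 0 \<in> degen_set B (Suc n) y"
  shows "face T (Suc n) i (x, y) = (face F (Suc n) i x, face B (Suc n) i y)"
proof (cases "i = 0")
  case True
  with assms(3) obtain y' where "y' \<in> simplices B n" "y = degen B n 0 y'"
    by (auto elim: degen_setE)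
  then have "\<tau> (Suc n) y = \<one>\<^bsub>grp G n\<^esub>" by (simp add: twist_degen_0)
  with True assms(1) F.face_closed show ?thesis by (simp add: act_one)
qed simp

end

section \<open>The Eilenberg-Zilber vector field\<close>

locale simplicial_pair = F: simplicial_set F + B: simplicial_set B
  for F :: "'f sset" and B :: "'b sset"
begin

abbreviation vert where "vert n \<rho> \<equiv> degen_set F n (fst \<rho>)"
abbreviation horiz where "horiz n \<rho> \<equiv> degen_set B n (snd \<rho>)"

definition prod_face :: "nat \<Rightarrow> nat \<Rightarrow> 'f \<times> 'b \<Rightarrow> 'f \<times> 'b" where
  "prod_face n k \<rho> = (face F n k (fst \<rho>), face B n k (snd \<rho>))"

definition prod_cells :: "nat \<Rightarrow> ('f \<times> 'b) set" where
  "prod_cells n = {\<rho>. fst \<rho> \<in> simplices F n \<and> snd \<rho> \<in> simplices B n \<and> vert n \<rho> \<inter> horiz n \<rho> = {}}"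

text \<open>A degeneracy of the product applies one index to both components, so a degenerate pair
  has an index common to its two sets.\<close>

lemma nondegenerate_product: "nondegenerate (product_sset F B) n = prod_cells n"
proof -
  have "degen_set (product_sset F B) n \<rho> = vert n \<rho> \<inter> horiz n \<rho>" for \<rho>
  proof (intro equalityI subsetI)
    fix i assume "i \<in> degen_set (product_sset F B) n \<rho>"
    then show "i \<in> vert n \<rho> \<inter> horiz n \<rho>" by (auto simp: degen_set_def product_sset_def)
  next
    fix i assume i: "i \<in> vert n \<rho> \<inter> horiz n \<rho>"
    then obtain m x where x: "n = Suc m" "i \<le> m" "x \<in> simplices F m" "fst \<rho> = degen F m i x"
      by (auto simp: degen_set_def)
    from i x(1) obtain y where y: "y \<in> simplices B m" "snd \<rho> = degen B m i y"
      by (auto simp: degen_set_def)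
    have "(x, y) \<in> simplices (product_sset F B) m" "\<rho> = degen (product_sset F B) m i (x, y)"
      using x y by (simp_all add: product_sset_def prod_eq_iff)
    with degen_setI[OF x(2), of "(x, y)" "product_sset F B"] x(1)
    show "i \<in> degen_set (product_sset F B) n \<rho>" by simp
  qed
  then have "\<rho> \<in> nondegenerate (product_sset F B) n \<longleftrightarrow>
      \<rho> \<in> simplices (product_sset F B) n \<and> vert n \<rho> \<inter> horiz n \<rho> = {}" for \<rho>
    by (simp only: nondegenerate_iff)
  moreover have "\<rho> \<in> simplices (product_sset F B) n \<longleftrightarrow>
      fst \<rho> \<in> simplices F n \<and> snd \<rho> \<in> simplices B n" for \<rho>
    by (simp add: product_sset_def mem_Times_iff)
  ultimately show ?thesis by (simp add: set_eq_iff prod_cells_def)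
qed

lemma vert_bound: "vert n \<rho> \<subseteq> {..<n}" and horiz_bound: "horiz n \<rho> \<subseteq> {..<n}"
  by (auto dest: degen_set_bound)

text \<open>This eliminates the surjections: each is the \<open>rank\<close> of the corresponding
  index set, so the simplex itself determines its cores and its path.\<close>

lemma EZ_path_iff:
  "EZ_path F B n \<rho> p \<phi> q b \<pi> \<longleftrightarrow> \<rho> \<in> prod_cells n \<and> core_of F p \<phi> n (fst \<rho>) \<and> core_of B q b n (snd \<rho>) \<and>
    \<pi> = lattice_path n (vert n \<rho>) (horiz n \<rho>)" (is "?L \<longleftrightarrow> ?R")
proof
  assume ?L
  then obtain \<alpha> \<beta> where \<rho>: "\<rho> \<in> prod_cells n" and nd: "\<phi> \<in> nondegenerate F p" "b \<in> nondegenerate B q"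
    and \<alpha>: "mono_surj n p \<alpha>" and \<beta>: "mono_surj n q \<beta>"
    and eq: "\<rho> = (surj_pullback F n p \<alpha> \<phi>, surj_pullback B n q \<beta> b)"
    and \<pi>: "\<pi> = map (\<lambda>i. (\<alpha> i, \<beta> i)) [0..<Suc n]"
    by (auto simp: EZ_path_def nondegenerate_product)
  have x: "core_of F p \<phi> n (fst \<rho>)" "vert n \<rho> = {i. i < n \<and> \<alpha> i = \<alpha> (Suc i)}"
    using F.surj_pullback_core[OF nd(1) \<alpha>] eq by auto
  have y: "core_of B q b n (snd \<rho>)" "horiz n \<rho> = {i. i < n \<and> \<beta> i = \<beta> (Suc i)}"
    using B.surj_pullback_core[OF nd(2) \<beta>] eq by auto
  have "\<pi> = lattice_path n (vert n \<rho>) (horiz n \<rho>)"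
    unfolding \<pi> lattice_path_def
    by (intro map_cong) (auto simp: x y mono_surj_eq_rank[OF \<alpha>, symmetric] mono_surj_eq_rank[OF \<beta>, symmetric]
        less_Suc_eq_le simp del: upt_Suc)
  with \<rho> x y show ?R by simp
next
  assume R: ?R
  let ?\<alpha> = "rank (vert n \<rho>)" and ?\<beta> = "rank (horiz n \<rho>)"
  have nd: "\<phi> \<in> nondegenerate F p" "b \<in> nondegenerate B q"
    using R by (auto intro: core_of_nondegenerate)
  have \<alpha>: "mono_surj n p ?\<alpha>" using mono_surj_rank[of n "vert n \<rho>"] F.core_of_rank R by metis
  have \<beta>: "mono_surj n q ?\<beta>" using mono_surj_rank[of n "horiz n \<rho>"] B.core_of_rank R by metis
  have "vert n \<rho> = {i. i < n \<and> ?\<alpha> i = ?\<alpha> (Suc i)}" "horiz n \<rho> = {i. i < n \<and> ?\<beta> i = ?\<beta> (Suc i)}"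
    using vert_bound[of n \<rho>] horiz_bound[of n \<rho>] by (auto simp: rank_Suc)
  then have "fst \<rho> = surj_pullback F n p ?\<alpha> \<phi>" "snd \<rho> = surj_pullback B n q ?\<beta> b"
    using F.surj_pullback_eq_iff[OF nd(1) \<alpha>] B.surj_pullback_eq_iff[OF nd(2) \<beta>] R by blast+
  then have "\<rho> = (surj_pullback F n p ?\<alpha> \<phi>, surj_pullback B n q ?\<beta> b)" by (simp add: prod_eq_iff)
  with R nd \<alpha> \<beta> show ?L
    unfolding EZ_path_def nondegenerate_product lattice_path_def by blast
qed

text \<open>A vertical step before the bend and a horizontal one after it mean that the face undoes
  one degeneracy in each component. This is why both cores are kept and \<open>merge_at\<close> is
  exact.\<close>

lemma prod_face_bend:
  assumes \<rho>: "\<rho> \<in> prod_cells (Suc n)" and t: "target_at (Suc n) (vert (Suc n) \<rho>) (horiz (Suc n) \<rho>) k"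
  shows "vert n (prod_face (Suc n) k \<rho>) = merge_at k (vert (Suc n) \<rho>)"
    and "horiz n (prod_face (Suc n) k \<rho>) = merge_at k (horiz (Suc n) \<rho>)"
    and "core_of F p \<phi> n (fst (prod_face (Suc n) k \<rho>)) \<longleftrightarrow> core_of F p \<phi> (Suc n) (fst \<rho>)"
    and "core_of B p b n (snd (prod_face (Suc n) k \<rho>)) \<longleftrightarrow> core_of B p b (Suc n) (snd \<rho>)"
    and "prod_face (Suc n) k \<rho> \<in> prod_cells n"
    and "source_at n (vert n (prod_face (Suc n) k \<rho>)) (horiz n (prod_face (Suc n) k \<rho>)) (k - 1)"
proof -
  let ?D = "vert (Suc n) \<rho>" and ?E = "horiz (Suc n) \<rho>"
  have disj: "?D \<inter> ?E = {}" and xy: "fst \<rho> \<in> simplices F (Suc n)" "snd \<rho> \<in> simplices B (Suc n)"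
    using \<rho> by (auto simp: prod_cells_def)
  note k = target_atD[OF t disj]
  have F: "k \<in> ?D \<or> 0 < k \<and> k - 1 \<in> ?D" and B: "k \<in> ?E \<or> 0 < k \<and> k - 1 \<in> ?E" using k by auto
  note F' = F.face_of_degenerate[OF xy(1) F] and B' = B.face_of_degenerate[OF xy(2) B]
  show 1: "vert n (prod_face (Suc n) k \<rho>) = merge_at k ?D"
    and 2: "horiz n (prod_face (Suc n) k \<rho>) = merge_at k ?E"
    and "core_of F p \<phi> n (fst (prod_face (Suc n) k \<rho>)) \<longleftrightarrow> core_of F p \<phi> (Suc n) (fst \<rho>)"
    and "core_of B p b n (snd (prod_face (Suc n) k \<rho>)) \<longleftrightarrow> core_of B p b (Suc n) (snd \<rho>)"
    using F' B' by (simp_all add: prod_face_def)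
  show "prod_face (Suc n) k \<rho> \<in> prod_cells n"
    using 1 2 merge_at_disjoint[OF disj, of k] xy k(2) F.face_closed B.face_closed
    by (simp add: prod_cells_def) (simp add: prod_face_def)
  show "source_at n (vert n (prod_face (Suc n) k \<rho>)) (horiz n (prod_face (Suc n) k \<rho>)) (k - 1)"
    unfolding 1 2 by (rule source_at_merge_at[OF t disj])
qed

text \<open>The condition on paths becomes an equation of simplices: removing the bend is the effect
  of the face \<open>k\<close>, and a simplex with given cores is determined by its path.\<close>

lemma EZ_field_iff:
  "(\<rho>1, \<rho>2) \<in> EZ_field F B n \<longleftrightarrow> \<rho>2 \<in> prod_cells (Suc n) \<and>
    (\<exists>k. target_at (Suc n) (vert (Suc n) \<rho>2) (horiz (Suc n) \<rho>2) k \<and> \<rho>1 = prod_face (Suc n) k \<rho>2)"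
  (is "?L \<longleftrightarrow> ?R")
proof
  let ?D = "vert (Suc n) \<rho>2" and ?E = "horiz (Suc n) \<rho>2"
  assume ?L
  then obtain p \<phi> q b k where 1: "EZ_path F B n \<rho>1 p \<phi> q b (lattice_path n (vert n \<rho>1) (horiz n \<rho>1))"
    and 2: "EZ_path F B (Suc n) \<rho>2 p \<phi> q b (lattice_path (Suc n) ?D ?E)"
    and k: "first_event (lattice_path (Suc n) ?D ?E) k \<and> bend (lattice_path (Suc n) ?D ?E) k"
    and eq: "lattice_path n (vert n \<rho>1) (horiz n \<rho>1) =
      take k (lattice_path (Suc n) ?D ?E) @ drop (Suc k) (lattice_path (Suc n) ?D ?E)"
    by (auto simp: EZ_field_def EZ_path_iff)
  have \<rho>2: "\<rho>2 \<in> prod_cells (Suc n)" using 2 by (simp add: EZ_path_iff)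
  then have disj: "?D \<inter> ?E = {}" by (simp add: prod_cells_def)
  have t: "target_at (Suc n) ?D ?E k" using k first_event_lattice_path(2)[OF disj] by blast
  note k = target_atD[OF t disj] and f = prod_face_bend[OF \<rho>2 t]
  have "lattice_path n (vert n \<rho>1) (horiz n \<rho>1) = lattice_path n (merge_at k ?D) (merge_at k ?E)"
    using eq lattice_path_merge_at[of k n ?D ?E] k by simp
  then have "vert n \<rho>1 = merge_at k ?D \<and> horiz n \<rho>1 = merge_at k ?E"
    using lattice_path_inject[OF _ vert_bound horiz_bound vert_bound horiz_bound] f(1,2) by metis
  then have "fst \<rho>1 = fst (prod_face (Suc n) k \<rho>2)" "snd \<rho>1 = snd (prod_face (Suc n) k \<rho>2)"
    using 1 2 f(1-4) F.core_of_degen_set_determine[of p \<phi> n "fst \<rho>1"]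
      B.core_of_degen_set_determine[of q b n "snd \<rho>1"] by (auto simp: EZ_path_iff)
  with \<rho>2 t show ?R by (auto simp: prod_eq_iff)
next
  let ?D = "vert (Suc n) \<rho>2" and ?E = "horiz (Suc n) \<rho>2"
  let ?\<pi>1 = "lattice_path n (vert n \<rho>1) (horiz n \<rho>1)" and ?\<pi>2 = "lattice_path (Suc n) ?D ?E"
  assume ?R
  then obtain k where \<rho>2: "\<rho>2 \<in> prod_cells (Suc n)" and t: "target_at (Suc n) ?D ?E k"
    and \<rho>1: "\<rho>1 = prod_face (Suc n) k \<rho>2" by blast
  then have disj: "?D \<inter> ?E = {}" by (simp add: prod_cells_def)
  note k = target_atD[OF t disj] and f = prod_face_bend[OF \<rho>2 t, folded \<rho>1]
  obtain p \<phi> q b where core: "core_of F p \<phi> (Suc n) (fst \<rho>2)" "core_of B q b (Suc n) (snd \<rho>2)"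
    using F.ex_core_of B.ex_core_of \<rho>2 unfolding prod_cells_def by blast
  have "EZ_path F B n \<rho>1 p \<phi> q b ?\<pi>1" "EZ_path F B (Suc n) \<rho>2 p \<phi> q b ?\<pi>2"
    using core \<rho>2 f(3-5) by (simp_all add: EZ_path_iff)
  moreover have "vert n \<rho>1 \<inter> horiz n \<rho>1 = {}" using f(5) by (simp add: prod_cells_def)
  then have "first_event ?\<pi>1 (k - 1) \<and> diag_step ?\<pi>1 (k - 1)"
    using first_event_lattice_path(1) f(6) by blast
  moreover have "first_event ?\<pi>2 k \<and> bend ?\<pi>2 k" using first_event_lattice_path(2)[OF disj] t by blast
  moreover have "?\<pi>1 = take k ?\<pi>2 @ drop (Suc k) ?\<pi>2"
    using lattice_path_merge_at[of k n ?D ?E] k f(1,2) by simp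
  ultimately show ?L unfolding EZ_field_def by blast
qed

section \<open>Source, target and critical cells\<close>

lemma source_cells_EZ:
  "source_cells (EZ_field F B) n = {\<rho> \<in> prod_cells n. \<exists>k. source_at n (vert n \<rho>) (horiz n \<rho>) k}"
proof (intro equalityI subsetI)
  fix \<rho> assume "\<rho> \<in> source_cells (EZ_field F B) n"
  then obtain \<rho>2 k where "\<rho>2 \<in> prod_cells (Suc n)" "\<rho> = prod_face (Suc n) k \<rho>2"
    "target_at (Suc n) (vert (Suc n) \<rho>2) (horiz (Suc n) \<rho>2) k"
    by (auto simp: source_cells_def EZ_field_iff)
  with prod_face_bend(5,6)[of \<rho>2 n k] show "\<rho> \<in> {\<rho> \<in> prod_cells n. \<exists>k. source_at n (vert n \<rho>) (horiz n \<rho>) k}"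
    by blast
next
  fix \<rho> assume "\<rho> \<in> {\<rho> \<in> prod_cells n. \<exists>k. source_at n (vert n \<rho>) (horiz n \<rho>) k}"
  then obtain k where \<rho>: "\<rho> \<in> prod_cells n" and s: "source_at n (vert n \<rho>) (horiz n \<rho>) k" by auto
  then have disj: "vert n \<rho> \<inter> horiz n \<rho> = {}"
    and xy: "fst \<rho> \<in> simplices F n" "snd \<rho> \<in> simplices B n" by (auto simp: prod_cells_def)
  have k: "k \<le> n" "Suc k \<le> n" using s by (auto simp: source_at_def event_def)
  \<comment> \<open>The target is obtained from its source by degenerating the fibre component at
    the diagonal step and the base component at the next index.\<close>
  let ?\<rho>2 = "(degen F n k (fst \<rho>), degen B n (Suc k) (snd \<rho>))"
  have D: "vert (Suc n) ?\<rho>2 = insert_at k (vert n \<rho>)" "horiz (Suc n) ?\<rho>2 = insert_at (Suc k) (horiz n \<rho>)"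
    using F.degen_set_degen[OF xy(1) k(1)] B.degen_set_degen[OF xy(2) k(2)] by (simp_all add: insert_at_def)
  have "?\<rho>2 \<in> prod_cells (Suc n)"
    using target_at_insert_at(2)[OF s disj] D xy k F.degen_closed B.degen_closed
    by (simp add: prod_cells_def)
  moreover have "target_at (Suc n) (vert (Suc n) ?\<rho>2) (horiz (Suc n) ?\<rho>2) (Suc k)"
    unfolding D by (rule target_at_insert_at(1)[OF s disj])
  moreover have "\<rho> = prod_face (Suc n) (Suc k) ?\<rho>2"
    using F.face_degen_Suc[OF xy(1) k(1)] B.face_degen_same[OF xy(2) k(2)]
    by (simp add: prod_face_def prod_eq_iff)
  ultimately have "(\<rho>, ?\<rho>2) \<in> EZ_field F B n" unfolding EZ_field_iff by blast
  then show "\<rho> \<in> source_cells (EZ_field F B) n" by (force simp: source_cells_def)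
qed

lemma target_cells_EZ:
  "target_cells (EZ_field F B) n = {\<rho> \<in> prod_cells n. \<exists>k. target_at n (vert n \<rho>) (horiz n \<rho>) k}"
proof (cases n)
  case 0
  then show ?thesis by (auto simp: target_cells_def target_at_def event_def)
next
  case (Suc m)
  have "\<rho> \<in> target_cells (EZ_field F B) n \<longleftrightarrow> (\<exists>\<sigma>. (\<sigma>, \<rho>) \<in> EZ_field F B m)" for \<rho>
    by (force simp: target_cells_def Suc)
  then show ?thesis unfolding EZ_field_iff Suc by blast
qed

text \<open>The target is recovered from its source: the bend replaces the last diagonal step.\<close>

lemma EZ_field_functional:
  assumes "(\<rho>, \<rho>2) \<in> EZ_field F B n" "(\<rho>, \<rho>3) \<in> EZ_field F B n"
  shows "\<rho>2 = \<rho>3"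
proof -
  have *: "\<exists>k. source_at n (vert n \<rho>) (horiz n \<rho>) k \<and>
      \<sigma> = (degen F n k (fst \<rho>), degen B n (Suc k) (snd \<rho>))" if pair: "(\<rho>, \<sigma>) \<in> EZ_field F B n" for \<sigma>
  proof -
    obtain k where \<sigma>: "\<sigma> \<in> prod_cells (Suc n)" and t: "target_at (Suc n) (vert (Suc n) \<sigma>) (horiz (Suc n) \<sigma>) k"
      and \<rho>: "\<rho> = prod_face (Suc n) k \<sigma>" using pair unfolding EZ_field_iff by blast
    have disj: "vert (Suc n) \<sigma> \<inter> horiz (Suc n) \<sigma> = {}" using \<sigma> by (simp add: prod_cells_def)
    note k = target_atD[OF t disj]
    obtain x where x: "k - 1 \<le> n" "x \<in> simplices F n" "fst \<sigma> = degen F n (k - 1) x"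
      using k(3) by (rule degen_setE)
    obtain y where y: "k \<le> n" "y \<in> simplices B n" "snd \<sigma> = degen B n k y"
      using k(4) by (rule degen_setE)
    have "x = fst \<rho>" using F.face_degen_Suc[OF x(2,1)] x(3) k(1) by (simp add: \<rho> prod_face_def)
    moreover have "y = snd \<rho>" using B.face_degen_same[OF y(2,1)] y(3) by (simp add: \<rho> prod_face_def)
    ultimately have "\<sigma> = (degen F n (k - 1) (fst \<rho>), degen B n (Suc (k - 1)) (snd \<rho>))"
      using x y k(1) by (simp add: prod_eq_iff)
    moreover have "source_at n (vert n \<rho>) (horiz n \<rho>) (k - 1)"
      using prod_face_bend(6)[OF \<sigma> t] \<rho> by simp
    ultimately show ?thesis by blast
  qed
  from *[OF assms(1)] *[OF assms(2)] source_at_unique show ?thesis by metis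
qed

text \<open>The two equivalences serve to recognise a simplex without events as a critical
  one.\<close>

lemma critical_simplex_core:
  assumes "\<phi> \<in> nondegenerate F p" "b \<in> nondegenerate B q"
  defines "\<rho> \<equiv> critical_simplex F B ((p, \<phi>), (q, b))"
  shows "core_of F p \<phi> (p + q) (fst \<rho>)" "core_of B q b (p + q) (snd \<rho>)"
    "vert (p + q) \<rho> = {p..<p + q}" "horiz (p + q) \<rho> = {..<p}"
    "x = fst \<rho> \<longleftrightarrow> core_of F p \<phi> (p + q) x \<and> degen_set F (p + q) x = {p..<p + q}"
    "y = snd \<rho> \<longleftrightarrow> core_of B q b (p + q) y \<and> degen_set B (p + q) y = {..<p}"
proof -
  have "(\<lambda>i. min i p) ` {..p + q} = {..p}"
  proof (intro equalityI subsetI)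
    fix i assume "i \<in> {..p}"
    then show "i \<in> (\<lambda>i. min i p) ` {..p + q}" by (intro image_eqI[of _ _ i]) auto
  qed auto
  then have \<alpha>: "mono_surj (p + q) p (\<lambda>i. min i p)" by (auto simp: mono_surj_def mono_on_def)
  have "(\<lambda>i. i - p) ` {..p + q} = {..q}"
  proof (intro equalityI subsetI)
    fix i assume "i \<in> {..q}"
    then show "i \<in> (\<lambda>i. i - p) ` {..p + q}" by (intro image_eqI[of _ _ "i + p"]) auto
  qed auto
  then have \<beta>: "mono_surj (p + q) q (\<lambda>i. i - p)" by (auto simp: mono_surj_def mono_on_def)
  have 1: "{i. i < p + q \<and> min i p = min (Suc i) p} = {p..<p + q}" by auto
  have 2: "{i. i < p + q \<and> i - p = Suc i - p} = {..<p}" by auto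
  show "core_of F p \<phi> (p + q) (fst \<rho>)" "core_of B q b (p + q) (snd \<rho>)"
    "vert (p + q) \<rho> = {p..<p + q}" "horiz (p + q) \<rho> = {..<p}"
    using F.surj_pullback_core[OF assms(1) \<alpha>] B.surj_pullback_core[OF assms(2) \<beta>] 1 2
    by (simp_all add: \<rho>_def)
  show "x = fst \<rho> \<longleftrightarrow> core_of F p \<phi> (p + q) x \<and> degen_set F (p + q) x = {p..<p + q}"
    "y = snd \<rho> \<longleftrightarrow> core_of B q b (p + q) y \<and> degen_set B (p + q) y = {..<p}"
    using F.surj_pullback_eq_iff[OF assms(1) \<alpha>, of x] B.surj_pullback_eq_iff[OF assms(2) \<beta>, of y] 1 2
    by (simp_all add: \<rho>_def)
qed

text \<open>Injectivity is the uniqueness of cores. For surjectivity, a path without events is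
  horizontal and then vertical, so its index sets are those of the critical simplex with the same
  cores.\<close>

lemma bij_critical_simplex:
  "bij_betw (critical_simplex F B) (cells (tensor_cpx (normalized_chains F) (normalized_chains B)) n)
    (prod_cells n - (source_cells (EZ_field F B) n \<union> target_cells (EZ_field F B) n))"
  (is "bij_betw ?c ?A ?K")
proof -
  have A: "?A = {((p, \<phi>), (q, b)) | p \<phi> q b. p + q = n \<and> \<phi> \<in> nondegenerate F p \<and> b \<in> nondegenerate B q}"
    by (simp add: tensor_cpx_def)
  have K: "?K = {\<rho> \<in> prod_cells n. \<forall>k. \<not> event n (vert n \<rho>) (horiz n \<rho>) k}"
  proof -
    have "(\<exists>k. source_at n D E k) \<or> (\<exists>k. target_at n D E k) \<longleftrightarrow> (\<exists>k. event n D E k)" for D E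
      using no_event_if_critical[of n D E] unfolding source_at_def target_at_def by blast
    then have "source_cells (EZ_field F B) n \<union> target_cells (EZ_field F B) n =
        {\<rho> \<in> prod_cells n. \<exists>k. event n (vert n \<rho>) (horiz n \<rho>) k}"
      unfolding source_cells_EZ target_cells_EZ by blast
    then show ?thesis by blast
  qed
  show ?thesis
  proof (rule bij_betw_imageI)
    show "inj_on ?c ?A"
    proof (rule inj_onI)
      fix u v assume "u \<in> ?A" "v \<in> ?A" and eq: "?c u = ?c v"
      then obtain p \<phi> q b p' \<phi>' q' b' where u: "u = ((p, \<phi>), (q, b))" "p + q = n"
          "\<phi> \<in> nondegenerate F p" "b \<in> nondegenerate B q"
        and v: "v = ((p', \<phi>'), (q', b'))" "p' + q' = n" "\<phi>' \<in> nondegenerate F p'" "b' \<in> nondegenerate B q'"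
        unfolding A by blast
      note cu = critical_simplex_core[OF u(3,4), unfolded u(2), folded u(1)]
      note cv = critical_simplex_core[OF v(3,4), unfolded v(2), folded v(1), folded eq]
      from F.core_of_unique[OF cu(1) cv(1)] B.core_of_unique[OF cu(2) cv(2)] show "u = v"
        by (simp add: u(1) v(1))
    qed
    show "?c ` ?A = ?K"
    proof (intro equalityI subsetI)
      fix \<rho> assume "\<rho> \<in> ?c ` ?A"
      then obtain p \<phi> q b where \<rho>: "\<rho> = ?c ((p, \<phi>), (q, b))" "p + q = n"
        "\<phi> \<in> nondegenerate F p" "b \<in> nondegenerate B q"
        unfolding A by blast
      note c = critical_simplex_core[OF \<rho>(3,4), unfolded \<rho>(2), folded \<rho>(1)]
      have "\<rho> \<in> prod_cells n"
        using c(3,4) F.core_of_closed[OF c(1)] B.core_of_closed[OF c(2)] by (auto simp: prod_cells_def)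
      moreover have "\<not> event n (vert n \<rho>) (horiz n \<rho>) k" for k
        using c(3,4) \<rho>(2) by (auto simp: event_def)
      ultimately show "\<rho> \<in> ?K" unfolding K by blast
    next
      fix \<rho> assume "\<rho> \<in> ?K"
      then have \<rho>: "\<rho> \<in> prod_cells n" "\<And>k. \<not> event n (vert n \<rho>) (horiz n \<rho>) k" unfolding K by blast+
      then have xy: "fst \<rho> \<in> simplices F n" "snd \<rho> \<in> simplices B n" and disj: "vert n \<rho> \<inter> horiz n \<rho> = {}"
        by (auto simp: prod_cells_def)
      obtain p \<phi> q b where core: "core_of F p \<phi> n (fst \<rho>)" "core_of B q b n (snd \<rho>)"
        using F.ex_core_of[OF xy(1)] B.ex_core_of[OF xy(2)] by blast
      have p: "rank (vert n \<rho>) n = p" by (rule F.core_of_rank[OF core(1)])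
      note s = critical_steps[OF vert_bound horiz_bound disj \<rho>(2), unfolded p]
      have "q + p = n" using B.core_of_dim[OF core(2)] s(1) by simp
      then have n: "p + q = n" by simp
      note nd = core_of_nondegenerate[OF core(1)] core_of_nondegenerate[OF core(2)]
      have "\<rho> = ?c ((p, \<phi>), (q, b))"
        using critical_simplex_core(5,6)[OF nd] core s n by (simp add: prod_eq_iff del: critical_simplex.simps)
      with n nd show "\<rho> \<in> ?c ` ?A" unfolding A by blast
    qed
  qed
qed

end

section \<open>The vector field on the twisted product\<close>

context twisted_product_data
begin

sublocale simplicial_pair F B ..

sublocale T: simplicial_set T by (rule simplicial_set_T)

text \<open>Non-degeneracy involves only simplices and degeneracies, which the twisted and the plain
  product share.\<close>

lemma nondegenerate_T_eq: "nondegenerate T n = prod_cells n"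
  unfolding nondegenerate_product[symmetric]
  by (simp add: nondegenerate_def twisted_product_def product_sset_def)

lemma face_T_bend:
  assumes \<rho>: "\<rho> \<in> prod_cells (Suc n)" and "0 < i"
  shows "face T (Suc n) i \<rho> = prod_face (Suc n) i \<rho>"
  using assms by (cases \<rho>) (simp add: prod_face_def)

text \<open>Twisting affects the face of index \<open>0\<close> only, and only if it decreases the dimension of the base
  component; so it cannot spoil the decrease of the measure.\<close>

lemma path_measure_face:
  assumes \<rho>: "\<rho> \<in> prod_cells (Suc n)" and t: "target_at (Suc n) (vert (Suc n) \<rho>) (horiz (Suc n) \<rho>) k"
    and i: "i \<le> Suc n" "i \<noteq> k" and s: "face T (Suc n) i \<rho> \<in> source_cells (EZ_field F B) n"
  defines "\<sigma> \<equiv> face T (Suc n) i \<rho>" and "\<sigma>0 \<equiv> prod_face (Suc n) k \<rho>"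
  shows "path_measure n (vert n \<sigma>) (horiz n \<sigma>) < path_measure n (vert n \<sigma>0) (horiz n \<sigma>0)"
proof -
  let ?D = "vert (Suc n) \<rho>" and ?E = "horiz (Suc n) \<rho>"
  obtain x y where xy: "\<rho> = (x, y)" "x \<in> simplices F (Suc n)" "y \<in> simplices B (Suc n)"
    and disj: "?D \<inter> ?E = {}" using \<rho> by (cases \<rho>) (auto simp: prod_cells_def)
  note k = target_atD[OF t disj] and f = prod_face_bend[OF \<rho> t, folded \<sigma>0_def]
  have rank0: "rank (vert n \<sigma>0) n = rank ?D (Suc n)" "rank (horiz n \<sigma>0) n = rank ?E (Suc n)"
    using f(1,2) rank_merge_at[of k ?D n] rank_merge_at[of k ?E n] k by auto
  have snd: "snd \<sigma> = face B (Suc n) i y" by (simp add: \<sigma>_def xy)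
  show ?thesis
  proof (cases "i \<in> ?E \<or> 0 < i \<and> i - 1 \<in> ?E")
    \<comment> \<open>No degeneracy of the base component is undone, so its dimension drops. The
      possibly twisted fibre component does not enter.\<close>
    case False
    then have "rank (horiz n \<sigma>) n < rank ?E (Suc n)"
      using B.rank_face_less[OF xy(3) i(1)] by (auto simp: snd xy(1))
    then show ?thesis using rank0 by (intro path_measure_less) simp
  next
    \<comment> \<open>If \<open>i = 0\<close>, then 0 is a degeneracy index of the base component,
      so the face is the untwisted one.\<close>
    case True
    then have \<sigma>: "\<sigma> = (face F (Suc n) i x, face B (Suc n) i y)"
      using face_T_untwisted[OF xy(2,3), of i] xy(1) by (auto simp: \<sigma>_def)
    have E: "horiz n \<sigma> = merge_at i ?E"
      using B.face_of_degenerate(1)[OF xy(3), of i] True by (simp add: \<sigma> xy(1))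
    have rE: "rank (horiz n \<sigma>) n = rank ?E (Suc n)"
    proof -
      obtain q b where c: "core_of B q b (Suc n) y" using B.ex_core_of[OF xy(3)] by blast
      have "core_of B q b n (snd \<sigma>)"
        using B.face_of_degenerate(2)[OF xy(3), of i q b] True c by (simp add: \<sigma> xy(1))
      with c show ?thesis using B.core_of_rank xy(1) by (metis snd_conv)
    qed
    show ?thesis
    proof (cases "i \<in> ?D \<or> 0 < i \<and> i - 1 \<in> ?D")
      case False
      then have "rank (vert n \<sigma>) n < rank ?D (Suc n)"
        using F.rank_face_less[OF xy(2) i(1)] by (auto simp: \<sigma> xy(1))
      then show ?thesis using rank0 rE by (intro path_measure_less) simp
    next
      case degD: True
      have D: "vert n \<sigma> = merge_at i ?D"
        using F.face_of_degenerate(1)[OF xy(2), of i] degD by (simp add: \<sigma> xy(1))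
      \<comment> \<open>A degeneracy is undone in both components and no index lies in both sets; so
        one of the steps \<open>i - 1\<close> and \<open>i\<close> is vertical and the other
        horizontal. This excludes the end points of the path.\<close>
      have corners: "0 < i \<and> i - 1 \<in> ?D \<and> i \<in> ?E \<or> 0 < i \<and> i - 1 \<in> ?E \<and> i \<in> ?D"
        using True degD disj by blast
      then have "i \<in> {..<Suc n}" using vert_bound[of "Suc n" \<rho>] horiz_bound[of "Suc n" \<rho>] by blast
      then have in_range: "i \<le> n" by simp
      \<comment> \<open>An earlier bend would make the face a target; a later one would contradict
        that \<open>k\<close> is the largest event index.\<close>
      have "\<not> (i - 1 \<in> ?D \<and> i \<in> ?E)"
      proof
        assume bend: "i - 1 \<in> ?D \<and> i \<in> ?E"
        with corners have pos: "0 < i" by blast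
        show False
        proof (cases "i < k")
          case True
          then have "target_at n (vert n \<sigma>) (horiz n \<sigma>) (k - 1)"
            using target_at_merge_at[OF t disj pos] bend D E by simp
          with s show False unfolding source_cells_EZ \<sigma>_def[symmetric]
            using source_at_not_target_at by blast
        next
          case False
          with i have "k < i" by simp
          moreover have "event (Suc n) ?D ?E i" using bend pos in_range by (simp add: event_def)
          ultimately show False using k(7) by blast
        qed
      qed
      with corners have c: "0 < i" "i - 1 \<in> ?E" "i \<in> ?D" by blast+
      have rD: "rank (vert n \<sigma>) n = rank ?D (Suc n)"
        using rank_merge_at[of i ?D n] c in_range D by auto
      \<comment> \<open>Both areas are compared with that of the target: cutting its bend subtracts
        1, cutting the other corner adds 1.\<close>
      have "area (steps n (vert n \<sigma>0) (horiz n \<sigma>0)) < area (steps n (vert n \<sigma>) (horiz n \<sigma>))"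
        using area_merge_corner[OF c(1) in_range c(2,3) disj] area_merge_bend[of k n ?D ?E] k disj D E f(1,2)
        by simp
      then show ?thesis using rank0 rE rD by (intro path_measure_less_area) simp_all
    qed
  qed
qed

lemma is_face_T:
  assumes "is_face (normalized_chains T) n s t"
  shows "\<exists>i\<le>Suc n. s = face T (Suc n) i t"
proof (rule ccontr)
  assume *: "\<not> ?thesis"
  have "s \<in> nondegenerate T n"
    and "Poly_Mapping.lookup (bdry (normalized_chains T) (Suc n) (frag_of t)) s \<noteq> 0"
    using assms by (simp_all add: is_face_def)
  moreover have "(\<Sum>i\<le>Suc n. if face T (Suc n) i t = s then (-1) ^ i else (0::int)) = 0"
    by (rule sum.neutral) (use * in auto)
  ultimately show False by (simp only: lookup_bdry_normalized_chains)
qed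

lemma EZ_pair:
  assumes "(s, t) \<in> EZ_field F B n"
  obtains k where "t \<in> prod_cells (Suc n)" "s \<in> prod_cells n" "s = face T (Suc n) k t" "k \<le> Suc n"
    "\<And>i. i \<le> Suc n \<Longrightarrow> i \<noteq> k \<Longrightarrow> face T (Suc n) i t \<in> source_cells (EZ_field F B) n \<Longrightarrow>
      path_measure n (vert n (face T (Suc n) i t)) (horiz n (face T (Suc n) i t))
        < path_measure n (vert n s) (horiz n s)"
proof -
  obtain k where t: "t \<in> prod_cells (Suc n)" and k: "target_at (Suc n) (vert (Suc n) t) (horiz (Suc n) t) k"
    and s: "s = prod_face (Suc n) k t" using assms unfolding EZ_field_iff by blast
  have "vert (Suc n) t \<inter> horiz (Suc n) t = {}" using t by (simp add: prod_cells_def)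
  note k' = target_atD[OF k this]
  show thesis
  proof (rule that[OF t])
    show "s \<in> prod_cells n" "s = face T (Suc n) k t" "k \<le> Suc n"
      using prod_face_bend(5)[OF t k] face_T_bend[OF t k'(1)] k'(2) s by simp_all
  qed (use path_measure_face[OF t k] s in simp)
qed

text \<open>Regularity comes from the measure: another face of the target equal to the source would
  have a measure below its own. So a single term of the boundary contributes, with coefficient
  \<open>(-1) ^ k\<close>.\<close>

lemma discrete_vector_field_EZ: "discrete_vector_field (normalized_chains T) (EZ_field F B)"
proof -
  have "is_regular_face (normalized_chains T) n s t" if st: "(s, t) \<in> EZ_field F B n" for n s t
  proof -
    obtain k where k: "t \<in> prod_cells (Suc n)" "s \<in> prod_cells n" "s = face T (Suc n) k t" "k \<le> Suc n"
      and less: "\<And>i. i \<le> Suc n \<Longrightarrow> i \<noteq> k \<Longrightarrow> face T (Suc n) i t \<in> source_cells (EZ_field F B) n \<Longrightarrow>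
        path_measure n (vert n (face T (Suc n) i t)) (horiz n (face T (Suc n) i t))
          < path_measure n (vert n s) (horiz n s)"
      using EZ_pair[OF st] by blast
    have src: "s \<in> source_cells (EZ_field F B) n" using st by (force simp: source_cells_def)
    have "face T (Suc n) i t \<noteq> s" if "i \<le> Suc n" "i \<noteq> k" for i
      using less[OF that] src by auto
    then have "(\<Sum>i\<le>Suc n. if face T (Suc n) i t = s then (-1) ^ i else (0::int))
        = (\<Sum>i\<in>{k}. if face T (Suc n) i t = s then (-1) ^ i else 0)"
      using k(4) by (intro sum.mono_neutral_right) auto
    then have "Poly_Mapping.lookup (bdry (normalized_chains T) (Suc n) (frag_of t)) s = (-1) ^ k"
      using k(2,3) by (simp add: lookup_bdry_normalized_chains nondegenerate_T_eq del: sum.atMost_Suc)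
    then show ?thesis
      using k(1,2) by (cases "even k") (simp_all add: is_regular_face_def nondegenerate_T_eq)
  qed
  moreover have "inj_on fst (EZ_field F B n)" for n
    using EZ_field_functional by (fastforce intro!: inj_onI)
  moreover have "inj_on snd (EZ_field F B n)" for n
  proof (rule inj_onI)
    fix u v assume uv: "u \<in> EZ_field F B n" "v \<in> EZ_field F B n" and eq: "snd u = snd v"
    then have "fst u = fst v"
      using EZ_field_iff[of "fst u" "snd u" n] EZ_field_iff[of "fst v" "snd v" n] target_at_unique
      by (metis prod.collapse)
    with eq show "u = v" by (simp add: prod_eq_iff)
  qed
  moreover have "fst ` EZ_field F B (Suc n) \<inter> snd ` EZ_field F B n = {}" for n
  proof -
    have "source_cells (EZ_field F B) (Suc n) \<inter> target_cells (EZ_field F B) (Suc n) = {}"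
      unfolding source_cells_EZ target_cells_EZ using source_at_not_target_at by blast
    then show ?thesis by (simp add: source_cells_def target_cells_def)
  qed
  ultimately show ?thesis unfolding discrete_vector_field_def by blast
qed

lemma admissible_EZ: "admissible_field (normalized_chains T) (EZ_field F B)"
proof (rule admissible_fieldI[where \<mu> = "\<lambda>n \<rho>. path_measure n (vert n \<rho>) (horiz n \<rho>)"])
  fix n s t s'
  assume st: "(s, t) \<in> EZ_field F B n" and s': "s' \<in> source_cells (EZ_field F B) n"
    and f: "is_face (normalized_chains T) n s' t" and ne: "s' \<noteq> s"
  obtain i where i: "i \<le> Suc n" "s' = face T (Suc n) i t" using is_face_T[OF f] by blast
  from st show "path_measure n (vert n s') (horiz n s') < path_measure n (vert n s) (horiz n s)"
    by (rule EZ_pair) (use i ne s' in blast)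
qed

sublocale EZ: admissible_vector_field "normalized_chains T" "EZ_field F B"
  by unfold_locales
    (rule T.chain_complex_normalized_chains discrete_vector_field_EZ admissible_EZ)+

lemma bij_critical_cells:
  "bij_betw (critical_simplex F B) (cells (tensor_cpx (normalized_chains F) (normalized_chains B)) n)
    (critical_cells (normalized_chains T) (EZ_field F B) n)"
  using bij_critical_simplex[of n] by (simp add: critical_cells_def nondegenerate_T_eq)

lemma cells_twisted_tensor:
  "cells (twisted_tensor F B act \<tau>) = cells (tensor_cpx (normalized_chains F) (normalized_chains B))"
  by (simp add: twisted_tensor_def)

text \<open>The linear extensions of \<open>critical_simplex\<close> and of its inverse on critical
  cells are the isomorphisms along which the reduction to the critical complex is moved.\<close>

lemma reduction_TEZ:
  "reduction (normalized_chains T) (twisted_tensor F B act \<tau>) (TEZ_f F B act \<tau>) (TEZ_g F B act \<tau>) (TEZ_h F B act \<tau>)"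
proof -
  let ?A = "cells (tensor_cpx (normalized_chains F) (normalized_chains B))"
  let ?K = "critical_cells (normalized_chains T) (EZ_field F B)"
  let ?c = "critical_simplex F B"
  have inv: "inv_into (?A n) ?c (?c u) = u" if "u \<in> ?A n" for n u
    using bij_critical_cells that by (rule bij_betw_inv_into_left)
  have c_inv: "?c (inv_into (?A n) ?c \<rho>) = \<rho>" "inv_into (?A n) ?c \<rho> \<in> ?A n" if "\<rho> \<in> ?K n" for n \<rho>
    using bij_betw_inv_into_right[OF bij_critical_cells that] bij_betw_inv_into[OF bij_critical_cells, of n] that
    by (auto simp: bij_betw_def)
  have to: "to_tensor F B n \<in> hom (free_Abelian_group (?K n)) (free_Abelian_group (?A n))" for n
    unfolding to_tensor_def by (rule frag_extend_hom) (simp add: c_inv)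
  have from': "from_tensor F B \<in> hom (free_Abelian_group (?A n)) (free_Abelian_group (?K n))" for n
    unfolding from_tensor_def using bij_critical_cells[of n] by (intro frag_extend_hom) (auto simp: bij_betw_def)
  have from_to: "from_tensor F B (to_tensor F B n c) = c" if "Poly_Mapping.keys c \<subseteq> ?K n" for n c
    by (rule hom_free_eqI[OF hom_free_comp[OF to from'] hom_free_id[OF order_refl] _ that])
      (simp add: from_tensor_def to_tensor_def c_inv)
  have to_from: "to_tensor F B n (from_tensor F B c) = c" if "Poly_Mapping.keys c \<subseteq> ?A n" for n c
    by (rule hom_free_eqI[OF hom_free_comp[OF from' to] hom_free_id[OF order_refl] _ that])
      (simp add: from_tensor_def to_tensor_def inv)
  have "reduction (normalized_chains T) (twisted_tensor F B act \<tau>)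
     (\<lambda>n c. to_tensor F B n (field_f (normalized_chains T) (EZ_field F B) n c))
     (\<lambda>n c. field_g (normalized_chains T) (EZ_field F B) n (from_tensor F B c))
     (field_h (normalized_chains T) (EZ_field F B))"
    by (rule reduction_transport[OF EZ.reduction_critical_cpx])
      (simp_all add: to from' from_to to_from cells_twisted_tensor, simp add: twisted_tensor_def)
  then show ?thesis by (simp add: TEZ_f_def[abs_def] TEZ_g_def[abs_def] TEZ_h_def)
qed

end

theorem theorem51:
  fixes F :: "'f sset" and B :: "'b sset" and G :: "'g sgroup"
    and act :: "nat \<Rightarrow> 'g \<Rightarrow> 'f \<Rightarrow> 'f" and \<tau> :: "nat \<Rightarrow> 'b \<Rightarrow> 'g"
  assumes "simplicial_set F" and "simplicial_set B" and "simplicial_group G"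
    and "simplicial_action G F act"
    and "twisting_function B G \<tau>"
  shows "discrete_vector_field (twisted_chains F B act \<tau>) (EZ_field F B) \<and>
         admissible_field (twisted_chains F B act \<tau>) (EZ_field F B) \<and>
         (\<forall>n. d21 (twisted_chains F B act \<tau>) (EZ_field F B) (Suc n) \<in>
           iso (free_Abelian_group (target_cells (EZ_field F B) (Suc n)))
               (free_Abelian_group (source_cells (EZ_field F B) n))) \<and>
         (\<forall>n. bij_betw (critical_simplex F B)
           (cells (tensor_cpx (normalized_chains F) (normalized_chains B)) n)
           (critical_cells (twisted_chains F B act \<tau>) (EZ_field F B) n)) \<and>
         cells (twisted_tensor F B act \<tau>) =
           cells (tensor_cpx (normalized_chains F) (normalized_chains B)) \<and>
         reduction (twisted_chains F B act \<tau>) (twisted_tensor F B act \<tau>)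
           (TEZ_f F B act \<tau>) (TEZ_g F B act \<tau>) (TEZ_h F B act \<tau>)"
proof -
  interpret twisted_product_data F B G act \<tau>
    using assms by (intro twisted_product_data.intro)
  show ?thesis
    using discrete_vector_field_EZ admissible_EZ EZ.d21_iso bij_critical_cells cells_twisted_tensor
      reduction_TEZ by blast
qed

end
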